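(* \[ P^{\mathrm{per}}_{\mathrm{red},\ell}\le\Big(p-\Big(\frac{e^{-c^2}}{2\pi}\Big)^{3/2}\frac1{p^2}\cdot\frac{\ell}{3\sqrt k}+O\big(\tfrac1{D^2}\big)\Big)^{\binom{\ell}{2}}, \] \[ \overline P^{\mathrm{per}}_{\mathrm{blue},C\ell}\le\Big(1-p+\Big(\frac{e^{-c^2}}{2\pi}\Big)^{3/2}\frac{C}{(1-p)^2}\cdot\frac{\ell}{3\sqrt k}+O\big(\tfrac1{D^2}\big)\Big)^{\binom{C\ell}{2}}. \]
   Context: Parameters: fix $C>1$; $p_C\in(0,1/2)$ is the unique solution of $C=\frac{\log p_C}{\log(1-p_C)}$; $\alpha_C:=\max\{1000,20\sqrt{C\log(10/p_C)}\}$. $D,\ell_0$ constants with $\ell_0\gg D\gg C$ ($D$ sufficiently large in terms of $C$, $\ell_0$ sufficiently large in terms of $D,C$); $\ell\ge\ell_0$ integer, $k=D^2\ell^2$, $p\in(p_C,1/2)$ fixed, $c:=c_{k,p}$. Quantities like $C\ell$ are treated as integers. $O(\cdot)$: bounded in absolute value by a constant times the expression, the constant depending on $C,p$ (and $p_C,\alpha_C,c$) but not on $D$ or $\ell$. $S^k$ is the unit sphere in $\mathbb R^{k+1}$ with uniform probability. $c_{k,p}\ge0$ is defined by $\mathbb P(\langle\mathbf x,\mathbf e\rangle\le-c_{k,p}/\sqrt k)=p$ for $\mathbf x$ uniform on $S^k$, $\mathbf e$ a fixed unit vector. $G_p(\mathbf x[r])$ is the complete graph on $\mathbf x_1,\dots,\mathbf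 x_r$ with edge $\mathbf x_i\mathbf x_j$ red iff $\langle\mathbf x_i,\mathbf x_j\rangle\le -c/\sqrt k$, blue otherwise. $\pi_{[i]}$ is orthogonal projection onto $\mathrm{span}(\mathbf x_1,\dots,\mathbf x_i)$. $\mathbf x[r]$ is perfect if $|\pi_{[i]}(\mathbf x_{i+1})|\le\alpha_C\sqrt\ell/\sqrt k$ for all $1\le i\le r-1$. For $r$ independent uniform points $\mathbf x[r]$ of $S^k$, $P^{\mathrm{per}}_{\mathrm{red},r}$ (resp. $\overline P^{\mathrm{per}}_{\mathrm{blue},r}$) is the probability that $G_p(\mathbf x[r])$ is a red (resp. blue) clique and $\mathbf x[r]$ is perfect. *)

theory Defs
  imports "HOL-Probability.Probability"
begin

text \<open>
  The dimension \<open>k\<close> varies inside the statement, so \<open>\<real>\<^bsup>k+1\<^esup>\<close> is represented by real functions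
  on the index set \<open>{..k}\<close> (extensional outside it), with Euclidean norm \<open>L2_set _ {..k}\<close>.
\<close>

definition lborel_k :: "nat \<Rightarrow> (nat \<Rightarrow> real) measure" where
  "lborel_k k = Pi\<^sub>M {..k} (\<lambda>_. lborel)"

definition ip :: "nat \<Rightarrow> (nat \<Rightarrow> real) \<Rightarrow> (nat \<Rightarrow> real) \<Rightarrow> real" where
  "ip k x y = (\<Sum>i\<le>k. x i * y i)"

definition unit_ball_k :: "nat \<Rightarrow> (nat \<Rightarrow> real) set" where
  "unit_ball_k k = {x \<in> space (lborel_k k). L2_set x {..k} \<le> 1}"

text \<open>
  The uniform probability measure on \<open>S\<^sup>k\<close>, as the law of \<open>x / |x|\<close> for \<open>x\<close> uniform in the unit
  ball of \<open>\<real>\<^bsup>k+1\<^esup>\<close> (the normalised cone measure). It is a Borel measure on all of \<open>\<real>\<^bsup>k+1\<^esup>\<close>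
  that is concentrated on the unit sphere.
\<close>

definition uniform_sphere :: "nat \<Rightarrow> (nat \<Rightarrow> real) measure" where
  "uniform_sphere k =
     distr (uniform_measure (lborel_k k) (unit_ball_k k)) (lborel_k k)
       (\<lambda>x. \<lambda>i\<in>{..k}. x i / L2_set x {..k})"

lemma ip_self: "ip k x x = (L2_set x {..k})\<^sup>2"
  by (simp add: ip_def L2_set_def sum_nonneg power2_eq_square)

lemma measurable_L2_set_k [measurable]: "(\<lambda>x. L2_set x {..k}) \<in> borel_measurable (lborel_k k)"
  unfolding L2_set_def lborel_k_def by measurable

lemma measurable_normalise_k [measurable]:
  "(\<lambda>x. \<lambda>i\<in>{..k}. x i / L2_set x {..k}) \<in> lborel_k k \<rightarrow>\<^sub>M lborel_k k"
  unfolding L2_set_def lborel_k_def by measurable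

lemma unit_ball_k_sets [measurable]: "unit_ball_k k \<in> sets (lborel_k k)"
  unfolding unit_ball_k_def by measurable

lemma emeasure_unit_ball_k:
  "emeasure (lborel_k k) (unit_ball_k k) = ennreal (unit_ball_vol (real (Suc k)))"
proof -
  have "unit_ball_k k = {f. sqrt (\<Sum>i\<in>{..k}. (f i)\<^sup>2) \<le> 1} \<inter> space (Pi\<^sub>M {..k} (\<lambda>_. lborel))"
    by (auto simp: unit_ball_k_def lborel_k_def L2_set_def)
  then show ?thesis
    using emeasure_cball_aux[of "{..k}" 1] by (simp add: lborel_k_def)
qed

lemma prob_space_uniform_ball_k:
  "prob_space (uniform_measure (lborel_k k) (unit_ball_k k))"
  by (rule prob_space_uniform_measure)
    (auto simp: emeasure_unit_ball_k less_imp_neq[OF unit_ball_vol_pos, symmetric])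

lemma prob_space_uniform_sphere: "prob_space (uniform_sphere k)"
  unfolding uniform_sphere_def
  by (rule prob_space.prob_space_distr[OF prob_space_uniform_ball_k]) simp

lemma AE_uniform_sphere: "AE x in uniform_sphere k. L2_set x {..k} = 1"
proof -
  interpret product_sigma_finite "\<lambda>_::nat. lborel :: real measure" ..
  let ?z = "\<lambda>i\<in>{..k}. 0 :: real"
  have "AE x in lborel_k k. x \<noteq> ?z"
  proof (rule AE_I[where N = "{?z}"])
    have z: "{?z} = Pi\<^sub>E {..k} (\<lambda>_. {0::real})"
      by (auto simp: PiE_def extensional_def restrict_def fun_eq_iff)
    show "emeasure (lborel_k k) {?z} = 0"
      unfolding z lborel_k_def by (subst emeasure_PiM) auto
    show "{?z} \<in> sets (lborel_k k)"
      unfolding z lborel_k_def by (intro sets_PiM_I_finite) auto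
  qed auto
  then have "AE x in lborel_k k. x \<in> unit_ball_k k \<longrightarrow>
      L2_set (\<lambda>i\<in>{..k}. x i / L2_set x {..k}) {..k} = 1"
  proof (eventually_elim, intro impI)
    fix x :: "nat \<Rightarrow> real"
    assume x: "x \<noteq> ?z" "x \<in> unit_ball_k k"
    have "x \<in> extensional {..k}"
      using x(2) by (auto simp: unit_ball_k_def lborel_k_def space_PiM PiE_def)
    then have "\<exists>i\<in>{..k}. x i \<noteq> 0"
      using x(1) by (metis (mono_tags, lifting) extensionalityI restrict_apply' restrict_extensional)
    then have pos: "L2_set x {..k} \<noteq> 0"
      by (auto simp: L2_set_eq_0_iff)
    have "L2_set (\<lambda>i\<in>{..k}. x i / L2_set x {..k}) {..k}
        = L2_set (\<lambda>i. inverse (L2_set x {..k}) * x i) {..k}"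
      by (intro L2_set_cong) (auto simp: divide_inverse mult.commute)
    also have "\<dots> = inverse (L2_set x {..k}) * L2_set x {..k}"
      by (rule L2_set_right_distrib[symmetric]) (simp add: L2_set_nonneg)
    finally show "L2_set (\<lambda>i\<in>{..k}. x i / L2_set x {..k}) {..k} = 1"
      using pos by simp
  qed
  then have "AE x in uniform_measure (lborel_k k) (unit_ball_k k).
      L2_set (\<lambda>i\<in>{..k}. x i / L2_set x {..k}) {..k} = 1"
    by (intro AE_uniform_measureI) auto
  then show ?thesis
    unfolding uniform_sphere_def by (subst AE_distr_iff) auto
qed

definition p_C :: "real \<Rightarrow> real" where
  "p_C C = (THE p. 0 < p \<and> p < 1/2 \<and> C = ln p / ln (1 - p))"

definition alpha_C :: "real \<Rightarrow> real" where
  "alpha_C C = max 1000 (20 * sqrt (C * ln (10 / p_C C)))"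

definition e0 :: "nat \<Rightarrow> nat \<Rightarrow> real" where
  "e0 k = (\<lambda>i\<in>{..k}. if i = 0 then 1 else 0)"

definition c_kp :: "nat \<Rightarrow> real \<Rightarrow> real" where
  "c_kp k p = (THE c. 0 \<le> c \<and>
     measure (uniform_sphere k) {x \<in> space (uniform_sphere k). ip k x (e0 k) \<le> - c / sqrt (real k)} = p)"

datatype colour = Red | Blue

text \<open>The colouring \<open>G\<^sub>p(x[r])\<close>: the colour of the edge between the points \<open>x i\<close> and \<open>x j\<close>.\<close>

definition edge_colour :: "nat \<Rightarrow> real \<Rightarrow> (nat \<Rightarrow> nat \<Rightarrow> real) \<Rightarrow> nat \<Rightarrow> nat \<Rightarrow> colour" where
  "edge_colour k p x i j = (if ip k (x i) (x j) \<le> - c_kp k p / sqrt (real k) then Red else Blue)"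

definition mono_clique :: "colour \<Rightarrow> nat \<Rightarrow> real \<Rightarrow> nat \<Rightarrow> (nat \<Rightarrow> nat \<Rightarrow> real) \<Rightarrow> bool" where
  "mono_clique col k p r x \<longleftrightarrow>
     (\<forall>i\<in>{1..r}. \<forall>j\<in>{1..r}. i \<noteq> j \<longrightarrow> edge_colour k p x i j = col)"

definition span_k :: "nat \<Rightarrow> (nat \<Rightarrow> nat \<Rightarrow> real) \<Rightarrow> nat set \<Rightarrow> (nat \<Rightarrow> real) set" where
  "span_k k x I = {v. \<exists>a. v = (\<lambda>j\<in>{..k}. \<Sum>i\<in>I. a i * x i j)}"

definition orth_proj :: "nat \<Rightarrow> (nat \<Rightarrow> real) set \<Rightarrow> (nat \<Rightarrow> real) \<Rightarrow> nat \<Rightarrow> real" where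
  "orth_proj k S u = (THE v. v \<in> S \<and> (\<forall>w\<in>S. ip k (\<lambda>j. u j - v j) w = 0))"

text \<open>The threshold for perfectness always involves \<open>\<ell>\<close>, also for sequences of length \<open>r \<noteq> \<ell>\<close>.\<close>

definition perfect :: "real \<Rightarrow> nat \<Rightarrow> nat \<Rightarrow> nat \<Rightarrow> (nat \<Rightarrow> nat \<Rightarrow> real) \<Rightarrow> bool" where
  "perfect C l k r x \<longleftrightarrow>
     (\<forall>i. 1 \<le> i \<and> i < r \<longrightarrow>
        L2_set (orth_proj k (span_k k x {1..i}) (x (Suc i))) {..k}
          \<le> alpha_C C * sqrt (real l) / sqrt (real k))"

text \<open>\<open>P_per Red C l k p r\<close> and \<open>P_per Blue C l k p r\<close> are the probabilities of perfect red and blue \<open>r\<close>-cliques.\<close>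

definition P_per :: "colour \<Rightarrow> real \<Rightarrow> nat \<Rightarrow> nat \<Rightarrow> real \<Rightarrow> nat \<Rightarrow> real" where
  "P_per col C l k p r =
     (let M = Pi\<^sub>M {1..r} (\<lambda>_. uniform_sphere k)
      in measure M {x \<in> space M. mono_clique col k p r x \<and> perfect C l k r x})"

end

theory Submission
  imports Defs
begin

text \<open>
  Let \<open>q\<close> be the probability of the colour and \<open>H = \<phi>(c) / q\<close>. A uniform point of the sphere is a standard Gaussian vector
  \<open>g\<close> divided by its independent norm, which is close to \<open>\<surd>k\<close>. Given perfect earlier points
  \<open>x\<^sub>1, \<dots>, x\<^sub>n\<close>, the probability that the next one has the right colour to all of them is that of a
  Gaussian orthant event; integrating out the coordinates of \<open>g\<close> along the Gram--Schmidt basis one at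
  a time, log-concavity of the Gaussian distribution function bounds it by
  \<open>q\<^sup>n exp (H\<^sup>2 \<Sum>\<^bsub>i<j\<^esub> \<langle>x\<^sub>i, x\<^sub>j\<rangle>)\<close> up to a factor \<open>exp (O(\<ell> / D\<^sup>2))\<close>, which is negligible at
  this order. Peeling off the points from the last one, the exponential becomes a linear tilt of the
  point removed next; the tilts together contribute \<open>\<mp>H\<^sup>3 (r choose 3) / \<surd>k\<close> to the exponent, which
  is the claimed first order term. Only the bound on the projections from perfectness is used
  to control the errors.

  As \<open>K\<close> may depend on \<open>p\<close>, values of \<open>D\<close> that are small compared with \<open>p\<close> are trivial: the error
  term then makes the base at least \<open>1\<close>.
\<close>

section \<open>Lebesgue and Gaussian measure on coordinate space\<close>

text \<open>The claim tolerates O(1/D^2) per edge, hence O(l/D^2) in the exponent for each removed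
  point, and this budget fixes the parameters. Norm concentration is only Chebyshev's inequality, so
  exchanging sphere and Gaussian costs a factor 2 per point; the resulting \<open>2 ^ r\<close> is
  within budget once l is at least of order D^2. The relative width \<delta> of the norm window must
  make \<delta> sqrt l of order 1/D^2 while 1/(\<delta>^2 k) is at most that order; \<delta> =
  1/(D^2 sqrt l) does both if l \<ge> 10 D^4, as k is about D^2 l^2. Perfectness bounds the squared
  off-diagonal part of each Cholesky row by \<tau> = O(1/(D^2 l)), so row sums are O(1/D) and r
  \<tau> is O(1/D^2). The cube of H is H^2 times H: every removed point leaves H^2 times the sum of
  inner products in the exponent, and a tilt s of the next point contributes -\<epsilon> H s / sqrt
  k for each of its constraints. As (r choose 3) = (r choose 2) (r - 2) / 3, each edge receives the
  factor \<open>Phi b\<close> exp (-\<epsilon> H^3 (r - 2) / (3 sqrt k)); one of the three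
  denominators q in H^3 cancels against \<open>Phi b\<close>, leaving q^2.\<close>

lemma sigma_finite_lborel_k: "sigma_finite_measure (lborel_k k)"
proof -
  interpret product_sigma_finite "\<lambda>_::nat. lborel :: real measure" ..
  show ?thesis unfolding lborel_k_def by (rule sigma_finite) simp
qed

lemma space_lborel_k: "space (lborel_k k) = extensional {..k}"
  by (auto simp: lborel_k_def space_PiM PiE_def)

lemma measurable_lborel_k_component [measurable (raw)]:
  assumes "f \<in> M \<rightarrow>\<^sub>M lborel_k k" "i \<le> k"
  shows "(\<lambda>x. f x i) \<in> borel_measurable M"
  using measurable_compose[OF assms(1)[unfolded lborel_k_def] measurable_component_singleton[of i]] assms(2)
  by (simp add: comp_def)

lemma measurable_lborel_k_restrict [measurable (raw)]:
  assumes "\<And>i. i \<le> k \<Longrightarrow> (\<lambda>x. f x i) \<in> borel_measurable M"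
  shows "(\<lambda>x. \<lambda>i\<in>{..k}. f x i) \<in> M \<rightarrow>\<^sub>M lborel_k k"
  unfolding lborel_k_def using assms by (intro measurable_restrict) auto

lemma measurable_ip [measurable (raw)]:
  assumes "\<And>i. i \<le> k \<Longrightarrow> (\<lambda>x. f x i) \<in> borel_measurable M"
    and "\<And>i. i \<le> k \<Longrightarrow> (\<lambda>x. g x i) \<in> borel_measurable M"
  shows "(\<lambda>x. ip k (f x) (g x)) \<in> borel_measurable M"
  unfolding ip_def using assms by measurable

text \<open>The preimage of a box is a box, so uniqueness of the product measure reduces this to
  \<open>lborel_real_affine\<close> in each coordinate. Translations drive the shears of the
  Gaussian rotation; dilations drive the cone argument on the sphere.\<close>

lemma lborel_k_affine:
  fixes c :: real and t :: "nat \<Rightarrow> real"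
  assumes c: "c \<noteq> 0"
  shows "lborel_k k = density (distr (lborel_k k) (lborel_k k) (\<lambda>x. \<lambda>i\<in>{..k}. t i + c * x i))
           (\<lambda>_. ennreal (\<bar>c\<bar> ^ Suc k))" (is "_ = ?D")
proof -
  interpret product_sigma_finite "\<lambda>_::nat. lborel :: real measure" ..
  have [measurable]: "(\<lambda>x. \<lambda>i\<in>{..k}. t i + c * x i) \<in> lborel_k k \<rightarrow>\<^sub>M lborel_k k"
    by measurable
  have "?D = lborel_k k"
    unfolding lborel_k_def
  proof (rule PiM_eqI)
    fix A :: "nat \<Rightarrow> real set"
    assume A: "\<And>i. i \<in> {..k} \<Longrightarrow> A i \<in> sets lborel"
    have [measurable]: "Pi\<^sub>E {..k} A \<in> sets (lborel_k k)"
      unfolding lborel_k_def using A by (intro sets_PiM_I_finite) auto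
    have B: "(\<lambda>x. t i + c * x) -` A i \<in> sets lborel" if "i \<le> k" for i
      using A[of i] that measurable_sets_borel[of "\<lambda>x. t i + c * x" borel "A i"] by simp
    have vim: "(\<lambda>x. \<lambda>i\<in>{..k}. t i + c * x i) -` Pi\<^sub>E {..k} A \<inter> space (lborel_k k)
        = Pi\<^sub>E {..k} (\<lambda>i. (\<lambda>x. t i + c * x) -` A i)"
      unfolding space_lborel_k PiE_def Pi_def by fastforce
    have "emeasure (density (distr (lborel_k k) (lborel_k k) (\<lambda>x. \<lambda>i\<in>{..k}. t i + c * x i))
           (\<lambda>_. ennreal (\<bar>c\<bar> ^ Suc k))) (Pi\<^sub>E {..k} A)
        = ennreal (\<bar>c\<bar> ^ Suc k) * emeasure (lborel_k k) (Pi\<^sub>E {..k} (\<lambda>i. (\<lambda>x. t i + c * x) -` A i))"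
      by (simp add: emeasure_density_const emeasure_distr vim)
    also have "\<dots> = ennreal (\<bar>c\<bar> ^ Suc k) * (\<Prod>i\<le>k. emeasure lborel ((\<lambda>x. t i + c * x) -` A i))"
      unfolding lborel_k_def using B by (subst emeasure_PiM) auto
    also have "\<dots> = (\<Prod>i\<le>k. ennreal \<bar>c\<bar> * emeasure lborel ((\<lambda>x. t i + c * x) -` A i))"
      by (simp add: prod.distrib ennreal_power ennreal_mult)
    also have "\<dots> = (\<Prod>i\<in>{..k}. emeasure lborel (A i))"
    proof (rule prod.cong)
      fix i assume i: "i \<in> {..k}"
      have "emeasure lborel (A i) =
          emeasure (density (distr lborel borel (\<lambda>x. t i + c * x)) (\<lambda>_. ennreal \<bar>c\<bar>)) (A i)"
        using lborel_real_affine[OF c, of "t i"] by simp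
      also have "\<dots> = ennreal \<bar>c\<bar> * emeasure lborel ((\<lambda>x. t i + c * x) -` A i)"
        using A[OF i] by (simp add: emeasure_density_const emeasure_distr)
      finally show "ennreal \<bar>c\<bar> * emeasure lborel ((\<lambda>x. t i + c * x) -` A i) = emeasure lborel (A i)"
        by simp
    qed simp
    finally show "emeasure (density (distr (Pi\<^sub>M {..k} (\<lambda>_. lborel)) (Pi\<^sub>M {..k} (\<lambda>_. lborel)) (\<lambda>x. \<lambda>i\<in>{..k}. t i + c * x i))
           (\<lambda>_. ennreal (\<bar>c\<bar> ^ Suc k))) (Pi\<^sub>E {..k} A) = (\<Prod>i\<in>{..k}. emeasure lborel (A i))"
      by (simp add: lborel_k_def)
  qed simp_all
  then show ?thesis by simp
qed

lemma nn_integral_lborel_k_affine: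
  assumes [measurable]: "f \<in> borel_measurable (lborel_k k)" and c: "c \<noteq> 0"
  shows "(\<integral>\<^sup>+x. f x \<partial>lborel_k k)
    = ennreal (\<bar>c\<bar> ^ Suc k) * (\<integral>\<^sup>+x. f (\<lambda>i\<in>{..k}. t i + c * x i) \<partial>lborel_k k)"
  by (subst lborel_k_affine[OF c, of k t])
    (simp add: nn_integral_density nn_integral_distr nn_integral_cmult)

lemma nn_integral_lborel_k_translate:
  assumes [measurable]: "f \<in> borel_measurable (lborel_k k)"
  shows "(\<integral>\<^sup>+x. f (\<lambda>i\<in>{..k}. t i + x i) \<partial>lborel_k k) = (\<integral>\<^sup>+x. f x \<partial>lborel_k k)"
  using nn_integral_lborel_k_affine[of f k 1 t] by simp

section \<open>Standard Gaussian measure and resampling of one coordinate\<close>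

abbreviation phi :: "real \<Rightarrow> real" where
  "phi \<equiv> std_normal_density"

definition gauss_k :: "nat \<Rightarrow> (nat \<Rightarrow> real) measure" where
  "gauss_k k = Pi\<^sub>M {..k} (\<lambda>_. density lborel (\<lambda>x. ennreal (phi x)))"

abbreviation std_normal :: "real measure" where
  "std_normal \<equiv> density lborel (\<lambda>x. ennreal (phi x))"

text \<open>The Gaussian density in radial form; \<open>gauss_weight_prod\<close> identifies it with
  the product of the marginals. Rotation invariance and the polar decomposition both use that it
  depends on the norm only.\<close>

definition gauss_weight :: "nat \<Rightarrow> (nat \<Rightarrow> real) \<Rightarrow> real" where
  "gauss_weight k x = (1 / sqrt (2 * pi)) ^ Suc k * exp (- ip k x x / 2)"

lemma gauss_weight_prod: "gauss_weight k x = (\<Prod>i\<le>k. phi (x i))"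
proof -
  have "exp (- (\<Sum>i\<le>k. x i * x i) / 2) = (\<Prod>i\<le>k. exp (- (x i)\<^sup>2 / 2))"
    by (subst exp_sum[symmetric]) (auto simp: sum_negf[symmetric] sum_divide_distrib power2_eq_square)
  then show ?thesis
    unfolding gauss_weight_def std_normal_density_def prod.distrib ip_def by simp
qed

lemma gauss_weight_nonneg: "0 \<le> gauss_weight k x"
  by (simp add: gauss_weight_def)

lemma measurable_gauss_weight [measurable]: "gauss_weight k \<in> borel_measurable (lborel_k k)"
  unfolding gauss_weight_def by measurable

lemma sets_gauss_k [measurable_cong, simp]: "sets (gauss_k k) = sets (lborel_k k)"
  unfolding gauss_k_def lborel_k_def by (intro sets_PiM_cong) auto

lemma space_gauss_k: "space (gauss_k k) = extensional {..k}"
  by (metis sets_eq_imp_space_eq sets_gauss_k space_lborel_k)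

lemma prob_space_gauss_k: "prob_space (gauss_k k)"
  unfolding gauss_k_def by (intro prob_space_PiM prob_space_normal_density) simp

lemma gauss_k_density: "gauss_k k = density (lborel_k k) (\<lambda>x. ennreal (gauss_weight k x))"
proof -
  interpret N: prob_space std_normal
    by (rule prob_space_normal_density) simp
  interpret NP: product_sigma_finite "\<lambda>_::nat. std_normal" ..
  interpret product_sigma_finite "\<lambda>_::nat. lborel :: real measure" ..
  have "density (lborel_k k) (\<lambda>x. ennreal (gauss_weight k x)) = gauss_k k"
    unfolding gauss_k_def
  proof (rule NP.PiM_eqI)
    show "sets (density (lborel_k k) (\<lambda>x. ennreal (gauss_weight k x))) = sets (Pi\<^sub>M {..k} (\<lambda>_. std_normal))"
      using sets_gauss_k unfolding gauss_k_def by simp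
    fix A :: "nat \<Rightarrow> real set"
    assume A: "\<And>i. i \<in> {..k} \<Longrightarrow> A i \<in> sets std_normal"
    then have A'[measurable]: "\<And>i. i \<in> {..k} \<Longrightarrow> A i \<in> sets borel"
      by simp
    have PA [measurable]: "Pi\<^sub>E {..k} A \<in> sets (lborel_k k)"
      unfolding lborel_k_def using A by (intro sets_PiM_I_finite) auto
    have "emeasure (density (lborel_k k) (\<lambda>x. ennreal (gauss_weight k x))) (Pi\<^sub>E {..k} A)
        = (\<integral>\<^sup>+x. ennreal (gauss_weight k x) * indicator (Pi\<^sub>E {..k} A) x \<partial>lborel_k k)"
      by (rule emeasure_density) measurable
    also have "\<dots> = (\<integral>\<^sup>+x. (\<Prod>i\<in>{..k}. ennreal (phi (x i)) * indicator (A i) (x i)) \<partial>lborel_k k)"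
    proof (rule nn_integral_cong)
      fix x assume x: "x \<in> space (lborel_k k)"
      have "indicator (Pi\<^sub>E {..k} A) x = (\<Prod>i\<le>k. indicator (A i) (x i) :: ennreal)"
      proof (cases "x \<in> Pi\<^sub>E {..k} A")
        case False
        then obtain i where "i \<le> k" "x i \<notin> A i"
          using x by (auto simp: space_lborel_k PiE_def)
        then have "(\<Prod>i\<le>k. indicator (A i) (x i) :: ennreal) = 0"
          by (intro prod_zero bexI[of _ i]) auto
        with False show ?thesis by simp
      qed (auto simp: PiE_def Pi_def)
      then show "ennreal (gauss_weight k x) * indicator (Pi\<^sub>E {..k} A) x
          = (\<Prod>i\<in>{..k}. ennreal (phi (x i)) * indicator (A i) (x i))"
        by (simp add: gauss_weight_prod prod_ennreal prod.distrib)
    qed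
    also have "\<dots> = (\<Prod>i\<in>{..k}. \<integral>\<^sup>+y. ennreal (phi y) * indicator (A i) y \<partial>lborel)"
      unfolding lborel_k_def by (rule product_nn_integral_prod) auto
    also have "\<dots> = (\<Prod>i\<in>{..k}. emeasure std_normal (A i))"
      by (intro prod.cong refl emeasure_density[symmetric]) auto
    finally show "emeasure (density (lborel_k k) (\<lambda>x. ennreal (gauss_weight k x))) (Pi\<^sub>E {..k} A)
        = (\<Prod>i\<in>{..k}. emeasure std_normal (A i))" .
  qed simp
  then show ?thesis by simp
qed

lemma nn_integral_gauss_k:
  assumes [measurable]: "f \<in> borel_measurable (lborel_k k)"
  shows "(\<integral>\<^sup>+x. f x \<partial>gauss_k k) = (\<integral>\<^sup>+x. ennreal (gauss_weight k x) * f x \<partial>lborel_k k)"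
  unfolding gauss_k_density by (rule nn_integral_density) measurable

lemma ip_restrict [simp]:
  "ip k (\<lambda>i\<in>{..k}. f i) y = ip k f y" "ip k x (\<lambda>i\<in>{..k}. f i) = ip k x f"
  by (simp_all add: ip_def)

lemma ip_commute: "ip k x y = ip k y x"
  by (simp add: ip_def mult.commute)

lemma ip_diff_left: "ip k (\<lambda>i. f i - g i) y = ip k f y - ip k g y"
  by (simp add: ip_def sum_subtractf algebra_simps)

lemma ip_scale_left: "ip k (\<lambda>i. c * f i) y = c * ip k f y"
  by (simp add: ip_def sum_distrib_left algebra_simps)

lemma ip_sum_left: "ip k (\<lambda>i. \<Sum>s\<in>I. f s i) y = (\<Sum>s\<in>I. ip k (f s) y)"
  unfolding ip_def sum_distrib_right by (rule sum.swap)

lemma ip_diff_right: "ip k y (\<lambda>i. f i - g i) = ip k y f - ip k y g"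
  by (simp add: ip_commute[of k y] ip_diff_left)

lemma ip_scale_right: "ip k y (\<lambda>i. c * f i) = c * ip k y f"
  by (simp add: ip_commute[of k y] ip_scale_left)

lemma ip_sum_right: "ip k y (\<lambda>i. \<Sum>s\<in>I. f s i) = (\<Sum>s\<in>I. ip k y (f s))"
  by (simp add: ip_commute[of k y] ip_sum_left)

text \<open>
  The quarter turn in the plane of \<open>\<langle>g, e\<rangle>\<close> and an independent coordinate \<open>h\<close> is a product of three
  shears, each of which preserves Lebesgue measure by Fubini and translation invariance.
\<close>

lemma gauss_k_resample:
  assumes F [measurable]: "F \<in> borel_measurable (lborel_k k)" and e: "ip k e e = 1"
  shows "(\<integral>\<^sup>+g. F g \<partial>gauss_k k) =
    (\<integral>\<^sup>+g. (\<integral>\<^sup>+h. F (\<lambda>i\<in>{..k}. g i - (ip k g e + h) * e i) \<partial>std_normal) \<partial>gauss_k k)"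
proof -
  interpret sigma_finite_measure "lborel_k k" by (rule sigma_finite_lborel_k)
  interpret P: pair_sigma_finite "lborel_k k" "lborel :: real measure" ..
  let ?s = "\<lambda>g h. \<lambda>i\<in>{..k}. g i - h * e i"
  define I where "I H = (\<integral>\<^sup>+g. (\<integral>\<^sup>+h. H (g, h) \<partial>lborel) \<partial>lborel_k k)"
    for H :: "(nat \<Rightarrow> real) \<times> real \<Rightarrow> ennreal"
  have I1: "I (\<lambda>(g, h). H (?s g h, h)) = I H"
    if [measurable]: "H \<in> borel_measurable (lborel_k k \<Otimes>\<^sub>M lborel)" for H
  proof -
    have "I (\<lambda>(g, h). H (?s g h, h)) = (\<integral>\<^sup>+h. (\<integral>\<^sup>+g. H (?s g h, h) \<partial>lborel_k k) \<partial>lborel)"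
      unfolding I_def by (subst P.Fubini') (simp_all add: case_prod_beta)
    also have "\<dots> = (\<integral>\<^sup>+h. (\<integral>\<^sup>+g. H (g, h) \<partial>lborel_k k) \<partial>lborel)"
    proof (rule nn_integral_cong)
      fix h :: real
      show "(\<integral>\<^sup>+g. H (?s g h, h) \<partial>lborel_k k) = (\<integral>\<^sup>+g. H (g, h) \<partial>lborel_k k)"
        using nn_integral_lborel_k_translate[of "\<lambda>g. H (g, h)" k "\<lambda>i. - h * e i"] by simp
    qed
    also have "\<dots> = I H"
      unfolding I_def by (subst P.Fubini') simp_all
    finally show ?thesis .
  qed
  have I2: "I (\<lambda>(g, h). H (g, h + ip k g e)) = I H"
    if [measurable]: "H \<in> borel_measurable (lborel_k k \<Otimes>\<^sub>M lborel)" for H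
    unfolding I_def
  proof (rule nn_integral_cong)
    fix g assume [measurable]: "g \<in> space (lborel_k k)"
    show "(\<integral>\<^sup>+h. (case (g, h) of (g, h) \<Rightarrow> H (g, h + ip k g e)) \<partial>lborel) = (\<integral>\<^sup>+h. H (g, h) \<partial>lborel)"
      using nn_integral_real_affine[of "\<lambda>h. H (g, h)" 1 "ip k g e"] by (simp add: add.commute)
  qed
  define H :: "(nat \<Rightarrow> real) \<times> real \<Rightarrow> ennreal" where
    "H = (\<lambda>(g, h). ennreal (gauss_weight k g) * ennreal (phi h) * F g)"
  have [measurable]: "H \<in> borel_measurable (lborel_k k \<Otimes>\<^sub>M lborel)"
    unfolding H_def by measurable
  have "I H = I (\<lambda>(g, h). H (?s g h, h))"
    by (rule I1[symmetric]) measurable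
  also have "\<dots> = I (\<lambda>(g, h). (case (g, h + ip k g e) of (g, h) \<Rightarrow> H (?s g h, h)))"
    using I2[of "\<lambda>(g, h). H (?s g h, h)"] by simp
  also have "\<dots> = I (\<lambda>(g, h). H (?s g (h + ip k g e), h + ip k g e))"
    by simp
  also have "\<dots> = I (\<lambda>(g, h). (case (?s g h, h) of (g, h) \<Rightarrow> H (?s g (h + ip k g e), h + ip k g e)))"
    using I1[of "\<lambda>(g, h). H (?s g (h + ip k g e), h + ip k g e)"] by simp
  also have "\<dots> = I (\<lambda>(g, h). ennreal (gauss_weight k g) * ennreal (phi h)
      * F (\<lambda>i\<in>{..k}. g i - (ip k g e + h) * e i))"
    unfolding I_def
  proof (intro nn_integral_cong)
    fix g :: "nat \<Rightarrow> real" and h :: real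
    \<comment> \<open>The composite of the three shears sends the coordinates
      (\<open>ip k g e\<close>, h) to (-h, \<open>ip k g e\<close>). This preserves |g|^2 + h^2, so
      the product of the two densities is the same before and after. It is also the reason why the
      resampled coordinate appears as -h.\<close>
    have 1: "h + ip k (?s g h) e = ip k g e"
      using e by (simp add: ip_diff_left ip_scale_left)
    have 2: "?s (?s g h) (ip k g e) = (\<lambda>i\<in>{..k}. g i - (ip k g e + h) * e i)"
      by (auto simp: algebra_simps)
    have 3: "ip k (\<lambda>i. g i - (ip k g e + h) * e i) (\<lambda>i. g i - (ip k g e + h) * e i)
        = ip k g g - (ip k g e)\<^sup>2 + h\<^sup>2"
      unfolding ip_diff_left ip_scale_left ip_diff_right ip_scale_right ip_commute[of k e g] e
      by (simp add: power2_eq_square algebra_simps)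
    have "gauss_weight k (\<lambda>i\<in>{..k}. g i - (ip k g e + h) * e i) * phi (ip k g e)
        = gauss_weight k g * phi h"
      unfolding gauss_weight_def std_normal_density_def ip_restrict 3
      by (simp add: exp_add[symmetric] diff_divide_distrib add_divide_distrib)
    then have "ennreal (gauss_weight k (\<lambda>i\<in>{..k}. g i - (ip k g e + h) * e i)) * ennreal (phi (ip k g e))
        = ennreal (gauss_weight k g) * ennreal (phi h)"
      by (simp only: ennreal_mult[symmetric] gauss_weight_nonneg normal_density_nonneg)
    then show "(case (g, h) of (g, h) \<Rightarrow> case (?s g h, h) of (g, h) \<Rightarrow> H (?s g (h + ip k g e), h + ip k g e))
      = (case (g, h) of (g, h) \<Rightarrow> ennreal (gauss_weight k g) * ennreal (phi h)
          * F (\<lambda>i\<in>{..k}. g i - (ip k g e + h) * e i))"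
      unfolding prod.case 1 2 H_def by simp
  qed
  finally have *: "I H = I (\<lambda>(g, h). ennreal (gauss_weight k g) * ennreal (phi h)
      * F (\<lambda>i\<in>{..k}. g i - (ip k g e + h) * e i))" .
  interpret N: prob_space std_normal
    by (rule prob_space_normal_density) simp
  have N1: "(\<integral>\<^sup>+h. ennreal (phi h) \<partial>lborel) = 1"
    using N.emeasure_space_1 by (simp add: emeasure_density)
  have "I H = (\<integral>\<^sup>+g. F g \<partial>gauss_k k)"
  proof -
    have "(\<integral>\<^sup>+h. H (g, h) \<partial>lborel) = ennreal (gauss_weight k g) * F g" for g
    proof -
      have "(\<integral>\<^sup>+h. H (g, h) \<partial>lborel) = (\<integral>\<^sup>+h. (ennreal (gauss_weight k g) * F g) * ennreal (phi h) \<partial>lborel)"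
        by (simp add: H_def ac_simps)
      also have "\<dots> = ennreal (gauss_weight k g) * F g"
        by (subst nn_integral_cmult) (simp_all add: N1)
      finally show ?thesis .
    qed
    then show ?thesis
      unfolding I_def by (simp add: nn_integral_gauss_k)
  qed
  moreover have "I (\<lambda>(g, h). ennreal (gauss_weight k g) * ennreal (phi h)
      * F (\<lambda>i\<in>{..k}. g i - (ip k g e + h) * e i))
    = (\<integral>\<^sup>+g. (\<integral>\<^sup>+h. F (\<lambda>i\<in>{..k}. g i - (ip k g e + h) * e i) \<partial>std_normal) \<partial>gauss_k k)"
    unfolding I_def
    by (subst nn_integral_gauss_k) (auto intro!: nn_integral_cong simp: nn_integral_density nn_integral_cmult[symmetric] ac_simps)
  ultimately show ?thesis using * by simp
qed

lemma nn_integral_std_normal_reflect: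
  assumes [measurable]: "f \<in> borel_measurable borel"
  shows "(\<integral>\<^sup>+h. f (- h) \<partial>std_normal) = (\<integral>\<^sup>+h. f h \<partial>std_normal)"
proof -
  have "(\<integral>\<^sup>+h. f (- h) \<partial>std_normal) = (\<integral>\<^sup>+h. ennreal (phi (0 + (-1) * h)) * f (0 + (-1) * h) \<partial>lborel)"
    by (subst nn_integral_density) (simp_all add: std_normal_density_def)
  also have "\<dots> = (\<integral>\<^sup>+h. f h \<partial>std_normal)"
    using nn_integral_real_affine[of "\<lambda>h. ennreal (phi h) * f h" "-1" 0]
    by (simp add: nn_integral_density)
  finally show ?thesis .
qed

text \<open>After resampling, the coordinate along e is -h with h standard normal, whatever g
  is.\<close>

lemma gauss_k_marginal:
  assumes [measurable]: "f \<in> borel_measurable borel" and e: "ip k e e = 1"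
  shows "(\<integral>\<^sup>+g. f (ip k g e) \<partial>gauss_k k) = (\<integral>\<^sup>+h. f h \<partial>std_normal)"
proof -
  interpret prob_space "gauss_k k" by (rule prob_space_gauss_k)
  have "(\<integral>\<^sup>+g. f (ip k g e) \<partial>gauss_k k)
      = (\<integral>\<^sup>+g. (\<integral>\<^sup>+h. f (ip k (\<lambda>i\<in>{..k}. g i - (ip k g e + h) * e i) e) \<partial>std_normal) \<partial>gauss_k k)"
    by (rule gauss_k_resample[OF _ e]) measurable
  also have "\<dots> = (\<integral>\<^sup>+g. (\<integral>\<^sup>+h. f (- h) \<partial>std_normal) \<partial>gauss_k k)"
    using e by (simp add: ip_diff_left ip_scale_left)
  also have "\<dots> = (\<integral>\<^sup>+h. f (- h) \<partial>std_normal)"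
    by (simp add: emeasure_space_1)
  also have "\<dots> = (\<integral>\<^sup>+h. f h \<partial>std_normal)"
    by (rule nn_integral_std_normal_reflect) measurable
  finally show ?thesis .
qed

section \<open>Polar decomposition of the Gaussian\<close>

abbreviation normalise_k :: "nat \<Rightarrow> (nat \<Rightarrow> real) \<Rightarrow> nat \<Rightarrow> real" where
  "normalise_k k x \<equiv> (\<lambda>i\<in>{..k}. x i / L2_set x {..k})"

lemma sets_uniform_sphere [measurable_cong, simp]: "sets (uniform_sphere k) = sets (lborel_k k)"
  by (simp add: uniform_sphere_def)

lemma space_uniform_sphere: "space (uniform_sphere k) = extensional {..k}"
  by (metis sets_eq_imp_space_eq sets_uniform_sphere space_lborel_k)

lemma L2_set_scale_k:
  assumes "0 \<le> c"
  shows "L2_set (\<lambda>i\<in>{..k}. c * x i) {..k} = c * L2_set x {..k}"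
proof -
  have "L2_set (\<lambda>i\<in>{..k}. c * x i) {..k} = L2_set (\<lambda>i. c * x i) {..k}"
    by (rule L2_set_cong) auto
  then show ?thesis
    using L2_set_right_distrib[OF assms, of x "{..k}"] by simp
qed

lemma normalise_k_scale:
  assumes "0 < c"
  shows "normalise_k k (\<lambda>i\<in>{..k}. c * x i) = normalise_k k x"
  using assms by (auto simp: L2_set_scale_k fun_eq_iff)

lemma AE_lborel_k_L2_pos: "AE x in lborel_k k. 0 < L2_set x {..k}"
proof -
  interpret product_sigma_finite "\<lambda>_::nat. lborel :: real measure" ..
  let ?z = "\<lambda>i\<in>{..k}. 0 :: real"
  have "AE x in lborel_k k. x \<noteq> ?z"
  proof (rule AE_I[where N = "{?z}"])
    have z: "{?z} = Pi\<^sub>E {..k} (\<lambda>_. {0::real})"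
      by (auto simp: PiE_def extensional_def restrict_def fun_eq_iff)
    show "emeasure (lborel_k k) {?z} = 0"
      unfolding z lborel_k_def by (subst emeasure_PiM) auto
    show "{?z} \<in> sets (lborel_k k)"
      unfolding z lborel_k_def by (intro sets_PiM_I_finite) auto
  qed auto
  moreover have "AE x in lborel_k k. x \<in> extensional {..k}"
    by (rule AE_I2) (simp add: space_lborel_k)
  ultimately show ?thesis
  proof eventually_elim
    case (elim x)
    then have "\<exists>i\<in>{..k}. x i \<noteq> 0"
      by (metis (mono_tags, lifting) extensionalityI restrict_apply' restrict_extensional)
    then have "L2_set x {..k} \<noteq> 0"
      by (auto simp: L2_set_eq_0_iff)
    then show ?case using L2_set_nonneg[of x "{..k}"] by linarith
  qed
qed

lemma AE_gauss_k_L2_pos: "AE x in gauss_k k. 0 < L2_set x {..k}"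
  unfolding gauss_k_density using AE_lborel_k_L2_pos[of k]
  by (subst AE_density) (auto elim!: eventually_mono)

text \<open>The unit ball, through which \<open>uniform_sphere\<close> is defined, is the case
  \<rho> = 1; the rest is homogeneity of Lebesgue measure, since a dilation does not change
  \<open>normalise_k\<close>. For \<rho> \<le> 0 the set lies in the null set of vectors of norm
  zero.\<close>

lemma emeasure_cone_ball:
  assumes A [measurable]: "A \<in> sets (lborel_k k)"
  shows "emeasure (lborel_k k) {x \<in> space (lborel_k k). normalise_k k x \<in> A \<and> L2_set x {..k} \<le> \<rho>}
    = emeasure (uniform_sphere k) A * ennreal (if \<rho> \<le> 0 then 0 else \<rho> ^ Suc k * unit_ball_vol (real (Suc k)))"
proof (cases "\<rho> \<le> 0")
  case True
  have "AE x in lborel_k k. x \<notin> {x \<in> space (lborel_k k). normalise_k k x \<in> A \<and> L2_set x {..k} \<le> \<rho>}"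
    using AE_lborel_k_L2_pos[of k] by eventually_elim (use True in auto)
  then have "emeasure (lborel_k k) {x \<in> space (lborel_k k). normalise_k k x \<in> A \<and> L2_set x {..k} \<le> \<rho>} = 0"
    by (subst (asm) AE_iff_measurable[OF _ refl]) (auto cong: conj_cong)
  with True show ?thesis by simp
next
  case False
  then have \<rho>: "0 < \<rho>" by simp
  let ?B = "unit_ball_k k" and ?V = "unit_ball_vol (real (Suc k))"
  let ?F = "indicator {x \<in> space (lborel_k k). normalise_k k x \<in> A \<and> L2_set x {..k} \<le> \<rho>} :: _ \<Rightarrow> ennreal"
  have V: "0 < ?V" by (rule unit_ball_vol_pos) simp
  have "emeasure (lborel_k k) {x \<in> space (lborel_k k). normalise_k k x \<in> A \<and> L2_set x {..k} \<le> \<rho>}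
    = (\<integral>\<^sup>+x. ?F x \<partial>lborel_k k)"
    by simp
  also have "\<dots> = ennreal (\<rho> ^ Suc k) * (\<integral>\<^sup>+x. ?F (\<lambda>i\<in>{..k}. 0 + \<rho> * x i) \<partial>lborel_k k)"
    using nn_integral_lborel_k_affine[of ?F k \<rho> "\<lambda>_. 0"] \<rho> by simp
  also have "(\<integral>\<^sup>+x. ?F (\<lambda>i\<in>{..k}. 0 + \<rho> * x i) \<partial>lborel_k k)
      = (\<integral>\<^sup>+x. indicator (?B \<inter> (normalise_k k -` A \<inter> space (lborel_k k))) x \<partial>lborel_k k)"
  proof (intro nn_integral_cong)
    fix x assume "x \<in> space (lborel_k k)"
    have "\<rho> * L2_set x {..k} \<le> \<rho> \<longleftrightarrow> L2_set x {..k} \<le> 1"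
      using \<rho> by simp
    moreover have "L2_set (\<lambda>i\<in>{..k}. \<rho> * x i) {..k} = \<rho> * L2_set x {..k}"
      using \<rho> by (intro L2_set_scale_k) simp
    moreover note normalise_k_scale[OF \<rho>, where k=k and x=x]
    moreover have "(\<lambda>i\<in>{..k}. \<rho> * x i) \<in> space (lborel_k k)"
      by (simp add: space_lborel_k)
    ultimately show "?F (\<lambda>i\<in>{..k}. 0 + \<rho> * x i) = indicator (?B \<inter> (normalise_k k -` A \<inter> space (lborel_k k))) x"
      using \<open>x \<in> space (lborel_k k)\<close>
      unfolding indicator_def unit_ball_k_def by (auto simp del: restrict_apply)
  qed
  also have "\<dots> = emeasure (lborel_k k) (?B \<inter> (normalise_k k -` A \<inter> space (lborel_k k)))"
    by (rule nn_integral_indicator) measurable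
  also have "\<dots> = ennreal ?V * emeasure (uniform_sphere k) A"
  proof -
    have "E = ennreal v * (E / ennreal v)" if "0 < v" for E and v :: real
      using that by (simp add: ennreal_times_divide mult.commute[of "ennreal v"] ennreal_mult_divide_eq)
    from this[OF V] show ?thesis
      by (simp add: uniform_sphere_def emeasure_distr emeasure_unit_ball_k)
  qed
  finally have E: "emeasure (lborel_k k) {x \<in> space (lborel_k k). normalise_k k x \<in> A \<and> L2_set x {..k} \<le> \<rho>}
    = ennreal (\<rho> ^ Suc k) * (ennreal ?V * emeasure (uniform_sphere k) A)" .
  show ?thesis
    unfolding E using \<rho> V by (simp add: ennreal_mult ac_simps)
qed

text \<open>Independence of direction and norm. The norm distributions on the cone over A and on the
  whole space are proportional on half-lines by \<open>emeasure_cone_ball\<close>, hence on all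
  Borel sets; the Gaussian density, a function of the norm, is then integrated against both.\<close>

lemma emeasure_gauss_k_cone:
  assumes A [measurable]: "A \<in> sets (lborel_k k)" and I [measurable]: "I \<in> sets borel"
  shows "emeasure (gauss_k k) {x \<in> space (lborel_k k). normalise_k k x \<in> A \<and> L2_set x {..k} \<in> I}
    = emeasure (uniform_sphere k) A * emeasure (gauss_k k) {x \<in> space (lborel_k k). L2_set x {..k} \<in> I}"
proof -
  interpret S: prob_space "uniform_sphere k" by (rule prob_space_uniform_sphere)
  let ?N = "normalise_k k -` A \<inter> space (lborel_k k)"
  define M1 where "M1 = distr (density (lborel_k k) (indicator ?N)) borel (\<lambda>x. L2_set x {..k})"
  define M2 where "M2 = density (distr (lborel_k k) borel (\<lambda>x. L2_set x {..k})) (\<lambda>_. emeasure (uniform_sphere k) A)"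
  have M1: "emeasure M1 X = emeasure (lborel_k k) {x \<in> space (lborel_k k). normalise_k k x \<in> A \<and> L2_set x {..k} \<in> X}"
    if [measurable]: "X \<in> sets borel" for X
  proof -
    have "emeasure M1 X = (\<integral>\<^sup>+x. indicator ?N x * indicator ((\<lambda>x. L2_set x {..k}) -` X \<inter> space (lborel_k k)) x \<partial>lborel_k k)"
      unfolding M1_def by (simp add: emeasure_distr emeasure_density)
    also have "\<dots> = (\<integral>\<^sup>+x. indicator {x \<in> space (lborel_k k). normalise_k k x \<in> A \<and> L2_set x {..k} \<in> X} x \<partial>lborel_k k)"
      by (intro nn_integral_cong) (auto simp: indicator_def)
    finally show ?thesis by simp
  qed
  have M2: "emeasure M2 X = emeasure (uniform_sphere k) A * emeasure (lborel_k k) {x \<in> space (lborel_k k). normalise_k k x \<in> space (lborel_k k) \<and> L2_set x {..k} \<in> X}"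
    if [measurable]: "X \<in> sets borel" for X
  proof -
    have "(\<lambda>x. L2_set x {..k}) -` X \<inter> space (lborel_k k) =
        {x \<in> space (lborel_k k). normalise_k k x \<in> space (lborel_k k) \<and> L2_set x {..k} \<in> X}"
      by (auto simp: space_lborel_k)
    then show ?thesis
      unfolding M2_def by (simp add: emeasure_density_const emeasure_distr)
  qed
  have S1: "emeasure (uniform_sphere k) (space (lborel_k k)) = 1"
    using S.emeasure_space_1 by (simp add: space_uniform_sphere space_lborel_k)
  have le: "emeasure M1 {..\<rho>} = emeasure M2 {..\<rho>}" "emeasure M1 {..\<rho>} \<noteq> \<infinity>" for \<rho>
    using emeasure_cone_ball[of A k \<rho>] emeasure_cone_ball[of "space (lborel_k k)" k \<rho>] S1
    by (simp_all add: M1 M2 ennreal_mult_eq_top_iff)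
  have eq: "M1 = M2"
  proof (rule measure_eqI_generator_eq)
    show "Int_stable (range atMost :: real set set)"
      by (auto simp: Int_stable_def)
    show "range (atMost :: real \<Rightarrow> _) \<subseteq> Pow UNIV" by simp
    show "sets M1 = sigma_sets UNIV (range atMost)" "sets M2 = sigma_sets UNIV (range atMost)"
      by (simp_all add: M1_def M2_def borel_eq_atMost)
    show "range (\<lambda>i::nat. {..real i}) \<subseteq> range atMost" by auto
    show "(\<Union>i::nat. {..real i}) = UNIV" by (auto intro: real_arch_simple)
  qed (use le in auto)
  define h where "h = (\<lambda>r. ennreal ((1 / sqrt (2 * pi)) ^ Suc k * exp (- r\<^sup>2 / 2)) * indicator I r)"
  have [measurable]: "h \<in> borel_measurable borel"
    unfolding h_def by measurable
  have h: "h (L2_set x {..k}) = ennreal (gauss_weight k x) * indicator I (L2_set x {..k})" for x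
    by (simp add: h_def gauss_weight_def ip_self)
  have "emeasure (gauss_k k) {x \<in> space (lborel_k k). normalise_k k x \<in> A \<and> L2_set x {..k} \<in> I}
     = (\<integral>\<^sup>+x. indicator ?N x * h (L2_set x {..k}) \<partial>lborel_k k)"
    unfolding gauss_k_density h by (subst emeasure_density) (auto intro!: nn_integral_cong simp: indicator_def)
  also have "\<dots> = (\<integral>\<^sup>+r. h r \<partial>M1)"
    unfolding M1_def by (simp add: nn_integral_distr nn_integral_density)
  also have "\<dots> = emeasure (uniform_sphere k) A * (\<integral>\<^sup>+x. h (L2_set x {..k}) \<partial>lborel_k k)"
    unfolding eq M2_def by (simp add: nn_integral_distr nn_integral_density nn_integral_cmult)
  also have "(\<integral>\<^sup>+x. h (L2_set x {..k}) \<partial>lborel_k k) = emeasure (gauss_k k) {x \<in> space (lborel_k k). L2_set x {..k} \<in> I}"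
    unfolding gauss_k_density h by (subst emeasure_density) (auto intro!: nn_integral_cong simp: indicator_def)
  finally show ?thesis .
qed

lemma nn_integral_gauss_k_radial:
  assumes f [measurable]: "f \<in> borel_measurable (lborel_k k)" and I [measurable]: "I \<in> sets borel"
  shows "(\<integral>\<^sup>+g. f (normalise_k k g) * indicator I (L2_set g {..k}) \<partial>gauss_k k)
    = (\<integral>\<^sup>+x. f x \<partial>uniform_sphere k) * emeasure (gauss_k k) {x \<in> space (lborel_k k). L2_set x {..k} \<in> I}"
proof -
  let ?c = "emeasure (gauss_k k) {x \<in> space (lborel_k k). L2_set x {..k} \<in> I}"
  have "distr (density (gauss_k k) (\<lambda>g. indicator I (L2_set g {..k}))) (lborel_k k) (normalise_k k)
      = density (uniform_sphere k) (\<lambda>_. ?c)" (is "?M1 = ?M2")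
  proof (rule measure_eqI)
    fix A assume "A \<in> sets ?M1"
    then have [measurable]: "A \<in> sets (lborel_k k)" by simp
    have sp: "space (gauss_k k) = space (lborel_k k)"
      by (simp add: space_gauss_k space_lborel_k)
    have "emeasure ?M1 A = emeasure (gauss_k k) {x \<in> space (lborel_k k). normalise_k k x \<in> A \<and> L2_set x {..k} \<in> I}"
    proof -
      have "emeasure ?M1 A = (\<integral>\<^sup>+g. indicator I (L2_set g {..k}) *
          indicator (normalise_k k -` A \<inter> space (lborel_k k)) g \<partial>gauss_k k)"
        by (simp add: emeasure_distr emeasure_density sp)
      also have "\<dots> = (\<integral>\<^sup>+g. indicator {x \<in> space (lborel_k k). normalise_k k x \<in> A \<and> L2_set x {..k} \<in> I} g \<partial>gauss_k k)"
        by (intro nn_integral_cong) (auto simp: indicator_def sp)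
      finally show ?thesis by simp
    qed
    then show "emeasure ?M1 A = emeasure ?M2 A"
      by (simp add: emeasure_gauss_k_cone emeasure_density_const mult.commute)
  qed simp
  then have "(\<integral>\<^sup>+x. f x \<partial>?M1) = (\<integral>\<^sup>+x. f x \<partial>?M2)" by simp
  then show ?thesis
    by (simp add: nn_integral_distr nn_integral_density nn_integral_cmult)
      (simp add: mult.commute)
qed

section \<open>Concentration of the Gaussian norm\<close>

lemma gauss_k_prod_expectation:
  fixes f :: "nat \<Rightarrow> real \<Rightarrow> real"
  assumes "\<And>i. i \<in> J \<Longrightarrow> integrable std_normal (f i)" "J \<subseteq> {..k}"
  shows "integrable (gauss_k k) (\<lambda>x. \<Prod>i\<in>J. f i (x i))"
    and "(\<integral>x. (\<Prod>i\<in>J. f i (x i)) \<partial>gauss_k k) = (\<Prod>i\<in>J. \<integral>y. f i y \<partial>std_normal)"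
proof -
  interpret N: prob_space std_normal
    by (rule prob_space_normal_density) simp
  interpret product_sigma_finite "\<lambda>_::nat. std_normal" ..
  let ?f = "\<lambda>i. if i \<in> J then f i else (\<lambda>_. 1)"
  have J: "{..k} \<inter> {i. i \<in> J} = J" using assms(2) by auto
  have eq: "(\<Prod>i\<le>k. ?f i (x i)) = (\<Prod>i\<in>J. f i (x i))" for x :: "nat \<Rightarrow> real"
  proof -
    have "(\<Prod>i\<le>k. ?f i (x i)) = (\<Prod>i\<le>k. if i \<in> J then f i (x i) else 1)"
      by (intro prod.cong) auto
    then show ?thesis using J by (simp add: prod.If_cases)
  qed
  have eq2: "(\<Prod>i\<le>k. \<integral>y. ?f i y \<partial>std_normal) = (\<Prod>i\<in>J. \<integral>y. f i y \<partial>std_normal)"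
  proof -
    have "(\<Prod>i\<le>k. \<integral>y. ?f i y \<partial>std_normal) = (\<Prod>i\<le>k. if i \<in> J then (\<integral>y. f i y \<partial>std_normal) else 1)"
      by (intro prod.cong) (auto simp: N.prob_space[simplified])
    then show ?thesis using J by (simp add: prod.If_cases)
  qed
  show "integrable (gauss_k k) (\<lambda>x. \<Prod>i\<in>J. f i (x i))"
    using product_integrable_prod[of "{..k}" ?f] assms(1) unfolding gauss_k_def eq by auto
  show "(\<integral>x. (\<Prod>i\<in>J. f i (x i)) \<partial>gauss_k k) = (\<Prod>i\<in>J. \<integral>y. f i y \<partial>std_normal)"
    using product_integral_prod[of "{..k}" ?f] assms(1) unfolding gauss_k_def eq eq2 by auto
qed

lemma has_bochner_integral_std_normal_poly:
  "has_bochner_integral std_normal (\<lambda>x. x\<^sup>2 - 1) 0"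
  "has_bochner_integral std_normal (\<lambda>x. (x\<^sup>2 - 1)\<^sup>2) 2"
proof -
  have 0: "has_bochner_integral lborel (\<lambda>x. phi x * x ^ 0) 1"
    using std_normal_moment_even[of 0] by simp
  have 2: "has_bochner_integral lborel (\<lambda>x. phi x * x ^ 2) 1"
    using std_normal_moment_even[of 1] by simp
  have 4: "has_bochner_integral lborel (\<lambda>x. phi x * x ^ 4) 3"
    using std_normal_moment_even[of 2] by (simp add: fact_numeral)
  have "has_bochner_integral lborel (\<lambda>x. phi x * x ^ 2 - phi x * x ^ 0) (1 - 1)"
    by (intro has_bochner_integral_diff 0 2)
  then show "has_bochner_integral std_normal (\<lambda>x. x\<^sup>2 - 1) 0"
    by (intro has_bochner_integral_density) (auto simp: algebra_simps)
  have "has_bochner_integral lborel (\<lambda>x. phi x * x ^ 4 - 2 * (phi x * x ^ 2)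
      + phi x * x ^ 0) (3 - 2 * 1 + 1)"
    by (intro has_bochner_integral_diff has_bochner_integral_add has_bochner_integral_mult_right 0 2 4)
  moreover have "phi x * x ^ 4 - 2 * (phi x * x ^ 2) + phi x * x ^ 0
      = phi x *\<^sub>R (x\<^sup>2 - 1)\<^sup>2" for x
    by (simp add: algebra_simps power2_eq_square power4_eq_xxxx)
  ultimately show "has_bochner_integral std_normal (\<lambda>x. (x\<^sup>2 - 1)\<^sup>2) 2"
    by (intro has_bochner_integral_density) auto
qed

text \<open>There are k + 1 coordinates, but the centring is at k, to match the scale sqrt k of the
  thresholds: variance 2 (k + 1) plus squared bias 1.\<close>

lemma gauss_k_norm_variance:
  "has_bochner_integral (gauss_k k) (\<lambda>x. (ip k x x - real k)\<^sup>2) (2 * real k + 3)"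
proof -
  interpret prob_space "gauss_k k" by (rule prob_space_gauss_k)
  let ?X = "\<lambda>y::real. y\<^sup>2 - 1"
  have X: "integrable std_normal ?X" "(\<integral>y. ?X y \<partial>std_normal) = 0"
    "integrable std_normal (\<lambda>y. (?X y)\<^sup>2)" "(\<integral>y. (?X y)\<^sup>2 \<partial>std_normal) = 2"
    using has_bochner_integral_std_normal_poly by (auto simp: has_bochner_integral_iff)
  have 1: "has_bochner_integral (gauss_k k) (\<lambda>x. ?X (x i)) 0" if "i \<le> k" for i
    using gauss_k_prod_expectation[of "{i}" "\<lambda>_. ?X" k] X that by (simp add: has_bochner_integral_iff)
  have 2: "has_bochner_integral (gauss_k k) (\<lambda>x. ?X (x i) * ?X (x j)) (if i = j then 2 else 0)"
    if "i \<le> k" "j \<le> k" for i j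
  proof (cases "i = j")
    case True
    then show ?thesis
      using gauss_k_prod_expectation[of "{i}" "\<lambda>_ y. (?X y)\<^sup>2" k] X that
      by (simp add: has_bochner_integral_iff power2_eq_square)
  next
    case False
    then show ?thesis
      using gauss_k_prod_expectation[of "{i, j}" "\<lambda>_. ?X" k] X that
      by (simp add: has_bochner_integral_iff)
  qed
  have const: "has_bochner_integral (gauss_k k) (\<lambda>x. 1 :: real) (measure (gauss_k k) (space (gauss_k k)) *\<^sub>R 1)"
    by (simp add: has_bochner_integral_iff)
  have "has_bochner_integral (gauss_k k)
      (\<lambda>x. (\<Sum>i\<le>k. \<Sum>j\<le>k. ?X (x i) * ?X (x j)) + 2 * (\<Sum>i\<le>k. ?X (x i)) + 1)
      ((\<Sum>i\<le>k. \<Sum>j\<le>k. if i = j then 2 else 0) + 2 * (\<Sum>i\<le>k. 0) + measure (gauss_k k) (space (gauss_k k)) *\<^sub>R 1)"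
    by (intro has_bochner_integral_add has_bochner_integral_mult_right has_bochner_integral_sum 1 2
        const) auto
  moreover have "(\<Sum>i\<le>k. \<Sum>j\<le>k. ?X (x i) * ?X (x j)) + 2 * (\<Sum>i\<le>k. ?X (x i)) + 1 = (ip k x x - real k)\<^sup>2"
    for x :: "nat \<Rightarrow> real"
  proof -
    have "ip k x x - real k = (\<Sum>i\<le>k. ?X (x i)) + 1"
      by (simp add: ip_def sum_subtractf power2_eq_square)
    then show ?thesis
      by (simp add: power2_eq_square sum_product algebra_simps)
  qed
  ultimately show ?thesis by (simp add: prob_space add.commute mult.commute)
qed

definition norm_window :: "nat \<Rightarrow> real \<Rightarrow> real set" where
  "norm_window k d = {r. \<bar>r - sqrt (real k)\<bar> \<le> d * sqrt (real k)}"

lemma norm_window_borel [measurable]: "norm_window k d \<in> sets borel"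
  unfolding norm_window_def by measurable

text \<open>Chebyshev for the squared norm. With r the norm and s = sqrt k, a deviation |r - s| > d
  s gives |r^2 - k| = |r - s| (r + s) \<ge> d k; the constant 5 absorbs 2 k + 3 for k \<ge>
  1.\<close>

lemma gauss_k_norm_concentration:
  assumes "0 < d" "1 \<le> k"
  shows "measure (gauss_k k) {x \<in> space (lborel_k k). L2_set x {..k} \<notin> norm_window k d} \<le> 5 / (d\<^sup>2 * real k)"
proof -
  interpret prob_space "gauss_k k" by (rule prob_space_gauss_k)
  have sp: "space (gauss_k k) = space (lborel_k k)"
    by (simp add: space_gauss_k space_lborel_k)
  have k: "0 < real k" using assms by simp
  have "measure (gauss_k k) {x \<in> space (lborel_k k). L2_set x {..k} \<notin> norm_window k d}
      \<le> measure (gauss_k k) {x \<in> space (gauss_k k). (d * real k)\<^sup>2 \<le> (ip k x x - real k)\<^sup>2}"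
  proof (rule finite_measure_mono)
    show "{x \<in> space (lborel_k k). L2_set x {..k} \<notin> norm_window k d}
      \<subseteq> {x \<in> space (gauss_k k). (d * real k)\<^sup>2 \<le> (ip k x x - real k)\<^sup>2}"
    proof safe
      fix x assume x: "x \<in> space (lborel_k k)" "L2_set x {..k} \<notin> norm_window k d"
      define r where "r = L2_set x {..k}"
      define s where "s = sqrt (real k)"
      have s: "0 < s" "s * s = real k" using k by (auto simp: s_def)
      have r: "0 \<le> r" "ip k x x = r * r" by (simp_all add: r_def L2_set_nonneg ip_self power2_eq_square)
      have "d * s \<le> \<bar>r - s\<bar>" using x(2) by (simp add: norm_window_def r_def s_def)
      then have "d * s * s \<le> \<bar>r - s\<bar> * (r + s)"
        using r s assms by (intro mult_mono) auto
      also have "\<dots> = \<bar>(r - s) * (r + s)\<bar>" using r s by (simp add: abs_mult)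
      also have "(r - s) * (r + s) = ip k x x - real k" using r s by (simp add: algebra_simps)
      finally have "\<bar>d * real k\<bar> \<le> \<bar>ip k x x - real k\<bar>" using s assms by (simp add: mult.assoc)
      then show "(d * real k)\<^sup>2 \<le> (ip k x x - real k)\<^sup>2"
        by (simp add: abs_le_square_iff)
      show "x \<in> space (gauss_k k)" using x sp by simp
    qed
  qed measurable
  also have "\<dots> \<le> (\<integral>x. (ip k x x - real k)\<^sup>2 \<partial>gauss_k k) / (d * real k)\<^sup>2"
    using assms k gauss_k_norm_variance[of k]
    by (intro integral_Markov_inequality_measure[where A="{}"]) (auto simp: has_bochner_integral_iff)
  also have "\<dots> = (2 * real k + 3) / (d * real k)\<^sup>2"
    using gauss_k_norm_variance[of k] by (simp add: has_bochner_integral_iff)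
  also have "\<dots> \<le> (5 * real k) / (d * real k)\<^sup>2"
    using assms by (intro divide_right_mono) auto
  also have "\<dots> = 5 / (d\<^sup>2 * real k)"
    using k assms by (simp add: power2_eq_square field_simps)
  finally show ?thesis .
qed

section \<open>The one-dimensional Gaussian distribution function\<close>

definition Phi :: "real \<Rightarrow> real" where
  "Phi x = measure std_normal {..x}"

lemma prob_space_std_normal: "prob_space std_normal"
  by (rule prob_space_normal_density) simp

lemma std_normal_density_even: "phi (- x) = phi x"
  by (simp add: std_normal_density_def)

lemma std_normal_density_le_1: "phi x \<le> 1"
proof -
  have "1 / sqrt (2 * pi) \<le> 1"
    using pi_gt3 by (simp add: real_le_rsqrt)
  moreover have "exp (- x\<^sup>2 / 2) \<le> 1" by simp
  ultimately show ?thesis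
    unfolding std_normal_density_def by (intro mult_le_one) auto
qed

lemma measure_std_normal_singleton: "measure std_normal {x} = 0"
  by (simp add: measure_def emeasure_density nn_integral_0_iff_AE
      nn_integral_indicator_singleton)

lemma Phi_diff:
  assumes "a \<le> x"
  shows "Phi x = Phi a + integral {a..x} phi"
proof -
  interpret N: prob_space std_normal by (rule prob_space_std_normal)
  have "{..x} = {..a} \<union> {a<..x}" using assms by auto
  then have "Phi x = Phi a + measure std_normal {a<..x}"
    unfolding Phi_def by (subst N.finite_measure_Union[symmetric]) auto
  also have "measure std_normal {a<..x} = measure std_normal {a..x}"
  proof -
    have "{a..x} = {a} \<union> {a<..x}" using assms by auto
    then have "measure std_normal {a..x} = measure std_normal {a} + measure std_normal {a<..x}"
      by (subst N.finite_measure_Union[symmetric]) auto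
    then show ?thesis by (simp add: measure_std_normal_singleton)
  qed
  also have "\<dots> = (\<integral>y. indicator {a..x} y \<partial>std_normal)"
    by simp
  also have "\<dots> = (LINT y:{a..x}|lborel. phi y)"
    unfolding set_lebesgue_integral_def
    by (subst integral_density) (auto intro!: Bochner_Integration.integral_cong simp: mult.commute)
  also have "\<dots> = integral {a..x} phi"
    by (rule set_borel_integral_eq_integral(2), rule borel_integrable_atLeastAtMost')
      (auto simp: std_normal_density_def intro!: continuous_intros)
  finally show ?thesis .
qed

lemma std_normal_density_has_derivative:
  "(phi has_real_derivative - x * phi x) (at x)"
proof -
  have "((\<lambda>x. c * exp (- x\<^sup>2 / 2)) has_real_derivative - x * (c * exp (- x\<^sup>2 / 2))) (at x)" for c :: real
    by (auto intro!: derivative_eq_intros)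
  then show ?thesis unfolding std_normal_density_def .
qed

lemma Phi_has_derivative: "(Phi has_real_derivative phi x) (at x)"
proof -
  have "((\<lambda>y. integral {x - 1..y} phi) has_real_derivative phi x)
      (at x within {x - 1..x + 1})"
    by (rule integral_has_real_derivative) (auto simp: std_normal_density_def intro!: continuous_intros)
  then have "((\<lambda>y. Phi (x - 1) + integral {x - 1..y} phi) has_real_derivative phi x)
      (at x within {x - 1..x + 1})"
    by (auto intro!: derivative_eq_intros)
  then have "(Phi has_real_derivative phi x) (at x within {x - 1..x + 1})"
    by (rule has_field_derivative_transform_within[where d=1]) (auto simp: Phi_diff)
  moreover have "at x within {x - 1..x + 1} = at x"
    by (rule at_within_interior) (auto simp: interior_atLeastAtMost_real)
  ultimately show ?thesis by simp
qed

lemma Phi_strict_mono: "a < b \<Longrightarrow> Phi a < Phi b"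
  by (rule DERIV_pos_imp_increasing[of a b Phi])
    (auto intro!: exI[of _ "phi x" for x] Phi_has_derivative normal_density_pos)

lemma Phi_pos: "0 < Phi x"
  using Phi_strict_mono[of "x - 1" x] measure_nonneg[of std_normal "{..x - 1}"]
  unfolding Phi_def by linarith

lemma Phi_le_1: "Phi x \<le> 1"
proof -
  interpret N: prob_space std_normal by (rule prob_space_std_normal)
  show ?thesis unfolding Phi_def by simp
qed

lemma Phi_lipschitz: "\<bar>Phi x - Phi y\<bar> \<le> \<bar>x - y\<bar>"
proof -
  have *: "Phi b - Phi a \<le> b - a" if ab: "a < b" for a b
  proof -
    obtain z where "Phi b - Phi a = (b - a) * phi z"
      using MVT2[OF ab, of Phi phi] Phi_has_derivative by blast
    then show ?thesis
      using std_normal_density_le_1[of z] ab by (simp add: mult_left_le)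
  qed
  show ?thesis
    using *[of x y] *[of y x] Phi_strict_mono[of x y] Phi_strict_mono[of y x]
    by (cases x y rule: linorder_cases) auto
qed

lemma Phi_minus: "Phi (- x) = 1 - Phi x"
proof -
  interpret N: prob_space std_normal by (rule prob_space_std_normal)
  have "emeasure std_normal {..-x} = (\<integral>\<^sup>+h. indicator {..-x} h \<partial>std_normal)"
    by simp
  also have "\<dots> = (\<integral>\<^sup>+h. indicator {..-x} (- h) \<partial>std_normal)"
    by (subst nn_integral_std_normal_reflect) auto
  also have "\<dots> = (\<integral>\<^sup>+h. indicator {x..} h \<partial>std_normal)"
    by (intro nn_integral_cong) (auto simp: indicator_def)
  finally have "Phi (- x) = measure std_normal {x..}"
    by (simp add: Phi_def measure_def)
  moreover have "measure std_normal {x..} = measure std_normal {x<..}"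
  proof -
    have "{x..} = {x} \<union> {x<..}" by auto
    then have "measure std_normal {x..} = measure std_normal {x} + measure std_normal {x<..}"
      by (subst N.finite_measure_Union[symmetric]) auto
    then show ?thesis by (simp add: measure_std_normal_singleton)
  qed
  moreover have "measure std_normal {x<..} = 1 - Phi x"
  proof -
    have "{x<..} = UNIV - {..x}" by auto
    then show ?thesis
      using N.prob_compl[of "{..x}"] by (simp add: Phi_def)
  qed
  ultimately show ?thesis by simp
qed

lemma Phi_0: "Phi 0 = 1 / 2"
  using Phi_minus[of 0] by simp

text \<open>Chebyshev with second moment 1. This quadratic decay suffices both for
  \<open>mills\<close> and for bounding the threshold c.\<close>

lemma Phi_tail: "x\<^sup>2 * Phi (- x) \<le> 1" if "0 < x"
proof -
  interpret N: prob_space std_normal by (rule prob_space_std_normal)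
  have 2: "has_bochner_integral lborel (\<lambda>x. phi x * x ^ 2) 1"
    using std_normal_moment_even[of 1] by simp
  then have "has_bochner_integral std_normal (\<lambda>x. x\<^sup>2) 1"
    by (intro has_bochner_integral_density) auto
  then have "measure std_normal {y \<in> space std_normal. x\<^sup>2 \<le> y\<^sup>2} \<le> 1 / x\<^sup>2"
    using integral_Markov_inequality_measure[of std_normal "\<lambda>x. x\<^sup>2" "{}" "x\<^sup>2"] that
    by (auto simp: has_bochner_integral_iff)
  moreover have "Phi (- x) \<le> measure std_normal {y \<in> space std_normal. x\<^sup>2 \<le> y\<^sup>2}"
    unfolding Phi_def
  proof (rule N.finite_measure_mono)
    show "{..- x} \<subseteq> {y \<in> space std_normal. x\<^sup>2 \<le> y\<^sup>2}"
      using that by (auto simp: abs_le_square_iff[symmetric])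
    have "{y \<in> space borel. x\<^sup>2 \<le> (y::real)\<^sup>2} \<in> sets borel"
      by (rule borel_measurable_le) auto
    then show "{y \<in> space std_normal. x\<^sup>2 \<le> y\<^sup>2} \<in> N.events"
      by simp
  qed
  ultimately have "Phi (- x) \<le> 1 / x\<^sup>2" by (rule order_trans[rotated])
  then show ?thesis
    using that by (simp add: field_simps)
qed

text \<open>The logarithmic derivative of \<open>Phi\<close>, an inverse Mills ratio. At the
  threshold b it plays the part of H, with \<open>Phi b\<close> as denominator instead of q; the two
  denominators differ by O(1/D^2).\<close>

definition hazard :: "real \<Rightarrow> real" where
  "hazard b = phi b / Phi b"

lemma hazard_pos: "0 < hazard b"
  by (simp add: hazard_def Phi_pos normal_density_pos)

text \<open>
  The left-hand side is increasing with derivative \<open>Phi\<close>. If it were negative somewhere, \<open>Phi y\<close>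
  would decay no faster than \<open>1 / \<bar>y\<bar>\<close> at \<open>-\<infinity>\<close>, contradicting Chebyshev's inequality.
\<close>

lemma mills: "0 \<le> x * Phi x + phi x"
proof (rule ccontr)
  assume neg: "\<not> ?thesis"
  define m where "m = - (x * Phi x + phi x)"
  have m: "0 < m" using neg by (simp add: m_def)
  define y where "y = - (1 + \<bar>x\<bar> + 1 / m)"
  have y: "y < x" "y < 0" "1 < - y * m"
  proof -
    have "0 < 1 / m" using m by simp
    then show "y < x" "y < 0" unfolding y_def by linarith+
    have "- y * m = 1 + m * (1 + \<bar>x\<bar>)"
      using m by (simp add: y_def field_simps)
    then show "1 < - y * m" using m by (simp add: add_pos_nonneg)
  qed
  have "y * Phi y + phi y \<le> x * Phi x + phi x"
  proof (rule DERIV_nonneg_imp_nondecreasing[where f="\<lambda>x. x * Phi x + phi x"])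
    show "y \<le> x" using y by simp
    fix t
    have "((\<lambda>x. x * Phi x + phi x) has_real_derivative Phi t) (at t)"
      by (auto intro!: derivative_eq_intros Phi_has_derivative std_normal_density_has_derivative)
    then show "\<exists>d. ((\<lambda>x. x * Phi x + phi x) has_real_derivative d) (at t) \<and> 0 \<le> d"
      using Phi_pos[of t] by (auto intro!: exI[of _ "Phi t"])
  qed
  then have "m \<le> - y * Phi y"
    using normal_density_nonneg[of 0 1 y] unfolding m_def by linarith
  then have "- y * m \<le> - y * (- y * Phi y)"
    using y by (intro mult_left_mono) auto
  also have "\<dots> \<le> 1"
    using Phi_tail[of "- y"] y by (simp add: power2_eq_square algebra_simps)
  finally show False using y by simp
qed

text \<open>\<open>ln\<close> of \<open>Phi\<close> is concave: \<open>hazard\<close> has derivative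
  \<open>- hazard x * (x + hazard x)\<close>, nonpositive by \<open>mills\<close>. A concave
  function lies below its tangent, here the one at b. The sign is flipped throughout because the
  second-derivative criterion speaks of convexity.\<close>

lemma Phi_tangent: "Phi (b + w) \<le> Phi b * exp (hazard b * w)"
proof -
  have D: "((\<lambda>x. - ln (Phi x)) has_real_derivative - hazard x) (at x)" for x
    using Phi_pos[of x] by (auto intro!: derivative_eq_intros Phi_has_derivative simp: hazard_def divide_inverse)
  have D2: "((\<lambda>x. - hazard x) has_real_derivative hazard x * (x + hazard x)) (at x)" for x
  proof -
    show ?thesis
      unfolding hazard_def using Phi_pos[of x]
      by (auto intro!: derivative_eq_intros Phi_has_derivative std_normal_density_has_derivative simp: field_simps)
  qed
  have "convex_on UNIV (\<lambda>x. - ln (Phi x))"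
  proof (rule f''_ge0_imp_convex[OF _ D D2])
    fix x
    have "0 \<le> (x * Phi x + phi x) / Phi x"
      using mills[of x] Phi_pos[of x] by simp
    also have "\<dots> = x + hazard x"
      using Phi_pos[of x] by (simp add: hazard_def field_simps)
    finally show "0 \<le> hazard x * (x + hazard x)"
      using hazard_pos[of x] by simp
  qed simp
  from convex_on_imp_above_tangent[OF this, of b "b + w" "- hazard b"]
  have "ln (Phi (b + w)) \<le> ln (Phi b) + hazard b * w"
    using D[of b] by (simp add: connected_UNIV)
  then have "exp (ln (Phi (b + w))) \<le> exp (ln (Phi b) + hazard b * w)"
    by simp
  then show ?thesis
    using Phi_pos by (simp add: exp_add)
qed

text \<open>Completing the square: the exponential factor shifts the Gaussian by t.\<close>

lemma std_normal_exp_halfline: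
  "(\<integral>\<^sup>+h. ennreal (exp (t * h)) * indicator {..B} h \<partial>std_normal) = ennreal (exp (t\<^sup>2 / 2) * Phi (B - t))"
proof -
  interpret N: prob_space std_normal by (rule prob_space_std_normal)
  have "(\<integral>\<^sup>+h. ennreal (exp (t * h)) * indicator {..B} h \<partial>std_normal)
      = (\<integral>\<^sup>+h. ennreal (phi h) * (ennreal (exp (t * h)) * indicator {..B} h) \<partial>lborel)"
    by (subst nn_integral_density) auto
  also have "\<dots> = (\<integral>\<^sup>+h. ennreal (phi (t + 1 * h)) * (ennreal (exp (t * (t + 1 * h))) * indicator {..B} (t + 1 * h)) \<partial>lborel)"
    by (subst nn_integral_real_affine[of _ 1 t]) auto
  also have "\<dots> = (\<integral>\<^sup>+h. ennreal (exp (t\<^sup>2 / 2)) * (ennreal (phi h) * indicator {..B - t} h) \<partial>lborel)"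
  proof (rule nn_integral_cong)
    fix h :: real
    have "phi (t + h) * exp (t * (t + h)) = exp (t\<^sup>2 / 2) * phi h"
      unfolding std_normal_density_def
      by (simp add: exp_add[symmetric] power2_eq_square) (simp add: algebra_simps add_divide_distrib)
    then have "ennreal (phi (t + h)) * ennreal (exp (t * (t + h)))
        = ennreal (exp (t\<^sup>2 / 2)) * ennreal (phi h)"
      by (simp add: ennreal_mult[symmetric])
    moreover have "indicator {..B} (t + h) = (indicator {..B - t} h :: ennreal)"
      by (auto simp: indicator_def)
    ultimately show "ennreal (phi (t + 1 * h)) * (ennreal (exp (t * (t + 1 * h))) * indicator {..B} (t + 1 * h))
        = ennreal (exp (t\<^sup>2 / 2)) * (ennreal (phi h) * indicator {..B - t} h)"
      by (simp add: mult.assoc[symmetric])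
  qed
  also have "\<dots> = ennreal (exp (t\<^sup>2 / 2)) * emeasure std_normal {..B - t}"
    by (subst nn_integral_cmult) (auto simp: emeasure_density)
  also have "\<dots> = ennreal (exp (t\<^sup>2 / 2) * Phi (B - t))"
    by (simp add: Phi_def N.emeasure_eq_measure ennreal_mult)
  finally show ?thesis .
qed

text \<open>The tangent is taken at the unperturbed threshold b and not at the actual end point of
  the half-line. The exponent is then affine in u, a linear form in the coordinates still to be
  integrated, so the next integration has the same shape. The signs of h come from the
  resampling.\<close>

lemma std_normal_exp_event:
  assumes \<epsilon>: "\<epsilon> = 1 \<or> \<epsilon> = - 1" and a: "0 < a"
  shows "(\<integral>\<^sup>+h. ennreal (exp (- \<theta> * h)) * indicator {h. \<epsilon> * (u - a * h) \<le> b'} h \<partial>std_normal)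
    \<le> ennreal (Phi b * exp (\<theta>\<^sup>2 / 2 - \<epsilon> * hazard b * (\<theta> + u / a) + hazard b * (b' / a - b)))"
proof -
  let ?B = "(b' - \<epsilon> * u) / a"
  let ?f = "\<lambda>h. ennreal (exp (\<epsilon> * \<theta> * h)) * indicator {..?B} h"
  have iff: "\<epsilon> * u + a * h \<le> b' \<longleftrightarrow> h \<le> ?B" for h
    using a by (simp add: field_simps)
  have "(\<integral>\<^sup>+h. ennreal (exp (- \<theta> * h)) * indicator {h. \<epsilon> * (u - a * h) \<le> b'} h \<partial>std_normal) = (\<integral>\<^sup>+h. ?f h \<partial>std_normal)"
  proof (cases "\<epsilon> = 1")
    \<comment> \<open>For \<epsilon> = 1 the event is an upper half-line in h; reflection turns it
      into a lower one.\<close>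
    case True
    have "(\<integral>\<^sup>+h. ennreal (exp (- \<theta> * h)) * indicator {h. \<epsilon> * (u - a * h) \<le> b'} h \<partial>std_normal)
       = (\<integral>\<^sup>+h. ?f (- h) \<partial>std_normal)"
      using iff[of "- h" for h] True by (intro nn_integral_cong) (auto simp: indicator_def)
    also have "\<dots> = (\<integral>\<^sup>+h. ?f h \<partial>std_normal)"
      by (rule nn_integral_std_normal_reflect) measurable
    finally show ?thesis .
  next
    case False
    then have "\<epsilon> = -1" using \<epsilon> by auto
    then show ?thesis
      using iff by (intro nn_integral_cong) (auto simp: indicator_def algebra_simps)
  qed
  also have "\<dots> = ennreal (exp (\<theta>\<^sup>2 / 2) * Phi (b + (?B - \<epsilon> * \<theta> - b)))"
    using std_normal_exp_halfline[of "\<epsilon> * \<theta>" ?B] \<epsilon> by (auto simp: power_mult_distrib)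
  also have "\<dots> \<le> ennreal (exp (\<theta>\<^sup>2 / 2) * (Phi b * exp (hazard b * (?B - \<epsilon> * \<theta> - b))))"
    by (intro ennreal_leI mult_left_mono Phi_tangent) auto
  also have "exp (\<theta>\<^sup>2 / 2) * (Phi b * exp (hazard b * (?B - \<epsilon> * \<theta> - b)))
      = Phi b * exp (\<theta>\<^sup>2 / 2 - \<epsilon> * hazard b * (\<theta> + u / a) + hazard b * (b' / a - b))"
    by (simp add: exp_add[symmetric] mult_ac) (simp add: algebra_simps diff_divide_distrib)
  finally show ?thesis .
qed

section \<open>Gaussian orthant events\<close>

text \<open>
  One row of a Cholesky factor: with \<open>L\<close> lower triangular, the vectors \<open>\<Sum>s\<le>j. L j s e\<^sub>s\<close> are the earlier
  points. The last coordinate is integrated out first; log-concavity of \<open>Phi\<close> turns its conditional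
  probability into an exponential of a linear form in the earlier coordinates, so the bound closes up
  under induction.
\<close>

lemma gauss_row_bound:
  fixes e L :: "nat \<Rightarrow> nat \<Rightarrow> real"
  assumes \<epsilon>: "\<epsilon> = 1 \<or> \<epsilon> = - 1"
    and orth: "\<And>s t. s \<in> {1..n} \<Longrightarrow> t \<in> {1..n} \<Longrightarrow> ip k (e s) (e t) = (if s = t then 1 else 0)"
    and diag: "\<And>j. j \<in> {1..n} \<Longrightarrow> 0 < L j j"
    and \<theta>: "\<And>s. s \<in> {1..n} \<Longrightarrow> \<theta> s = V s - \<epsilon> * hazard b * (\<Sum>j\<in>{s<..n}. L j s / L j j)"
  shows "(\<integral>\<^sup>+g. (if \<forall>j\<in>{1..n}. \<epsilon> * (\<Sum>s=1..j. L j s * ip k g (e s)) \<le> b'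
            then ennreal (exp (\<Sum>s=1..n. V s * ip k g (e s))) else 0) \<partial>gauss_k k)
    \<le> ennreal (Phi b ^ n * exp ((\<Sum>s=1..n. (\<theta> s)\<^sup>2 / 2 - \<epsilon> * hazard b * \<theta> s)
          + hazard b * (\<Sum>j=1..n. b' / L j j - b)))"
  using orth diag \<theta>
proof (induction n arbitrary: V \<theta>)
  case 0
  interpret prob_space "gauss_k k" by (rule prob_space_gauss_k)
  show ?case by (simp add: emeasure_space_1)
next
  case (Suc n)
  interpret prob_space "gauss_k k" by (rule prob_space_gauss_k)
  let ?H = "hazard b"
  let ?ok = "\<lambda>n g. \<forall>j\<in>{1..n}. \<epsilon> * (\<Sum>s=1..j. L j s * ip k g (e s)) \<le> b'"
  let ?E = "\<lambda>n V g. exp (\<Sum>s=1..n. V s * ip k g (e s))"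
  let ?a = "L (Suc n) (Suc n)" and ?v = "V (Suc n)"
  let ?u = "\<lambda>g. \<Sum>s=1..n. L (Suc n) s * ip k g (e s)"
  \<comment> \<open>Integrating out the last coordinate transfers the last row of L, divided by its
    diagonal entry and scaled by the tangent slope, to the tilt of the earlier coordinates.
    Accumulated over all later rows this gives the \<theta> of the hypothesis.\<close>
  let ?V' = "\<lambda>s. V s - \<epsilon> * ?H * (L (Suc n) s / ?a)"
  let ?c = "?v\<^sup>2 / 2 - \<epsilon> * ?H * ?v + ?H * (b' / ?a - b)"
  have a: "0 < ?a" using Suc.prems by simp
  have en: "ip k (e (Suc n)) (e (Suc n)) = 1" using Suc.prems by simp
  have e0: "ip k (e (Suc n)) (e s) = 0" if "s \<in> {1..n}" for s
    using Suc.prems(1)[of "Suc n" s] that by simp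
  let ?g = "\<lambda>g h. \<lambda>i\<in>{..k}. g i - (ip k g (e (Suc n)) + h) * e (Suc n) i"
  have g1: "ip k (?g g h) (e s) = ip k g (e s)" if "s \<in> {1..n}" for g h s
    using e0[OF that] by (simp add: ip_diff_left ip_scale_left)
  have g2: "ip k (?g g h) (e (Suc n)) = - h" for g h
    using en by (simp add: ip_diff_left ip_scale_left)
  have ok: "?ok (Suc n) (?g g h) \<longleftrightarrow> ?ok n g \<and> \<epsilon> * (?u g - ?a * h) \<le> b'" for g h
  proof -
    have "(\<Sum>s=1..j. L j s * ip k (?g g h) (e s)) = (\<Sum>s=1..j. L j s * ip k g (e s))" if "j \<in> {1..n}" for j
      by (rule sum.cong) (use that in \<open>auto simp: g1 simp del: ip_restrict\<close>)
    moreover have "(\<Sum>s=1..Suc n. L (Suc n) s * ip k (?g g h) (e s)) = ?u g - ?a * h"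
      using g1[of _ g h] g2[of g h] by (simp del: ip_restrict)
    ultimately show ?thesis
      by (auto simp: atLeastAtMostSuc_conv simp del: ip_restrict)
  qed
  have ex: "?E (Suc n) V (?g g h) = ?E n V g * exp (- ?v * h)" for g h
    using g1[of _ g h] g2[of g h] by (simp add: exp_add[symmetric] del: ip_restrict)
  have "(\<integral>\<^sup>+g. (if ?ok (Suc n) g then ennreal (?E (Suc n) V g) else 0) \<partial>gauss_k k)
      = (\<integral>\<^sup>+g. (\<integral>\<^sup>+h. (if ?ok (Suc n) (?g g h) then ennreal (?E (Suc n) V (?g g h)) else 0) \<partial>std_normal) \<partial>gauss_k k)"
    by (rule gauss_k_resample[OF _ en]) measurable
  also have "\<dots> = (\<integral>\<^sup>+g. (if ?ok n g then ennreal (?E n V g) else 0) *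
      (\<integral>\<^sup>+h. ennreal (exp (- ?v * h)) * indicator {h. \<epsilon> * (?u g - ?a * h) \<le> b'} h \<partial>std_normal) \<partial>gauss_k k)"
  proof (intro nn_integral_cong)
    fix g
    have "(\<integral>\<^sup>+h. (if ?ok (Suc n) (?g g h) then ennreal (?E (Suc n) V (?g g h)) else 0) \<partial>std_normal)
      = (\<integral>\<^sup>+h. (if ?ok n g then ennreal (?E n V g) else 0) *
        (ennreal (exp (- ?v * h)) * indicator {h. \<epsilon> * (?u g - ?a * h) \<le> b'} h) \<partial>std_normal)"
      unfolding ok ex by (intro nn_integral_cong) (auto simp: indicator_def ennreal_mult)
    then show "(\<integral>\<^sup>+h. (if ?ok (Suc n) (?g g h) then ennreal (?E (Suc n) V (?g g h)) else 0) \<partial>std_normal)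
      = (if ?ok n g then ennreal (?E n V g) else 0) *
        (\<integral>\<^sup>+h. ennreal (exp (- ?v * h)) * indicator {h. \<epsilon> * (?u g - ?a * h) \<le> b'} h \<partial>std_normal)"
      by (subst (asm) nn_integral_cmult) auto
  qed
  also have "\<dots> \<le> (\<integral>\<^sup>+g. (if ?ok n g then ennreal (?E n V g) else 0) *
      ennreal (Phi b * exp (?v\<^sup>2 / 2 - \<epsilon> * ?H * (?v + ?u g / ?a) + ?H * (b' / ?a - b))) \<partial>gauss_k k)"
    by (intro nn_integral_mono mult_left_mono std_normal_exp_event \<epsilon> a) auto
  also have "\<dots> = (\<integral>\<^sup>+g. ennreal (Phi b * exp ?c) * (if ?ok n g then ennreal (?E n ?V' g) else 0) \<partial>gauss_k k)"
  proof (intro nn_integral_cong)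
    fix g
    have "(\<Sum>s=1..n. ?V' s * ip k g (e s)) = (\<Sum>s=1..n. V s * ip k g (e s)) - \<epsilon> * ?H * (?u g / ?a)"
      by (simp add: left_diff_distrib sum_subtractf sum_distrib_left sum_divide_distrib mult.assoc)
    then have "?E n V g * (Phi b * exp (?v\<^sup>2 / 2 - \<epsilon> * ?H * (?v + ?u g / ?a) + ?H * (b' / ?a - b)))
        = (Phi b * exp ?c) * ?E n ?V' g"
      by (simp add: exp_add[symmetric]) (simp add: algebra_simps)
    then show "(if ?ok n g then ennreal (?E n V g) else 0) *
        ennreal (Phi b * exp (?v\<^sup>2 / 2 - \<epsilon> * ?H * (?v + ?u g / ?a) + ?H * (b' / ?a - b)))
      = ennreal (Phi b * exp ?c) * (if ?ok n g then ennreal (?E n ?V' g) else 0)"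
      using Phi_pos[of b] by (simp add: ennreal_mult[symmetric] less_imp_le)
  qed
  also have "\<dots> = ennreal (Phi b * exp ?c) * (\<integral>\<^sup>+g. (if ?ok n g then ennreal (?E n ?V' g) else 0) \<partial>gauss_k k)"
    by (rule nn_integral_cmult) measurable
  also have "\<dots> \<le> ennreal (Phi b * exp ?c) * ennreal (Phi b ^ n * exp ((\<Sum>s=1..n. (\<theta> s)\<^sup>2 / 2 - \<epsilon> * ?H * \<theta> s)
          + ?H * (\<Sum>j=1..n. b' / L j j - b)))"
  proof (intro mult_left_mono Suc.IH)
    fix s assume s: "s \<in> {1..n}"
    then have "{s<..Suc n} = insert (Suc n) {s<..n}" by auto
    then show "\<theta> s = ?V' s - \<epsilon> * ?H * (\<Sum>j\<in>{s<..n}. L j s / L j j)"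
      using Suc.prems(3)[of s] s by (simp add: algebra_simps)
  qed (use Suc.prems in auto)
  also have "\<dots> = ennreal (Phi b ^ Suc n * exp ((\<Sum>s=1..Suc n. (\<theta> s)\<^sup>2 / 2 - \<epsilon> * ?H * \<theta> s)
          + ?H * (\<Sum>j=1..Suc n. b' / L j j - b)))"
  proof -
    have "\<theta> (Suc n) = ?v" using Suc.prems(3)[of "Suc n"] by simp
    then show ?thesis
      using Phi_pos[of b] by (simp add: ennreal_mult[symmetric] less_imp_le exp_add[symmetric] mult_ac)
        (simp add: algebra_simps)
  qed
  finally show ?case .
qed

section \<open>Expanding the exponent of the row bound\<close>

lemma abs_sum_le_sqrt:
  fixes f :: "'a \<Rightarrow> real"
  assumes "(\<Sum>s\<in>A. (f s)\<^sup>2) \<le> c" "real (card A) * c \<le> y\<^sup>2" "0 \<le> y"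
  shows "(\<Sum>s\<in>A. \<bar>f s\<bar>) \<le> y"
proof -
  have "(\<Sum>s\<in>A. \<bar>f s\<bar>)\<^sup>2 \<le> (\<Sum>s\<in>A. \<bar>f s\<bar>\<^sup>2) * real (card A)"
    using Cauchy_Schwarz_ineq_sum[of "\<lambda>s. \<bar>f s\<bar>" "\<lambda>_. 1" A] by simp
  also have "\<dots> \<le> c * real (card A)"
    using assms(1) by (intro mult_right_mono) auto
  finally have "(\<Sum>s\<in>A. \<bar>f s\<bar>)\<^sup>2 \<le> y\<^sup>2"
    using assms(2) by (simp add: mult.commute)
  then show ?thesis
    using assms(3) by (rule power2_le_imp_le)
qed

lemma sum_triangle_swap:
  fixes f :: "nat \<Rightarrow> nat \<Rightarrow> real"
  shows "(\<Sum>s=1..n. \<Sum>j\<in>{s<..n}. f j s) = (\<Sum>j=1..n. \<Sum>s=1..<j. f j s)"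
proof -
  have "(\<Sum>s=1..n. \<Sum>j\<in>{s<..n}. f j s) = (\<Sum>(s, j)\<in>(SIGMA s:{1..n}. {s<..n}). f j s)"
    by (rule sum.Sigma) auto
  also have "\<dots> = (\<Sum>(j, s)\<in>(SIGMA j:{1..n}. {1..<j}). f j s)"
    by (rule sum.reindex_bij_witness[of _ "\<lambda>(a, b). (b, a)" "\<lambda>(a, b). (b, a)"]) auto
  also have "\<dots> = (\<Sum>j=1..n. \<Sum>s=1..<j. f j s)"
    by (rule sum.Sigma[symmetric]) auto
  finally show ?thesis .
qed

text \<open>As 0 < a \<le> 1, a \<ge> a^2 = 1 - q.\<close>

lemma cholesky_diag_bounds:
  fixes a \<tau> q :: real
  assumes "0 < a" "a\<^sup>2 = 1 - q" "0 \<le> q" "q \<le> \<tau>" "\<tau> \<le> 1/4"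
  shows "1 - \<tau> \<le> a" "a \<le> 1" "1 / a \<le> 1 + 2 * \<tau>" "1 \<le> 1 / a"
proof -
  show a1: "a \<le> 1"
    by (rule power2_le_imp_le) (use assms in auto)
  have "a * a \<le> a * 1" using a1 assms by (intro mult_left_mono) auto
  then show a0: "1 - \<tau> \<le> a"
    using assms unfolding power2_eq_square by linarith
  show "1 \<le> 1 / a" using a1 assms by simp
  have "1 \<le> (1 + 2 * \<tau>) * (1 - \<tau>)"
  proof -
    have "\<tau> * \<tau> \<le> (1/4) * \<tau>" using assms by (intro mult_right_mono) auto
    moreover have "(1 + 2 * \<tau>) * (1 - \<tau>) = 1 + \<tau> - 2 * (\<tau> * \<tau>)" by (simp add: algebra_simps)
    ultimately show ?thesis using assms by linarith
  qed
  also have "\<dots> \<le> (1 + 2 * \<tau>) * a"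
    using a0 assms by (intro mult_left_mono) auto
  finally show "1 / a \<le> 1 + 2 * \<tau>"
    using assms by (simp add: divide_le_eq)
qed

text \<open>Expansion around L = identity. As n \<tau> \<le> w, the column sums \<open>U s\<close>
  average to about 1 and give the main term -\<epsilon> H t n, while the tangent corrections sum to
  T up to O(n w); T is the sum of the pairwise inner products of the rows. The rest is of order w +
  t^2 + \<delta> per row. The first conclusion bounds the squared norm of the sum of all rows,
  linearly in n instead of the trivial n^2.\<close>

lemma cholesky_estimate:
  fixes L :: "nat \<Rightarrow> nat \<Rightarrow> real"
  assumes \<epsilon>: "\<epsilon> = 1 \<or> \<epsilon> = - 1"
    and diag: "\<And>j. j \<in> {1..n} \<Longrightarrow> 0 < L j j \<and> (L j j)\<^sup>2 = 1 - (\<Sum>s=1..<j. (L j s)\<^sup>2)"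
    and row: "\<And>j. j \<in> {1..n} \<Longrightarrow> (\<Sum>s=1..<j. (L j s)\<^sup>2) \<le> \<tau>"
    and \<tau>: "\<tau> \<le> 1/4" and w: "real n * \<tau> \<le> w" "w \<le> 1"
    and U: "\<And>s. U s = (\<Sum>j\<in>{s..n}. L j s)"
    and \<theta>: "\<And>s. \<theta> s = t * U s - \<epsilon> * H * (\<Sum>j\<in>{s<..n}. L j s / L j j)"
    and T: "T = (\<Sum>j=1..n. \<Sum>i=1..<j. \<Sum>s=1..i. L j s * L i s)"
    and H: "0 \<le> H" and t: "0 \<le> t" and \<delta>: "0 \<le> \<delta>"
    and b': "b' = b + \<bar>b\<bar> * \<delta>"
  shows "(\<Sum>s=1..n. (U s)\<^sup>2) \<le> 4 * real n"
    and "(\<Sum>s=1..n. (\<theta> s)\<^sup>2 / 2 - \<epsilon> * H * \<theta> s) + H * (\<Sum>j=1..n. b' / L j j - b)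
      \<le> - \<epsilon> * H * t * real n + H\<^sup>2 * T
        + real n * (8 * H\<^sup>2 * w + 5 * t\<^sup>2 + 2 * H * \<bar>b\<bar> * (\<delta> + w))"
proof -
  define N where "N = real n"
  define R where "R j = (\<Sum>s=1..<j. L j s)" for j
  define P where "P s = (\<Sum>j\<in>{s<..n}. L j s)" for s
  define Q where "Q s = (\<Sum>j\<in>{s<..n}. L j s / L j j)" for s
  \<comment> \<open>By Cauchy-Schwarz over at most n entries, the absolute off-diagonal row sums are
    at most sqrt (n \<tau>) \<le> y. This is only of order 1/D, so it is good enough only where
    another small factor multiplies it.\<close>
  define y where "y = sqrt w"
  show "(\<Sum>s=1..n. (U s)\<^sup>2) \<le> 4 * real n"
    and "(\<Sum>s=1..n. (\<theta> s)\<^sup>2 / 2 - \<epsilon> * H * \<theta> s) + H * (\<Sum>j=1..n. b' / L j j - b)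
      \<le> - \<epsilon> * H * t * real n + H\<^sup>2 * T
        + real n * (8 * H\<^sup>2 * w + 5 * t\<^sup>2 + 2 * H * \<bar>b\<bar> * (\<delta> + w))"
  proof (atomize (full), cases "n = 0")
    case True
    then show "(\<Sum>s=1..n. (U s)\<^sup>2) \<le> 4 * real n \<and>
      (\<Sum>s=1..n. (\<theta> s)\<^sup>2 / 2 - \<epsilon> * H * \<theta> s) + H * (\<Sum>j=1..n. b' / L j j - b)
      \<le> - \<epsilon> * H * t * real n + H\<^sup>2 * T
        + real n * (8 * H\<^sup>2 * w + 5 * t\<^sup>2 + 2 * H * \<bar>b\<bar> * (\<delta> + w))"
      by (simp add: T)
  next
    case False
    have N: "1 \<le> N" using False by (simp add: N_def)
    have "0 \<le> (\<Sum>s\<in>{1..<1::nat}. (L 1 s)\<^sup>2)" by simp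
    then have \<tau>0: "0 \<le> \<tau>" using row[of 1] False by simp
    have "1 * \<tau> \<le> N * \<tau>" using N \<tau>0 by (intro mult_right_mono)
    then have \<tau>w: "\<tau> \<le> w" and Nw: "N * \<tau> \<le> w" using w by (auto simp: N_def)
    have w0: "0 \<le> w" using \<tau>0 \<tau>w by simp
    have y: "0 \<le> y" "y\<^sup>2 = w" "y \<le> 1" using w0 w by (auto simp: y_def)
    have cd: "0 < L j j" "1 - \<tau> \<le> L j j" "L j j \<le> 1" "1 / L j j \<le> 1 + 2 * \<tau>" "1 \<le> 1 / L j j" if "j \<in> {1..n}" for j
    proof -
      have "0 \<le> (\<Sum>s=1..<j. (L j s)\<^sup>2)" by (rule sum_nonneg) simp
      with diag[OF that] row[OF that] \<tau>
        cholesky_diag_bounds[of "L j j" "\<Sum>s=1..<j. (L j s)\<^sup>2" \<tau>]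
      show "0 < L j j" "1 - \<tau> \<le> L j j" "L j j \<le> 1" "1 / L j j \<le> 1 + 2 * \<tau>" "1 \<le> 1 / L j j"
        by blast+
    qed
    have absrow: "(\<Sum>s=1..<j. \<bar>L j s\<bar>) \<le> y" if "j \<in> {1..n}" for j
    proof (rule abs_sum_le_sqrt[OF row[OF that]])
      have "real (card {1..<j}) * \<tau> \<le> N * \<tau>"
        using that \<tau>0 by (intro mult_right_mono) (auto simp: N_def)
      then show "real (card {1..<j}) * \<tau> \<le> y\<^sup>2" using Nw y by simp
    qed (use y in simp)
    have R: "\<bar>R j\<bar> \<le> y" if "j \<in> {1..n}" for j
      unfolding R_def using absrow[OF that] by (rule order_trans[OF sum_abs])

    have U': "U s = L s s + P s" if "s \<in> {1..n}" for s
    proof -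
      have "{s..n} = insert s {s<..n}" using that by auto
      then show ?thesis by (simp add: U P_def)
    qed
    have sqrow: "(\<Sum>j=1..n. \<Sum>s=1..<j. (L j s)\<^sup>2) \<le> w"
    proof -
      have "(\<Sum>j=1..n. \<Sum>s=1..<j. (L j s)\<^sup>2) \<le> (\<Sum>j=1..n. \<tau>)"
        by (rule sum_mono) (rule row)
      then show ?thesis using Nw by (simp add: N_def)
    qed
    \<comment> \<open>Columns are controlled through rows: Cauchy-Schwarz in each column, then an
      exchange of summation to reach the total of the squared entries below the diagonal, at most n
      \<tau>.\<close>
    have P2: "(\<Sum>s=1..n. (P s)\<^sup>2) \<le> N * w"
    proof -
      have "(\<Sum>s=1..n. (P s)\<^sup>2) \<le> (\<Sum>s=1..n. N * (\<Sum>j\<in>{s<..n}. (L j s)\<^sup>2))"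
      proof (rule sum_mono)
        fix s assume "s \<in> {1..n}"
        have "(P s)\<^sup>2 \<le> (\<Sum>j\<in>{s<..n}. (L j s)\<^sup>2) * real (card {s<..n})"
          using Cauchy_Schwarz_ineq_sum[of "\<lambda>j. L j s" "\<lambda>_. 1" "{s<..n}"] by (simp add: P_def)
        also have "\<dots> \<le> (\<Sum>j\<in>{s<..n}. (L j s)\<^sup>2) * N"
          by (intro mult_left_mono sum_nonneg) (auto simp: N_def)
        finally show "(P s)\<^sup>2 \<le> N * (\<Sum>j\<in>{s<..n}. (L j s)\<^sup>2)" by (simp add: mult.commute)
      qed
      also have "\<dots> = N * (\<Sum>j=1..n. \<Sum>s=1..<j. (L j s)\<^sup>2)"
        by (simp only: sum_distrib_left[symmetric] sum_triangle_swap[of "\<lambda>j s. (L j s)\<^sup>2"])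
      also have "\<dots> \<le> N * w" using sqrow N by (intro mult_left_mono) auto
      finally show ?thesis .
    qed
    have Q2: "(\<Sum>s=1..n. (Q s)\<^sup>2) \<le> 3 * N * w"
    proof -
      have "(\<Sum>s=1..n. (Q s)\<^sup>2) \<le> (\<Sum>s=1..n. 3 * N * (\<Sum>j\<in>{s<..n}. (L j s)\<^sup>2))"
      proof (rule sum_mono)
        fix s assume s: "s \<in> {1..n}"
        have "(Q s)\<^sup>2 \<le> (\<Sum>j\<in>{s<..n}. (L j s / L j j)\<^sup>2) * real (card {s<..n})"
          using Cauchy_Schwarz_ineq_sum[of "\<lambda>j. L j s / L j j" "\<lambda>_. 1" "{s<..n}"] by (simp add: Q_def)
        also have "\<dots> \<le> (\<Sum>j\<in>{s<..n}. (L j s / L j j)\<^sup>2) * N"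
          by (intro mult_left_mono sum_nonneg) (auto simp: N_def)
        also have "\<dots> \<le> (\<Sum>j\<in>{s<..n}. 3 * (L j s)\<^sup>2) * N"
        proof (intro mult_right_mono sum_mono)
          fix j assume j: "j \<in> {s<..n}"
          have "1 / L j j \<le> 3 / 2" "0 < L j j" using cd[of j] s j \<tau> by auto
          then have "(1 / L j j)\<^sup>2 \<le> (3 / 2)\<^sup>2" by (intro power_mono) auto
          then have "(L j s)\<^sup>2 * (1 / L j j)\<^sup>2 \<le> (L j s)\<^sup>2 * 3"
            by (intro mult_left_mono) (auto simp: power2_eq_square)
          then show "(L j s / L j j)\<^sup>2 \<le> 3 * (L j s)\<^sup>2"
            by (simp add: power_divide)
        qed (use N in simp)
        finally show "(Q s)\<^sup>2 \<le> 3 * N * (\<Sum>j\<in>{s<..n}. (L j s)\<^sup>2)"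
          by (simp add: sum_distrib_left[symmetric] mult_ac)
      qed
      also have "\<dots> = 3 * N * (\<Sum>j=1..n. \<Sum>s=1..<j. (L j s)\<^sup>2)"
        by (simp only: sum_distrib_left[symmetric] sum_triangle_swap[of "\<lambda>j s. (L j s)\<^sup>2"])
      also have "\<dots> \<le> 3 * N * w" using sqrow N by (intro mult_left_mono) auto
      finally show ?thesis .
    qed
    have U2: "(\<Sum>s=1..n. (U s)\<^sup>2) \<le> 4 * N"
    proof -
      have "(\<Sum>s=1..n. (U s)\<^sup>2) \<le> (\<Sum>s=1..n. 2 + 2 * (P s)\<^sup>2)"
      proof (rule sum_mono)
        fix s assume s: "s \<in> {1..n}"
        have "(L s s)\<^sup>2 \<le> 1" using cd[OF s] by (simp add: power_le_one_iff)
        moreover have "0 \<le> (L s s - P s)\<^sup>2" by simp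
        ultimately show "(U s)\<^sup>2 \<le> 2 + 2 * (P s)\<^sup>2"
          unfolding U'[OF s] by (simp add: power2_eq_square algebra_simps)
      qed
      also have "\<dots> = 2 * N + 2 * (\<Sum>s=1..n. (P s)\<^sup>2)"
        by (simp add: sum.distrib sum_distrib_left N_def)
      also have "\<dots> \<le> 2 * N + 2 * (N * w)" using P2 by simp
      also have "N * w \<le> N * 1" using N w by (intro mult_left_mono) auto
      finally show ?thesis by simp
    qed
    have sq: "(\<Sum>s=1..n. (\<theta> s)\<^sup>2 / 2) \<le> 4 * N * t\<^sup>2 + 3 * N * H\<^sup>2 * w"
    proof -
      have "(\<Sum>s=1..n. (\<theta> s)\<^sup>2 / 2) \<le> (\<Sum>s=1..n. t\<^sup>2 * (U s)\<^sup>2 + H\<^sup>2 * (Q s)\<^sup>2)"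
      proof (rule sum_mono)
        fix s
        have "0 \<le> (t * U s + \<epsilon> * H * Q s)\<^sup>2" by simp
        moreover have "\<epsilon> * \<epsilon> = 1" using \<epsilon> by auto
        ultimately show "(\<theta> s)\<^sup>2 / 2 \<le> t\<^sup>2 * (U s)\<^sup>2 + H\<^sup>2 * (Q s)\<^sup>2"
          using \<epsilon> unfolding \<theta> Q_def[symmetric] by (auto simp: power2_eq_square algebra_simps)
      qed
      also have "\<dots> = t\<^sup>2 * (\<Sum>s=1..n. (U s)\<^sup>2) + H\<^sup>2 * (\<Sum>s=1..n. (Q s)\<^sup>2)"
        by (simp add: sum.distrib sum_distrib_left)
      also have "\<dots> \<le> t\<^sup>2 * (4 * N) + H\<^sup>2 * (3 * N * w)"
        by (intro add_mono mult_left_mono U2 Q2) auto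
      finally show ?thesis by (simp add: mult_ac)
    qed
    have sumU: "\<bar>(\<Sum>s=1..n. U s) - N\<bar> \<le> N * (2 * y)"
    proof -
      have "(\<Sum>s=1..n. U s) = (\<Sum>s=1..n. L s s + P s)"
        by (rule sum.cong) (simp_all add: U')
      also have "\<dots> = (\<Sum>s=1..n. L s s) + (\<Sum>s=1..n. P s)"
        by (rule sum.distrib)
      also have "(\<Sum>s=1..n. P s) = (\<Sum>j=1..n. R j)"
        unfolding P_def R_def by (rule sum_triangle_swap)
      finally have "(\<Sum>s=1..n. U s) - N = (\<Sum>j=1..n. (L j j - 1) + R j)"
        by (simp add: sum.distrib sum_subtractf N_def)
      also have "\<bar>\<dots>\<bar> \<le> (\<Sum>j=1..n. 2 * y)"
      proof (rule order_trans[OF sum_abs], rule sum_mono)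
        fix j assume j: "j \<in> {1..n}"
        have "y * y \<le> y * 1" using y by (intro mult_left_mono) auto
        then have "w \<le> y" using y(2) by (simp add: power2_eq_square)
        then show "\<bar>L j j - 1 + R j\<bar> \<le> 2 * y"
          using cd[OF j] R[OF j] \<tau>w by linarith
      qed
      finally show ?thesis by (simp add: N_def)
    qed
    \<comment> \<open>\<open>R j\<close> is of order sqrt w, so it has to be matched with inner
      products and not merely bounded. The inner product of rows j and i is
      \<open>L j i * L i i\<close> plus a product of off-diagonal parts. Replacing 1 /
      \<open>L j j\<close> by \<open>L i i\<close> costs 3 \<tau> times the absolute value of
      \<open>L j i\<close>, the product costs \<tau>, and summing over i < j gives at most 4
      w.\<close>
    have sumQ: "(\<Sum>s=1..n. Q s) \<le> T + N * (4 * w)"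
    proof -
      have *: "R j / L j j \<le> (\<Sum>i=1..<j. \<Sum>s=1..i. L j s * L i s) + 4 * w" if j: "j \<in> {1..n}" for j
      proof -
        have "R j / L j j - (\<Sum>i=1..<j. \<Sum>s=1..i. L j s * L i s)
            = (\<Sum>i=1..<j. L j i * (1 / L j j - L i i) - (\<Sum>s=1..<i. L j s * L i s))"
        proof -
          have "(\<Sum>s=1..i. L j s * L i s) = L j i * L i i + (\<Sum>s=1..<i. L j s * L i s)" if "i \<in> {1..<j}" for i
          proof -
            have "{1..i} = insert i {1..<i}" using that by auto
            then show ?thesis by simp
          qed
          then have "(\<Sum>i=1..<j. \<Sum>s=1..i. L j s * L i s) = (\<Sum>i=1..<j. L j i * L i i + (\<Sum>s=1..<i. L j s * L i s))"
            by (intro sum.cong) auto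
          moreover have "R j / L j j = (\<Sum>i=1..<j. L j i * (1 / L j j))"
            by (simp add: R_def sum_divide_distrib)
          ultimately show ?thesis
            by (simp only: sum_subtractf[symmetric]) (simp add: right_diff_distrib diff_diff_eq)
        qed
        also have "\<dots> \<le> (\<Sum>i=1..<j. 3 * \<tau> * \<bar>L j i\<bar> + \<tau>)"
        proof (rule sum_mono)
          fix i assume i: "i \<in> {1..<j}"
          then have i': "i \<in> {1..n}" using j by auto
          have "L j i * (1 / L j j - L i i) \<le> \<bar>L j i\<bar> * \<bar>1 / L j j - L i i\<bar>"
            by (metis abs_ge_self abs_mult)
          also have "\<dots> \<le> \<bar>L j i\<bar> * (3 * \<tau>)"
            using cd[OF j] cd[OF i'] by (intro mult_left_mono) linarith+
          finally have 1: "L j i * (1 / L j j - L i i) \<le> 3 * \<tau> * \<bar>L j i\<bar>"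
            by (simp add: mult_ac)
          have "- (\<Sum>s=1..<i. L j s * L i s) \<le> (\<Sum>s=1..<i. ((L j s)\<^sup>2 + (L i s)\<^sup>2) / 2)"
            unfolding sum_negf[symmetric]
          proof (rule sum_mono)
            fix s
            have "0 \<le> (L j s + L i s)\<^sup>2" by simp
            then show "- (L j s * L i s) \<le> ((L j s)\<^sup>2 + (L i s)\<^sup>2) / 2"
              by (simp add: power2_eq_square algebra_simps)
          qed
          also have "\<dots> = ((\<Sum>s=1..<i. (L j s)\<^sup>2) + (\<Sum>s=1..<i. (L i s)\<^sup>2)) / 2"
            by (simp add: sum.distrib sum_divide_distrib[symmetric])
          also have "\<dots> \<le> (\<tau> + \<tau>) / 2"
          proof -
            have "(\<Sum>s=1..<i. (L j s)\<^sup>2) \<le> (\<Sum>s=1..<j. (L j s)\<^sup>2)"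
              using i by (intro sum_mono2) auto
            then show ?thesis using row[OF j] row[OF i'] by simp
          qed
          finally show "L j i * (1 / L j j - L i i) - (\<Sum>s=1..<i. L j s * L i s) \<le> 3 * \<tau> * \<bar>L j i\<bar> + \<tau>"
            using 1 by simp
        qed
        also have "\<dots> = 3 * \<tau> * (\<Sum>i=1..<j. \<bar>L j i\<bar>) + real (j - 1) * \<tau>"
          by (simp add: sum.distrib sum_distrib_left)
        also have "\<dots> \<le> 3 * \<tau> * 1 + N * \<tau>"
          using absrow[OF j] y \<tau>0 j by (intro add_mono mult_left_mono mult_right_mono) (auto simp: N_def)
        finally have "R j / L j j \<le> (\<Sum>i=1..<j. \<Sum>s=1..i. L j s * L i s) + (3 * \<tau> + N * \<tau>)" by simp
        then show ?thesis using \<tau>w Nw by linarith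
      qed
      have "(\<Sum>s=1..n. Q s) = (\<Sum>j=1..n. \<Sum>s=1..<j. L j s / L j j)"
        unfolding Q_def by (rule sum_triangle_swap)
      also have "\<dots> = (\<Sum>j=1..n. R j / L j j)"
        by (simp add: R_def sum_divide_distrib)
      also have "\<dots> \<le> (\<Sum>j=1..n. (\<Sum>i=1..<j. \<Sum>s=1..i. L j s * L i s) + 4 * w)"
        by (rule sum_mono) (rule *)
      also have "\<dots> = T + N * (4 * w)"
        by (simp add: sum.distrib T N_def)
      finally show ?thesis .
    qed
    have \<epsilon>2: "\<epsilon> * \<epsilon> = 1" "\<bar>\<epsilon>\<bar> = 1" using \<epsilon> by auto
    have "(\<Sum>s=1..n. - \<epsilon> * H * \<theta> s) = - \<epsilon> * H * t * (\<Sum>s=1..n. U s) + H\<^sup>2 * (\<Sum>s=1..n. Q s)"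
    proof -
      have "- \<epsilon> * H * \<theta> s = - \<epsilon> * H * t * U s + H\<^sup>2 * Q s" for s
        using \<epsilon> unfolding \<theta> Q_def[symmetric] by (auto simp: power2_eq_square algebra_simps)
      then show ?thesis by (simp only: sum.distrib sum_distrib_left)
    qed
    also have "\<dots> \<le> (- \<epsilon> * H * t * N + N * (t\<^sup>2 + H\<^sup>2 * w)) + H\<^sup>2 * (T + N * (4 * w))"
    proof (intro add_mono mult_left_mono sumQ)
      have "- \<epsilon> * H * t * (\<Sum>s=1..n. U s) - (- \<epsilon> * H * t * N) = - \<epsilon> * H * t * ((\<Sum>s=1..n. U s) - N)"
        by (simp add: algebra_simps)
      also have "\<dots> \<le> \<bar>- \<epsilon> * H * t\<bar> * \<bar>(\<Sum>s=1..n. U s) - N\<bar>"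
        by (metis abs_ge_self abs_mult)
      also have "\<bar>- \<epsilon> * H * t\<bar> = H * t"
        using \<epsilon>2 H t by (simp add: abs_mult)
      also have "H * t * \<bar>(\<Sum>s=1..n. U s) - N\<bar> \<le> H * t * (N * (2 * y))"
        using H t by (intro mult_left_mono sumU) auto
      \<comment> \<open>Both t and y are of order 1/D, so the inequality of the means splits this
        into two terms of order 1/D^2.\<close>
      also have "\<dots> = N * (2 * t * (H * y))" by (simp add: algebra_simps)
      also have "\<dots> \<le> N * (t\<^sup>2 + (H * y)\<^sup>2)"
        using N by (intro mult_left_mono sum_squares_bound) auto
      finally show "- \<epsilon> * H * t * (\<Sum>s=1..n. U s) \<le> - \<epsilon> * H * t * N + N * (t\<^sup>2 + H\<^sup>2 * w)"
        using y by (simp add: power_mult_distrib)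
    qed simp
    finally have lin: "(\<Sum>s=1..n. - \<epsilon> * H * \<theta> s) \<le> \<dots>" .
    have last: "H * (\<Sum>j=1..n. b' / L j j - b) \<le> N * (2 * H * \<bar>b\<bar> * (\<delta> + w))"
    proof -
      have "(\<Sum>j=1..n. b' / L j j - b) \<le> (\<Sum>j=1..n. \<bar>b\<bar> * (2 * (\<delta> + w)))"
      proof (rule sum_mono)
        fix j assume j: "j \<in> {1..n}"
        have eq: "b' / L j j - b = b * (1 / L j j - 1) + \<bar>b\<bar> * (\<delta> * (1 / L j j))"
          by (simp add: b' add_divide_distrib algebra_simps)
        have "b * (1 / L j j - 1) \<le> \<bar>b\<bar> * (2 * \<tau>)"
          using cd[OF j] by (intro mult_mono) auto
        moreover have "\<bar>b\<bar> * (2 * \<tau>) \<le> \<bar>b\<bar> * (2 * w)"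
          using \<tau>w by (intro mult_left_mono) auto
        moreover have "\<bar>b\<bar> * (\<delta> * (1 / L j j)) \<le> \<bar>b\<bar> * (\<delta> * 2)"
          using cd[OF j] \<tau> \<delta> by (intro mult_left_mono) linarith+
        ultimately show "b' / L j j - b \<le> \<bar>b\<bar> * (2 * (\<delta> + w))"
          unfolding eq by (simp add: algebra_simps)
      qed
      also have "\<dots> = N * (\<bar>b\<bar> * (2 * (\<delta> + w)))" by (simp add: N_def)
      finally have "H * (\<Sum>j=1..n. b' / L j j - b) \<le> H * (N * (\<bar>b\<bar> * (2 * (\<delta> + w))))"
        using H by (intro mult_left_mono)
      then show ?thesis by (simp add: mult_ac)
    qed
    have split: "(\<Sum>s=1..n. (\<theta> s)\<^sup>2 / 2 - \<epsilon> * H * \<theta> s)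
        = (\<Sum>s=1..n. (\<theta> s)\<^sup>2 / 2) + (\<Sum>s=1..n. - \<epsilon> * H * \<theta> s)"
      by (subst sum.distrib[symmetric]) simp
    have "(\<Sum>s=1..n. (\<theta> s)\<^sup>2 / 2 - \<epsilon> * H * \<theta> s) + H * (\<Sum>j=1..n. b' / L j j - b)
      \<le> - \<epsilon> * H * t * N + H\<^sup>2 * T + N * (8 * H\<^sup>2 * w + 5 * t\<^sup>2 + 2 * H * \<bar>b\<bar> * (\<delta> + w))"
      unfolding split using sq lin last by (simp add: algebra_simps)
    with U2 show "(\<Sum>s=1..n. (U s)\<^sup>2) \<le> 4 * real n \<and>
      (\<Sum>s=1..n. (\<theta> s)\<^sup>2 / 2 - \<epsilon> * H * \<theta> s) + H * (\<Sum>j=1..n. b' / L j j - b)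
      \<le> - \<epsilon> * H * t * real n + H\<^sup>2 * T
        + real n * (8 * H\<^sup>2 * w + 5 * t\<^sup>2 + 2 * H * \<bar>b\<bar> * (\<delta> + w))"
      unfolding N_def by blast
  qed
qed

section \<open>Transfer from the Gaussian to the sphere\<close>

lemma ip_cong:
  assumes "\<And>i. i \<le> k \<Longrightarrow> x i = x' i" "\<And>i. i \<le> k \<Longrightarrow> y i = y' i"
  shows "ip k x y = ip k x' y'"
  unfolding ip_def using assms by (intro sum.cong) auto

lemma abs_ip_le: "\<bar>ip k x y\<bar> \<le> L2_set x {..k} * L2_set y {..k}"
  unfolding ip_def
  by (rule order_trans[OF sum_abs]) (simp add: abs_mult L2_set_mult_ineq)

lemma ip_normalise: "ip k (normalise_k k g) y = ip k g y / L2_set g {..k}"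
  unfolding ip_restrict by (simp add: ip_def sum_divide_distrib)

lemma sum_lower_triangle_swap:
  fixes f :: "nat \<Rightarrow> nat \<Rightarrow> real"
  shows "(\<Sum>j=1..n. \<Sum>s=1..j. f j s) = (\<Sum>s=1..n. \<Sum>j\<in>{s..n}. f j s)"
proof -
  have "(\<Sum>j=1..n. \<Sum>s=1..j. f j s) = (\<Sum>(j, s)\<in>(SIGMA j:{1..n}. {1..j}). f j s)"
    by (rule sum.Sigma) auto
  also have "\<dots> = (\<Sum>(s, j)\<in>(SIGMA s:{1..n}. {s..n}). f j s)"
    by (rule sum.reindex_bij_witness[of _ "\<lambda>(a, b). (b, a)" "\<lambda>(a, b). (b, a)"]) auto
  also have "\<dots> = (\<Sum>s=1..n. \<Sum>j\<in>{s..n}. f j s)"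
    by (rule sum.Sigma[symmetric]) auto
  finally show ?thesis .
qed

lemma ip_orthonormal_sums:
  assumes orth: "\<And>s t. s \<in> I \<Longrightarrow> t \<in> I \<Longrightarrow> ip k (e s) (e t) = (if s = t then 1 else 0)"
    and fin: "finite I"
  shows "ip k (\<lambda>i. \<Sum>s\<in>I. u s * e s i) (\<lambda>i. \<Sum>s\<in>I. v s * e s i) = (\<Sum>s\<in>I. u s * v s)"
proof -
  have "ip k (\<lambda>i. \<Sum>s\<in>I. u s * e s i) (\<lambda>i. \<Sum>s\<in>I. v s * e s i)
      = (\<Sum>s\<in>I. \<Sum>t\<in>I. u s * (v t * ip k (e s) (e t)))"
    by (simp add: ip_sum_left ip_sum_right ip_scale_left ip_scale_right sum_distrib_left)
  also have "\<dots> = (\<Sum>s\<in>I. \<Sum>t\<in>I. if s = t then u s * v t else 0)"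
    by (intro sum.cong refl) (auto simp: orth)
  also have "\<dots> = (\<Sum>s\<in>I. u s * v s)"
    using fin by (simp add: sum.delta)
  finally show ?thesis .
qed

lemma gauss_k_norm_window_ge_half:
  assumes "0 < d" "1 \<le> k" "10 \<le> d\<^sup>2 * real k"
  shows "1 / 2 \<le> measure (gauss_k k) {x \<in> space (lborel_k k). L2_set x {..k} \<in> norm_window k d}"
proof -
  interpret prob_space "gauss_k k" by (rule prob_space_gauss_k)
  have sp: "space (gauss_k k) = space (lborel_k k)"
    by (simp add: space_gauss_k space_lborel_k)
  have "5 / (d\<^sup>2 * real k) \<le> 1 / 2"
    using assms by (simp add: divide_le_eq)
  then have "prob {x \<in> space (lborel_k k). L2_set x {..k} \<notin> norm_window k d} \<le> 1 / 2"
    using gauss_k_norm_concentration[OF assms(1,2)] by linarith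
  moreover have "prob {x \<in> space (lborel_k k). L2_set x {..k} \<notin> norm_window k d}
      = 1 - prob {x \<in> space (lborel_k k). L2_set x {..k} \<in> norm_window k d}"
    using prob_neg[of "\<lambda>x. L2_set x {..k} \<in> norm_window k d"] by (simp add: sp)
  ultimately show ?thesis by linarith
qed

text \<open>Direction and norm of a Gaussian g are independent, so the sphere integral times the
  probability of the norm window is a Gaussian integral over the window. There g / |g| is replaced
  by g / sqrt k: the threshold grows by at most |b| \<delta>, the tilt exponent by at most 2 s sqrt
  n \<delta>. The window has probability at least 1/2, whence the factor 2.\<close>

lemma sphere_row_bound:
  fixes e x L :: "nat \<Rightarrow> nat \<Rightarrow> real"
  assumes \<epsilon>: "\<epsilon> = 1 \<or> \<epsilon> = - 1"
    and k: "1 \<le> k" and \<delta>: "0 < \<delta>" "\<delta> < 1" "10 \<le> \<delta>\<^sup>2 * real k"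
    and orth: "\<And>s t. s \<in> {1..n} \<Longrightarrow> t \<in> {1..n} \<Longrightarrow> ip k (e s) (e t) = (if s = t then 1 else 0)"
    and x: "\<And>j i. j \<in> {1..n} \<Longrightarrow> i \<le> k \<Longrightarrow> x j i = (\<Sum>s=1..j. L j s * e s i)"
    and diag: "\<And>j. j \<in> {1..n} \<Longrightarrow> 0 < L j j \<and> (L j j)\<^sup>2 = 1 - (\<Sum>s=1..<j. (L j s)\<^sup>2)"
    and row: "\<And>j. j \<in> {1..n} \<Longrightarrow> (\<Sum>s=1..<j. (L j s)\<^sup>2) \<le> \<tau>"
    and \<tau>: "\<tau> \<le> 1/4" and w: "real n * \<tau> \<le> w" "w \<le> 1"
    and s: "0 \<le> s"
  shows "(\<integral>\<^sup>+y. (if \<forall>j\<in>{1..n}. \<epsilon> * ip k y (x j) \<le> b / sqrt (real k)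
            then ennreal (exp (s * (\<Sum>j=1..n. ip k y (x j)))) else 0) \<partial>uniform_sphere k)
    \<le> ennreal (2 * Phi b ^ n * exp (- \<epsilon> * hazard b * (s / sqrt (real k)) * real n
          + (hazard b)\<^sup>2 * (\<Sum>j=1..n. \<Sum>i=1..<j. ip k (x j) (x i))
          + real n * (8 * (hazard b)\<^sup>2 * w + 5 * (s / sqrt (real k))\<^sup>2 + 2 * hazard b * \<bar>b\<bar> * (\<delta> + w))
          + 2 * s * sqrt (real n) * \<delta>))"
proof -
  interpret G: prob_space "gauss_k k" by (rule prob_space_gauss_k)
  let ?H = "hazard b" and ?t = "s / sqrt (real k)" and ?r = "\<lambda>g. L2_set g {..k}"
  let ?I = "norm_window k \<delta>" and ?b' = "b + \<bar>b\<bar> * \<delta>"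
  define U where "U s = (\<Sum>j\<in>{s..n}. L j s)" for s
  define \<theta> where "\<theta> s = ?t * U s - \<epsilon> * ?H * (\<Sum>j\<in>{s<..n}. L j s / L j j)" for s
  define T where "T = (\<Sum>j=1..n. \<Sum>i=1..<j. \<Sum>s=1..i. L j s * L i s)"
  define S where "S = (\<lambda>i. \<Sum>s=1..n. U s * e s i)"
  have rk: "0 < sqrt (real k)" using k by simp
  have ipx: "ip k g (x j) = (\<Sum>s=1..j. L j s * ip k g (e s))" if "j \<in> {1..n}" for j g
  proof -
    have "ip k g (x j) = ip k g (\<lambda>i. \<Sum>s=1..j. L j s * e s i)"
      using that by (intro ip_cong) (auto simp: x)
    then show ?thesis by (simp add: ip_sum_right ip_scale_right)
  qed
  have T: "T = (\<Sum>j=1..n. \<Sum>i=1..<j. ip k (x j) (x i))"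
    unfolding T_def
  proof (intro sum.cong refl)
    fix j i assume ji: "j \<in> {1..n}" "i \<in> {1..<j}"
    then have i: "i \<in> {1..n}" by auto
    have "ip k (x j) (e s) = L j s" if "s \<in> {1..i}" for s
    proof -
      have "ip k (x j) (e s) = (\<Sum>t=1..j. L j t * ip k (e s) (e t))"
        using ipx[OF ji(1), of "e s"] by (simp add: ip_commute)
      also have "\<dots> = (\<Sum>t=1..j. if t = s then L j t else 0)"
        using that ji by (intro sum.cong) (auto simp: orth)
      also have "\<dots> = L j s" using that ji by simp
      finally show ?thesis .
    qed
    then show "(\<Sum>s=1..i. L j s * L i s) = ip k (x j) (x i)"
      unfolding ipx[OF i] by (intro sum.cong) auto
  qed
  have sumx: "(\<Sum>j=1..n. ip k g (x j)) = (\<Sum>s=1..n. U s * ip k g (e s))" for g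
  proof -
    have "(\<Sum>j=1..n. ip k g (x j)) = (\<Sum>j=1..n. \<Sum>s=1..j. L j s * ip k g (e s))"
      by (intro sum.cong refl ipx)
    also have "\<dots> = (\<Sum>s=1..n. \<Sum>j\<in>{s..n}. L j s * ip k g (e s))"
      by (rule sum_lower_triangle_swap)
    finally show ?thesis by (simp add: U_def sum_distrib_right)
  qed
  have est: "(\<Sum>s=1..n. (U s)\<^sup>2) \<le> 4 * real n"
    "(\<Sum>s=1..n. (\<theta> s)\<^sup>2 / 2 - \<epsilon> * ?H * \<theta> s) + ?H * (\<Sum>j=1..n. ?b' / L j j - b)
      \<le> - \<epsilon> * ?H * ?t * real n + ?H\<^sup>2 * T
        + real n * (8 * ?H\<^sup>2 * w + 5 * ?t\<^sup>2 + 2 * ?H * \<bar>b\<bar> * (\<delta> + w))"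
    using cholesky_estimate[where b=b and \<delta>=\<delta>, OF \<epsilon> diag row \<tau> w U_def \<theta>_def T_def _ _ _ refl]
      less_imp_le[OF hazard_pos[of b]] s \<delta> by auto
  \<comment> \<open>S is the sum of the points \<open>x j\<close>. Nearly orthogonal unit vectors
    have a sum of norm O(sqrt n), and this keeps the cost of rescaling the tilt small.\<close>
  have normS: "\<bar>\<Sum>s=1..n. U s * ip k g (e s)\<bar> \<le> ?r g * (2 * sqrt (real n))" for g
  proof -
    have "(?r S)\<^sup>2 = (\<Sum>s=1..n. (U s)\<^sup>2)"
      unfolding ip_self[symmetric] S_def using ip_orthonormal_sums[of "{1..n}" k e U U] orth
      by (simp add: power2_eq_square)
    also have "\<dots> \<le> (2 * sqrt (real n))\<^sup>2" using est(1) by (simp add: power_mult_distrib)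
    finally have "?r S \<le> 2 * sqrt (real n)"
      by (rule power2_le_imp_le) simp
    moreover have "(\<Sum>s=1..n. U s * ip k g (e s)) = ip k g S"
      by (simp add: S_def ip_sum_right ip_scale_right)
    ultimately show ?thesis
      using abs_ip_le[of k g S] mult_left_mono[of "?r S" "2 * sqrt (real n)" "?r g"]
      by (simp add: L2_set_nonneg)
  qed
  define f where "f = (\<lambda>y. if \<forall>j\<in>{1..n}. \<epsilon> * ip k y (x j) \<le> b / sqrt (real k)
            then ennreal (exp (s * (\<Sum>j=1..n. ip k y (x j)))) else 0)"
  define F where "F = (\<lambda>g. if \<forall>j\<in>{1..n}. \<epsilon> * (\<Sum>s=1..j. L j s * ip k g (e s)) \<le> ?b'
            then ennreal (exp (\<Sum>s=1..n. (?t * U s) * ip k g (e s))) else 0)"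
  have [measurable]: "f \<in> borel_measurable (lborel_k k)" "F \<in> borel_measurable (lborel_k k)"
    unfolding f_def F_def by measurable
  have pw: "f (normalise_k k g) * indicator ?I (?r g) \<le> ennreal (exp (2 * s * sqrt (real n) * \<delta>)) * F g" for g
  proof (cases "?r g \<in> ?I \<and> (\<forall>j\<in>{1..n}. \<epsilon> * ip k (normalise_k k g) (x j) \<le> b / sqrt (real k))")
    case True
    define r where "r = ?r g"
    have rI: "\<bar>r - sqrt (real k)\<bar> \<le> \<delta> * sqrt (real k)"
      using True by (simp add: norm_window_def r_def)
    have "\<delta> * sqrt (real k) < 1 * sqrt (real k)"
      using \<delta> rk by (intro mult_strict_right_mono) auto
    then have r: "0 < r" using rI by linarith
    have ratio: "\<bar>r / sqrt (real k) - 1\<bar> \<le> \<delta>"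
    proof -
      have "r / sqrt (real k) - 1 = (r - sqrt (real k)) / sqrt (real k)"
        using rk by (simp add: field_simps)
      then show ?thesis using rI rk by (simp add: divide_le_eq)
    qed
    have "\<epsilon> * (\<Sum>s=1..j. L j s * ip k g (e s)) \<le> ?b'" if j: "j \<in> {1..n}" for j
    proof -
      have "\<epsilon> * (ip k g (x j) / r) \<le> b / sqrt (real k)"
        using True j unfolding ip_normalise r_def by blast
      then have "\<epsilon> * ip k g (x j) \<le> b * (r / sqrt (real k))"
        using r by (simp add: field_simps)
      moreover have "b * (r / sqrt (real k)) = b + b * (r / sqrt (real k) - 1)" by (simp add: algebra_simps)
      moreover have "b * (r / sqrt (real k) - 1) \<le> \<bar>b\<bar> * \<delta>"
        using mult_left_mono[OF ratio, of "\<bar>b\<bar>"] by (metis abs_ge_self abs_ge_zero abs_mult order_trans)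
      ultimately show ?thesis using ipx[OF j, of g] by simp
    qed
    moreover have "s * (\<Sum>j=1..n. ip k (normalise_k k g) (x j))
        \<le> 2 * s * sqrt (real n) * \<delta> + (\<Sum>s=1..n. (?t * U s) * ip k g (e s))"
    proof -
      define Y where "Y = (\<Sum>s=1..n. U s * ip k g (e s))"
      have "(\<Sum>j=1..n. ip k (normalise_k k g) (x j)) = Y / r"
        unfolding ip_normalise Y_def sumx[symmetric] r_def by (simp add: sum_divide_distrib)
      moreover have "(\<Sum>s=1..n. (?t * U s) * ip k g (e s)) = ?t * Y"
        by (simp add: Y_def sum_distrib_left mult.assoc)
      moreover have "s * (Y / r) - ?t * Y = s * ((Y / r) * (1 - r / sqrt (real k)))"
        using r rk by (simp add: field_simps)
      moreover have "(Y / r) * (1 - r / sqrt (real k)) \<le> (2 * sqrt (real n)) * \<delta>"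
      proof -
        have "\<bar>Y / r\<bar> \<le> 2 * sqrt (real n)"
          using normS[of g] r unfolding Y_def[symmetric] r_def[symmetric]
          by (simp add: abs_divide divide_le_eq mult.commute)
        then have "\<bar>Y / r\<bar> * \<bar>1 - r / sqrt (real k)\<bar> \<le> (2 * sqrt (real n)) * \<delta>"
          using ratio by (intro mult_mono) (auto simp: abs_minus_commute)
        then show ?thesis by (metis abs_ge_self abs_mult order_trans)
      qed
      ultimately show ?thesis
        using mult_left_mono[OF \<open>(Y / r) * (1 - r / sqrt (real k)) \<le> (2 * sqrt (real n)) * \<delta>\<close> s]
        by (simp add: mult_ac)
    qed
    ultimately show ?thesis
      using True by (simp add: f_def F_def ennreal_mult[symmetric] exp_add[symmetric] del: ip_restrict)
  next
    case False
    then show ?thesis by (auto simp: f_def indicator_def simp del: ip_restrict)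
  qed
  let ?c = "measure (gauss_k k) {x \<in> space (lborel_k k). ?r x \<in> ?I}"
  have c: "1 / 2 \<le> ?c" by (rule gauss_k_norm_window_ge_half) (use k \<delta> in auto)
  define X where "X = Phi b ^ n * exp (- \<epsilon> * ?H * ?t * real n + ?H\<^sup>2 * T
        + real n * (8 * ?H\<^sup>2 * w + 5 * ?t\<^sup>2 + 2 * ?H * \<bar>b\<bar> * (\<delta> + w)))"
  have X0: "0 \<le> X" using Phi_pos[of b] by (simp add: X_def less_imp_le)
  have "(\<integral>\<^sup>+g. F g \<partial>gauss_k k) \<le> ennreal (Phi b ^ n * exp ((\<Sum>s=1..n. (\<theta> s)\<^sup>2 / 2 - \<epsilon> * ?H * \<theta> s)
          + ?H * (\<Sum>j=1..n. ?b' / L j j - b)))"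
    unfolding F_def using diag by (intro gauss_row_bound \<epsilon> orth) (auto simp: \<theta>_def)
  also have "\<dots> \<le> ennreal X"
    unfolding X_def using est(2) Phi_pos[of b] by (intro ennreal_leI mult_left_mono) (auto simp: less_imp_le)
  finally have FX: "(\<integral>\<^sup>+g. F g \<partial>gauss_k k) \<le> ennreal X" .
  have "(\<integral>\<^sup>+y. f y \<partial>uniform_sphere k) * ennreal ?c = (\<integral>\<^sup>+g. f (normalise_k k g) * indicator ?I (?r g) \<partial>gauss_k k)"
    by (subst nn_integral_gauss_k_radial) (simp_all add: G.emeasure_eq_measure)
  also have "\<dots> \<le> (\<integral>\<^sup>+g. ennreal (exp (2 * s * sqrt (real n) * \<delta>)) * F g \<partial>gauss_k k)"
    by (intro nn_integral_mono pw)
  also have "\<dots> = ennreal (exp (2 * s * sqrt (real n) * \<delta>)) * (\<integral>\<^sup>+g. F g \<partial>gauss_k k)"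
    by (rule nn_integral_cmult) measurable
  also have "\<dots> \<le> ennreal (exp (2 * s * sqrt (real n) * \<delta>)) * ennreal X"
    by (intro mult_left_mono FX) simp
  finally have main: "(\<integral>\<^sup>+y. f y \<partial>uniform_sphere k) * ennreal ?c \<le> \<dots>" .
  have "(\<integral>\<^sup>+y. f y \<partial>uniform_sphere k) = (\<integral>\<^sup>+y. f y \<partial>uniform_sphere k) * ennreal (1 / 2) * ennreal 2"
  proof -
    have "ennreal (1 / 2) * ennreal 2 = ennreal (1 / 2 * 2)"
      by (rule ennreal_mult[symmetric]) auto
    then show ?thesis by (simp only: mult.assoc) simp
  qed
  also have "\<dots> \<le> (\<integral>\<^sup>+y. f y \<partial>uniform_sphere k) * ennreal ?c * ennreal 2"
    using c by (intro mult_right_mono mult_left_mono ennreal_leI) auto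
  also have "\<dots> \<le> ennreal (exp (2 * s * sqrt (real n) * \<delta>)) * ennreal X * ennreal 2"
    by (intro mult_right_mono main) simp
  also have "\<dots> = ennreal (2 * Phi b ^ n * exp (- \<epsilon> * ?H * ?t * real n + ?H\<^sup>2 * T
        + real n * (8 * ?H\<^sup>2 * w + 5 * ?t\<^sup>2 + 2 * ?H * \<bar>b\<bar> * (\<delta> + w)) + 2 * s * sqrt (real n) * \<delta>))"
  proof -
    have "ennreal (exp (2 * s * sqrt (real n) * \<delta>)) * ennreal X * ennreal 2
        = ennreal (exp (2 * s * sqrt (real n) * \<delta>) * X * 2)"
      using X0 by (simp only: ennreal_mult mult_nonneg_nonneg exp_ge_zero zero_le_numeral)
    then show ?thesis by (simp add: X_def exp_add mult_ac)
  qed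
  finally show ?thesis unfolding f_def T .
qed

section \<open>Gram--Schmidt orthogonalisation\<close>

text \<open>Norms and inner products see only the coordinates up to k, but the vectors are not cut
  off there, so the expansion of \<open>x n\<close> in them holds at every index. A residual of norm
  zero yields 0 by division; the bound on the squared coefficients excludes this wherever
  orthonormality is claimed.\<close>

function gram_schmidt :: "nat \<Rightarrow> (nat \<Rightarrow> nat \<Rightarrow> real) \<Rightarrow> nat \<Rightarrow> nat \<Rightarrow> real" where
  "gram_schmidt k x n = (\<lambda>i. (x n i - (\<Sum>s=1..<n. ip k (x n) (gram_schmidt k x s) * gram_schmidt k x s i)) /
     L2_set (\<lambda>i. x n i - (\<Sum>s=1..<n. ip k (x n) (gram_schmidt k x s) * gram_schmidt k x s i)) {..k})"
  by auto
termination by (relation "Wellfounded.measure (\<lambda>(k, x, n). n)") auto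

declare gram_schmidt.simps [simp del]

lemma gram_schmidt_cong:
  assumes "\<And>j. j \<in> {1..n} \<Longrightarrow> x j = x' j" "1 \<le> n"
  shows "gram_schmidt k x n = gram_schmidt k x' n"
  using assms
proof (induction n rule: less_induct)
  case (less n)
  have IH: "gram_schmidt k x s = gram_schmidt k x' s" if "s \<in> {1..<n}" for s
    using less.IH[of s] less.prems that by auto
  have "x n = x' n" using less.prems by auto
  then have "(\<lambda>i. x n i - (\<Sum>s=1..<n. ip k (x n) (gram_schmidt k x s) * gram_schmidt k x s i))
      = (\<lambda>i. x' n i - (\<Sum>s=1..<n. ip k (x' n) (gram_schmidt k x' s) * gram_schmidt k x' s i))"
    by (simp add: IH)
  then show ?case
    unfolding gram_schmidt.simps[of k x n] gram_schmidt.simps[of k x' n] by metis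
qed

text \<open>Row j of the Cholesky factor of the Gram matrix of unit vectors. The diagonal entry is
  written as the Pythagorean remainder, so that its positivity and its relation to the rest of the
  row are immediate.\<close>

definition gs_coeff :: "nat \<Rightarrow> (nat \<Rightarrow> nat \<Rightarrow> real) \<Rightarrow> nat \<Rightarrow> nat \<Rightarrow> real" where
  "gs_coeff k x j s = (if s < j then ip k (x j) (gram_schmidt k x s)
     else sqrt (1 - (\<Sum>t=1..<j. (ip k (x j) (gram_schmidt k x t))\<^sup>2)))"

text \<open>The residual of \<open>x n\<close> has squared norm 1 - q, with q the sum of its squared
  coefficients. The condition q < 1, which perfectness supplies, does the work of linear
  independence.\<close>

lemma gram_schmidt_step:
  assumes orth: "\<And>s t. s \<in> {1..<n} \<Longrightarrow> t \<in> {1..<n} \<Longrightarrow>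
      ip k (gram_schmidt k x s) (gram_schmidt k x t) = (if s = t then 1 else 0)"
    and unit: "ip k (x n) (x n) = 1"
    and lt: "(\<Sum>s=1..<n. (ip k (x n) (gram_schmidt k x s))\<^sup>2) < 1"
    and n: "1 \<le> n"
  shows "ip k (gram_schmidt k x n) (gram_schmidt k x n) = 1"
    and "t \<in> {1..<n} \<Longrightarrow> ip k (gram_schmidt k x n) (gram_schmidt k x t) = 0"
    and "x n i = (\<Sum>s=1..n. gs_coeff k x n s * gram_schmidt k x s i)"
proof -
  let ?e = "gram_schmidt k x"
  define c where "c s = ip k (x n) (?e s)" for s
  define z where "z = (\<lambda>i. x n i - (\<Sum>s=1..<n. c s * ?e s i))"
  define q where "q = (\<Sum>s=1..<n. (c s)\<^sup>2)"
  have q: "q < 1" using lt by (simp add: q_def c_def)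
  have en: "?e n = (\<lambda>i. z i / L2_set z {..k})"
    unfolding gram_schmidt.simps[of k x n] z_def c_def by simp
  have zz: "ip k z z = 1 - q"
  proof -
    have 1: "ip k (x n) (\<lambda>i. \<Sum>s=1..<n. c s * ?e s i) = q"
      by (simp add: ip_sum_right ip_scale_right c_def q_def power2_eq_square)
    have 2: "ip k (\<lambda>i. \<Sum>s=1..<n. c s * ?e s i) (x n) = q"
      by (subst ip_commute) (rule 1)
    have 3: "ip k (\<lambda>i. \<Sum>s=1..<n. c s * ?e s i) (\<lambda>i. \<Sum>s=1..<n. c s * ?e s i) = q"
      using ip_orthonormal_sums[of "{1..<n}" k ?e c c] orth by (simp add: q_def power2_eq_square)
    show ?thesis
      unfolding z_def ip_diff_left ip_diff_right 1 2 3 unit by simp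
  qed
  then have L: "L2_set z {..k} = sqrt (1 - q)"
    by (metis L2_set_nonneg ip_self real_sqrt_abs abs_of_nonneg)
  have s0: "0 < sqrt (1 - q)" using q by simp
  have en': "?e n = (\<lambda>i. (1 / sqrt (1 - q)) * z i)"
    using en L by simp
  show "ip k (?e n) (?e n) = 1"
    using zz q unfolding en' ip_scale_left ip_scale_right by (simp add: field_simps)
  show "ip k (?e n) (?e t) = 0" if t: "t \<in> {1..<n}"
  proof -
    have "ip k z (?e t) = c t - (\<Sum>s=1..<n. c s * ip k (?e s) (?e t))"
      unfolding z_def ip_diff_left ip_sum_left ip_scale_left by (simp add: c_def)
    also have "(\<Sum>s=1..<n. c s * ip k (?e s) (?e t)) = (\<Sum>s=1..<n. if s = t then c s else 0)"
      by (rule sum.cong[OF refl]) (simp add: orth[OF _ t])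
    also have "\<dots> = c t" using t by simp
    finally show ?thesis unfolding en' ip_scale_left by simp
  qed
  have "{1..n} = insert n {1..<n}" using n by auto
  moreover have "gs_coeff k x n n * ?e n i = z i"
  proof -
    have "gs_coeff k x n n = sqrt (1 - q)"
      by (simp add: gs_coeff_def q_def c_def)
    then show ?thesis using s0 by (simp add: en')
  qed
  moreover have "(\<Sum>s=1..<n. gs_coeff k x n s * ?e s i) = (\<Sum>s=1..<n. c s * ?e s i)"
    by (intro sum.cong) (auto simp: gs_coeff_def c_def)
  ultimately show "x n i = (\<Sum>s=1..n. gs_coeff k x n s * ?e s i)"
    by (simp add: z_def)
qed

lemma gram_schmidt_facts:
  assumes "\<And>j. j \<in> {1..n} \<Longrightarrow> ip k (x j) (x j) = 1"
    and "\<And>j. j \<in> {1..n} \<Longrightarrow> (\<Sum>s=1..<j. (ip k (x j) (gram_schmidt k x s))\<^sup>2) < 1"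
  shows "\<forall>s\<in>{1..n}. \<forall>t\<in>{1..n}. ip k (gram_schmidt k x s) (gram_schmidt k x t) = (if s = t then 1 else 0)"
  using assms
proof (induction n)
  case (Suc n)
  have IH: "\<forall>s\<in>{1..n}. \<forall>t\<in>{1..n}. ip k (gram_schmidt k x s) (gram_schmidt k x t) = (if s = t then 1 else 0)"
    using Suc by simp
  have eq: "{1..<Suc n} = {1..n}" by auto
  note st = gram_schmidt_step[of "Suc n" k x, unfolded eq]
  have 1: "ip k (gram_schmidt k x (Suc n)) (gram_schmidt k x (Suc n)) = 1"
    and 2: "\<And>t. t \<in> {1..n} \<Longrightarrow> ip k (gram_schmidt k x (Suc n)) (gram_schmidt k x t) = 0"
    using st(1,2)[OF IH[rule_format]] Suc.prems(1)[of "Suc n"] Suc.prems(2)[of "Suc n", unfolded eq] by simp_all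
  have 3: "ip k (gram_schmidt k x t) (gram_schmidt k x (Suc n)) = 0" if "t \<in> {1..n}" for t
    using 2[OF that] by (subst ip_commute)
  show ?case
  proof (intro ballI)
    fix s t assume "s \<in> {1..Suc n}" "t \<in> {1..Suc n}"
    then consider "s = Suc n" "t = Suc n" | "s = Suc n" "t \<in> {1..n}" | "s \<in> {1..n}" "t = Suc n"
      | "s \<in> {1..n}" "t \<in> {1..n}" by fastforce
    then show "ip k (gram_schmidt k x s) (gram_schmidt k x t) = (if s = t then 1 else 0)"
      by cases (use 1 2 3 IH in auto)
  qed
qed simp

text \<open>All vectors are expanded over one index set {1..m}, so that spans of different prefixes
  need not be compared.\<close>

lemma gram_schmidt_in_span:
  assumes "1 \<le> n" "n \<le> m"
  shows "\<exists>a. \<forall>i. gram_schmidt k x n i = (\<Sum>j=1..m. a j * x j i)"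
  using assms
proof (induction n rule: less_induct)
  case (less n)
  have "\<forall>s\<in>{1..<n}. \<exists>a. \<forall>i. gram_schmidt k x s i = (\<Sum>j=1..m. a j * x j i)"
    using less.IH less.prems by auto
  then obtain B where B: "\<And>s i. s \<in> {1..<n} \<Longrightarrow> gram_schmidt k x s i = (\<Sum>j=1..m. B s j * x j i)"
    by metis
  define c where "c s = ip k (x n) (gram_schmidt k x s)" for s
  obtain d where d: "\<And>i. gram_schmidt k x n i = (x n i - (\<Sum>s=1..<n. c s * gram_schmidt k x s i)) / d"
    unfolding gram_schmidt.simps[of k x n] c_def by blast
  have "gram_schmidt k x n i = (\<Sum>j=1..m. (((if j = n then 1 else 0) - (\<Sum>s=1..<n. c s * B s j)) / d) * x j i)" for i
  proof -
    have "(\<Sum>s=1..<n. c s * gram_schmidt k x s i) = (\<Sum>s=1..<n. \<Sum>j=1..m. c s * B s j * x j i)"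
      by (intro sum.cong) (auto simp: B sum_distrib_left mult.assoc)
    also have "\<dots> = (\<Sum>j=1..m. (\<Sum>s=1..<n. c s * B s j) * x j i)"
      unfolding sum_distrib_right by (rule sum.swap)
    finally have 1: "(\<Sum>s=1..<n. c s * gram_schmidt k x s i) = \<dots>" .
    have "(\<Sum>j=1..m. (if j = n then 1 else 0) * x j i) = (\<Sum>j=1..m. if j = n then x j i else 0)"
      by (intro sum.cong) auto
    also have "\<dots> = x n i" using less.prems by simp
    finally have 2: "x n i = (\<Sum>j=1..m. (if j = n then 1 else 0) * x j i)" by simp
    show ?thesis
      unfolding d 1
      by (subst 2, unfold sum_subtractf[symmetric] sum_divide_distrib left_diff_distrib[symmetric]) simp
  qed
  then show ?case by (intro exI allI)
qed

text \<open>\<open>orth_proj\<close> is a definite description, so existence and uniqueness of the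
  projection have to be supplied. The candidate is the Fourier sum \<open>v0\<close> over the
  orthonormal system; its norm is then Parseval's identity.\<close>

lemma orth_proj_gram_schmidt:
  assumes unit: "\<And>j. j \<in> {1..n} \<Longrightarrow> ip k (x j) (x j) = 1"
    and lt: "\<And>j. j \<in> {1..n} \<Longrightarrow> (\<Sum>s=1..<j. (ip k (x j) (gram_schmidt k x s))\<^sup>2) < 1"
  shows "(L2_set (orth_proj k (span_k k x {1..n}) u) {..k})\<^sup>2 = (\<Sum>s=1..n. (ip k u (gram_schmidt k x s))\<^sup>2)"
proof -
  let ?e = "gram_schmidt k x"
  have orth: "\<And>s t. s \<in> {1..n} \<Longrightarrow> t \<in> {1..n} \<Longrightarrow> ip k (?e s) (?e t) = (if s = t then 1 else 0)"
    using gram_schmidt_facts[of n k x] assms by blast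
  define v0 where "v0 = (\<lambda>i. \<Sum>s=1..n. ip k u (?e s) * ?e s i)"
  define v where "v = (\<lambda>i\<in>{..k}. v0 i)"
  have xe: "x j i = (\<Sum>s=1..j. gs_coeff k x j s * ?e s i)" if "j \<in> {1..n}" for j i
    using that assms by (intro gram_schmidt_step(3) orth) auto
  have ve: "ip k (\<lambda>j. u j - v0 j) (?e t) = 0" if t: "t \<in> {1..n}" for t
  proof -
    have "ip k v0 (?e t) = (\<Sum>s=1..n. ip k u (?e s) * ip k (?e s) (?e t))"
      by (simp add: v0_def ip_sum_left ip_scale_left)
    also have "\<dots> = (\<Sum>s=1..n. if s = t then ip k u (?e s) else 0)"
      by (rule sum.cong[OF refl]) (simp add: orth[OF _ t])
    also have "\<dots> = ip k u (?e t)" using t by simp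
    finally show ?thesis by (simp add: ip_diff_left)
  qed
  have vx: "ip k (\<lambda>j. u j - v0 j) (x j) = 0" if j: "j \<in> {1..n}" for j
  proof -
    have "x j = (\<lambda>i. \<Sum>s=1..j. gs_coeff k x j s * ?e s i)"
      using xe[OF j] by auto
    then have "ip k (\<lambda>j. u j - v0 j) (x j) = (\<Sum>s=1..j. gs_coeff k x j s * ip k (\<lambda>j. u j - v0 j) (?e s))"
      by (simp add: ip_sum_right ip_scale_right)
    also have "\<dots> = 0" using j by (intro sum.neutral ballI) (auto simp: ve)
    finally show ?thesis .
  qed
  have uv: "ip k (\<lambda>j. u j - v j) y = ip k (\<lambda>j. u j - v0 j) y" for y
    by (rule ip_cong) (auto simp: v_def)
  have span_orth: "ip k (\<lambda>j. u j - v j) y = 0" if y: "y \<in> span_k k x {1..n}" for y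
  proof -
    obtain a where "y = (\<lambda>j\<in>{..k}. \<Sum>i=1..n. a i * x i j)"
      using y by (auto simp: span_k_def)
    then have "ip k (\<lambda>j. u j - v j) y = (\<Sum>i=1..n. a i * ip k (\<lambda>j. u j - v0 j) (x i))"
      by (simp add: uv ip_sum_right ip_scale_right)
    also have "\<dots> = 0" by (intro sum.neutral ballI) (simp add: vx)
    finally show ?thesis .
  qed
  have v_span: "v \<in> span_k k x {1..n}"
  proof -
    have "\<forall>s\<in>{1..n}. \<exists>a. \<forall>i. ?e s i = (\<Sum>j=1..n. a j * x j i)"
      by (intro ballI gram_schmidt_in_span) auto
    then obtain B where B: "\<And>s i. s \<in> {1..n} \<Longrightarrow> ?e s i = (\<Sum>j=1..n. B s j * x j i)"
      by metis
    have "v0 i = (\<Sum>s=1..n. \<Sum>j=1..n. ip k u (?e s) * B s j * x j i)" for i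
      unfolding v0_def by (intro sum.cong refl) (subst B, auto simp: sum_distrib_left mult.assoc)
    then have "v0 i = (\<Sum>j=1..n. (\<Sum>s=1..n. ip k u (?e s) * B s j) * x j i)" for i
      unfolding sum_distrib_right by (subst sum.swap) simp
    then have "v = (\<lambda>i\<in>{..k}. \<Sum>j=1..n. (\<Sum>s=1..n. ip k u (?e s) * B s j) * x j i)"
      by (simp add: v_def)
    then show ?thesis
      unfolding span_k_def by (intro CollectI exI[of _ "\<lambda>j. \<Sum>s=1..n. ip k u (?e s) * B s j"])
  qed
  have "orth_proj k (span_k k x {1..n}) u = v"
    unfolding orth_proj_def
  proof (rule the_equality)
    show "v \<in> span_k k x {1..n} \<and> (\<forall>w\<in>span_k k x {1..n}. ip k (\<lambda>j. u j - v j) w = 0)"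
      using v_span span_orth by blast
    fix v' assume v': "v' \<in> span_k k x {1..n} \<and> (\<forall>w\<in>span_k k x {1..n}. ip k (\<lambda>j. u j - v' j) w = 0)"
    obtain a a' where a: "v = (\<lambda>j\<in>{..k}. \<Sum>i=1..n. a i * x i j)" "v' = (\<lambda>j\<in>{..k}. \<Sum>i=1..n. a' i * x i j)"
      using v_span v' by (auto simp: span_k_def)
    \<comment> \<open>The difference of two projections lies in the span and is orthogonal to it,
      hence to itself.\<close>
    define d where "d = (\<lambda>j\<in>{..k}. v j - v' j)"
    have "d = (\<lambda>j\<in>{..k}. \<Sum>i=1..n. (a i - a' i) * x i j)"
      unfolding d_def a by (auto simp: left_diff_distrib sum_subtractf)
    then have "d \<in> span_k k x {1..n}"
      unfolding span_k_def by (auto intro!: exI[of _ "\<lambda>i. a i - a' i"])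
    then have "ip k (\<lambda>j. u j - v' j) d - ip k (\<lambda>j. u j - v j) d = 0"
      using v' span_orth by simp
    moreover have "ip k (\<lambda>j. u j - v' j) d - ip k (\<lambda>j. u j - v j) d = ip k d d"
      unfolding ip_diff_left[symmetric] by (rule ip_cong) (auto simp: d_def)
    ultimately have "L2_set d {..k} = 0" by (simp add: ip_self)
    then have le: "v j = v' j" if "j \<le> k" for j
      using that by (auto simp: L2_set_eq_0_iff d_def)
    \<comment> \<open>The functions must agree beyond index k as well; there every element of the
      span takes the value \<open>undefined\<close>.\<close>
    have gt: "v j = undefined" "v' j = undefined" if "\<not> j \<le> k" for j
      using that by (subst a, simp)+
    show "v' = v"
    proof
      fix j show "v' j = v j" using le[of j] gt[of j] by (cases "j \<le> k") simp_all
    qed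
  qed
  moreover have "ip k v v = (\<Sum>s=1..n. (ip k u (?e s))\<^sup>2)"
    unfolding v_def ip_restrict v0_def
    using ip_orthonormal_sums[of "{1..n}" k ?e "\<lambda>s. ip k u (?e s)" "\<lambda>s. ip k u (?e s)"] orth
    by (simp add: power2_eq_square)
  ultimately show ?thesis by (simp add: ip_self)
qed

section \<open>Peeling off the vertices\<close>

abbreviation sphere_prod :: "nat \<Rightarrow> nat \<Rightarrow> (nat \<Rightarrow> nat \<Rightarrow> real) measure" where
  "sphere_prod k n \<equiv> Pi\<^sub>M {1..n} (\<lambda>_. uniform_sphere k)"

lemma measurable_sphere_prod_component:
  assumes "j \<in> {1..n}" "i \<le> k"
  shows "(\<lambda>x. x j i) \<in> borel_measurable (sphere_prod k n)"
proof -
  have "(\<lambda>x. x j) \<in> sphere_prod k n \<rightarrow>\<^sub>M uniform_sphere k"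
    using assms by (intro measurable_component_singleton)
  then have "(\<lambda>x. x j) \<in> sphere_prod k n \<rightarrow>\<^sub>M lborel_k k"
    by (simp cong: measurable_cong_sets)
  then show ?thesis by (rule measurable_lborel_k_component[OF _ assms(2)])
qed

lemma measurable_gram_schmidt:
  assumes "j \<in> {1..n}" "i \<le> k"
  shows "(\<lambda>x. gram_schmidt k x j i) \<in> borel_measurable (sphere_prod k n)"
  using assms
proof (induction j arbitrary: i rule: less_induct)
  case (less j)
  have x0: "\<And>i. i \<le> k \<Longrightarrow> (\<lambda>x. x j i) \<in> borel_measurable (sphere_prod k n)"
    using less.prems by (intro measurable_sphere_prod_component)
  have e: "(\<lambda>x. gram_schmidt k x s i) \<in> borel_measurable (sphere_prod k n)"
    if "s \<in> {1..<j}" "i \<le> k" for s i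
    using less.IH[of s i] less.prems that by auto
  have ip: "(\<lambda>x. ip k (x j) (gram_schmidt k x s)) \<in> borel_measurable (sphere_prod k n)" if "s \<in> {1..<j}" for s
    by (rule measurable_ip[OF x0 e[OF that]])
  have num: "(\<lambda>x. x j i - (\<Sum>s=1..<j. ip k (x j) (gram_schmidt k x s) * gram_schmidt k x s i))
      \<in> borel_measurable (sphere_prod k n)" if "i \<le> k" for i
    using that by (intro borel_measurable_diff borel_measurable_sum borel_measurable_times x0 e ip)
  show ?case
    unfolding gram_schmidt.simps[of k _ j] L2_set_def
    using less.prems
    by (intro borel_measurable_divide num measurable_compose[OF _ borel_measurable_sqrt]
        borel_measurable_sum borel_measurable_power) auto
qed

lemma measurable_sphere_prod_ip:
  assumes "i \<in> {1..n}" "j \<in> {1..n}"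
  shows "(\<lambda>x. ip k (x i) (x j)) \<in> borel_measurable (sphere_prod k n)"
  using assms by (intro measurable_ip measurable_sphere_prod_component)

lemma measurable_sphere_prod_ip_gs:
  assumes "i \<in> {1..n}" "j \<in> {1..n}"
  shows "(\<lambda>x. ip k (x i) (gram_schmidt k x j)) \<in> borel_measurable (sphere_prod k n)"
  using assms by (intro measurable_ip measurable_sphere_prod_component measurable_gram_schmidt)

text \<open>
  \<open>good \<epsilon> b \<tau> k n x\<close> is a measurable event containing almost all of the perfect cliques; the colour is
  encoded by the sign \<open>\<epsilon>\<close> and the threshold \<open>b\<close>: red is \<open>\<epsilon> = 1, b = -c\<close>, blue is \<open>\<epsilon> = -1, b = c\<close>.
\<close>

definition good :: "real \<Rightarrow> real \<Rightarrow> real \<Rightarrow> nat \<Rightarrow> nat \<Rightarrow> (nat \<Rightarrow> nat \<Rightarrow> real) \<Rightarrow> bool" where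
  "good \<epsilon> b \<tau> k n x \<longleftrightarrow> (\<forall>j\<in>{1..n}. ip k (x j) (x j) = 1 \<and>
     (\<Sum>s=1..<j. (ip k (x j) (gram_schmidt k x s))\<^sup>2) \<le> \<tau> \<and>
     (\<forall>i\<in>{1..<j}. \<epsilon> * ip k (x j) (x i) \<le> b / sqrt (real k)))"

lemma good_pred: "Measurable.pred (sphere_prod k n) (good \<epsilon> b \<tau> k n)"
proof -
  have "Measurable.pred (sphere_prod k n) (\<lambda>x. ip k (x j) (x j) = 1 \<and>
     (\<Sum>s=1..<j. (ip k (x j) (gram_schmidt k x s))\<^sup>2) \<le> \<tau> \<and>
     (\<forall>i\<in>{1..<j}. \<epsilon> * ip k (x j) (x i) \<le> b / sqrt (real k)))" if j: "j \<in> {1..n}" for j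
  proof -
    have 1 [measurable]: "(\<lambda>x. ip k (x j) (x j)) \<in> borel_measurable (sphere_prod k n)"
      by (rule measurable_sphere_prod_ip[OF j j])
    have 2 [measurable]: "(\<lambda>x. \<Sum>s=1..<j. (ip k (x j) (gram_schmidt k x s))\<^sup>2) \<in> borel_measurable (sphere_prod k n)"
      using j by (intro borel_measurable_sum borel_measurable_power measurable_sphere_prod_ip_gs) auto
    have 3: "(\<lambda>x. ip k (x j) (x i)) \<in> borel_measurable (sphere_prod k n)" if "i \<in> {1..<j}" for i
      using j that by (intro measurable_sphere_prod_ip) auto
    have "Measurable.pred (sphere_prod k n) (\<lambda>x. \<forall>i\<in>{1..<j}. \<epsilon> * ip k (x j) (x i) \<le> b / sqrt (real k))"
    proof (intro pred_intros_finite)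
      fix i assume "i \<in> {1..<j}"
      from 3[OF this] show "Measurable.pred (sphere_prod k n) (\<lambda>x. \<epsilon> * ip k (x j) (x i) \<le> b / sqrt (real k))"
        by measurable
    qed simp
    then show ?thesis by measurable
  qed
  then show ?thesis
    unfolding good_def[abs_def] by (intro pred_intros_finite) auto
qed

section \<open>The tilted weight and its recursion\<close>

definition pair_sum :: "nat \<Rightarrow> nat \<Rightarrow> (nat \<Rightarrow> nat \<Rightarrow> real) \<Rightarrow> real" where
  "pair_sum k n x = (\<Sum>j=1..n. \<Sum>i=1..<j. ip k (x j) (x i))"

lemma measurable_pair_sum: "pair_sum k n \<in> borel_measurable (sphere_prod k n)"
  unfolding pair_sum_def[abs_def]
  by (intro borel_measurable_sum measurable_sphere_prod_ip) auto

text \<open>The quantity carried through the peeling: each of the r - n points already removed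
  contributes one copy of \<open>(hazard b)\<^sup>2 * pair_sum k n x\<close> to the exponent. For n
  = r it is the probability of \<open>good\<close>, for n = 0 it is 1.\<close>

definition weight :: "real \<Rightarrow> real \<Rightarrow> real \<Rightarrow> nat \<Rightarrow> nat \<Rightarrow> nat \<Rightarrow> ennreal" where
  "weight \<epsilon> b \<tau> k r n = (\<integral>\<^sup>+x. (if good \<epsilon> b \<tau> k n x
     then ennreal (exp ((hazard b)\<^sup>2 * real (r - n) * pair_sum k n x)) else 0) \<partial>sphere_prod k n)"

text \<open>\<open>gram_schmidt\<close> at s depends on the first s points only, so the conditions
  on the earlier points are unaffected by y. Of the new point only the colour conditions are kept,
  which enlarges the event and so preserves an upper bound.\<close>

lemma good_Suc:
  assumes "good \<epsilon> b \<tau> k (Suc n) (x(Suc n := y))"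
  shows "good \<epsilon> b \<tau> k n x" "\<forall>j\<in>{1..n}. \<epsilon> * ip k y (x j) \<le> b / sqrt (real k)"
proof -
  have gs: "gram_schmidt k (x(Suc n := y)) s = gram_schmidt k x s" if "s \<in> {1..n}" for s
    using that by (intro gram_schmidt_cong) auto
  show "good \<epsilon> b \<tau> k n x"
    unfolding good_def
  proof (intro ballI)
    fix j assume j: "j \<in> {1..n}"
    then have xj: "(x(Suc n := y)) j = x j" and j': "j \<in> {1..Suc n}" by auto
    have s: "(\<Sum>s=1..<j. (ip k (x j) (gram_schmidt k (x(Suc n := y)) s))\<^sup>2)
        = (\<Sum>s=1..<j. (ip k (x j) (gram_schmidt k x s))\<^sup>2)"
      using j by (intro sum.cong) (auto simp: gs)
    have i: "(x(Suc n := y)) i = x i" if "i \<in> {1..<j}" for i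
      using that j by auto
    have "ip k (x j) (x j) = 1 \<and>
     (\<Sum>s=1..<j. (ip k (x j) (gram_schmidt k (x(Suc n := y)) s))\<^sup>2) \<le> \<tau> \<and>
     (\<forall>i\<in>{1..<j}. \<epsilon> * ip k (x j) ((x(Suc n := y)) i) \<le> b / sqrt (real k))"
      using bspec[OF assms[unfolded good_def] j'] unfolding xj .
    then show "ip k (x j) (x j) = 1 \<and>
     (\<Sum>s=1..<j. (ip k (x j) (gram_schmidt k x s))\<^sup>2) \<le> \<tau> \<and>
     (\<forall>i\<in>{1..<j}. \<epsilon> * ip k (x j) (x i) \<le> b / sqrt (real k))"
      unfolding s using i by metis
  qed
  show "\<forall>j\<in>{1..n}. \<epsilon> * ip k y (x j) \<le> b / sqrt (real k)"
  proof
    fix j assume "j \<in> {1..n}"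
    have in_Suc: "Suc n \<in> {1..Suc n}" by simp
    have "j \<in> {1..<Suc n}" "j \<noteq> Suc n" using \<open>j \<in> {1..n}\<close> by auto
    moreover have "\<forall>i\<in>{1..<Suc n}. \<epsilon> * ip k ((x(Suc n := y)) (Suc n)) ((x(Suc n := y)) i) \<le> b / sqrt (real k)"
      using bspec[OF assms[unfolded good_def] in_Suc] by blast
    ultimately show "\<epsilon> * ip k y (x j) \<le> b / sqrt (real k)"
      by fastforce
  qed
qed

lemma pair_sum_Suc: "pair_sum k (Suc n) (x(Suc n := y)) = pair_sum k n x + (\<Sum>j=1..n. ip k y (x j))"
proof -
  have "{1..<Suc n} = {1..n}" by auto
  moreover have "(\<Sum>j=1..n. \<Sum>i=1..<j. ip k ((x(Suc n := y)) j) ((x(Suc n := y)) i))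
      = (\<Sum>j=1..n. \<Sum>i=1..<j. ip k (x j) (x i))"
    by (intro sum.cong refl) auto
  moreover have "(\<Sum>i=1..n. ip k y ((x(Suc n := y)) i)) = (\<Sum>i=1..n. ip k y (x i))"
    by (intro sum.cong refl) auto
  ultimately show ?thesis
    unfolding pair_sum_def by (simp del: fun_upd_apply add: fun_upd_same)
qed

text \<open>The error exponent of \<open>sphere_row_bound\<close> with n and the tilt replaced by
  their upper bounds r and \<open>(hazard b)\<^sup>2 * real r\<close>, so that it is the same at
  every step.\<close>

definition row_error :: "nat \<Rightarrow> real \<Rightarrow> nat \<Rightarrow> real \<Rightarrow> real \<Rightarrow> real" where
  "row_error k b r w \<delta> = real r * (8 * (hazard b)\<^sup>2 * w + 5 * ((hazard b)\<^sup>2 * real r / sqrt (real k))\<^sup>2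
     + 2 * hazard b * \<bar>b\<bar> * (\<delta> + w)) + 2 * ((hazard b)\<^sup>2 * real r) * sqrt (real r) * \<delta>"

text \<open>The last point is integrated with the tilt s = H^2 (r - n - 1), its share of
  \<open>pair_sum\<close>. The row bound returns one more copy of H^2 \<open>pair_sum k n x\<close>,
  which raises the coefficient to r - n, and the deterministic term -\<epsilon> H s n / sqrt k,
  where the cube of H originates.\<close>

lemma weight_step:
  assumes \<epsilon>: "\<epsilon> = 1 \<or> \<epsilon> = - 1"
    and k: "1 \<le> k" and \<delta>: "0 < \<delta>" "\<delta> < 1" "10 \<le> \<delta>\<^sup>2 * real k"
    and \<tau>: "0 \<le> \<tau>" "\<tau> \<le> 1/4" and w: "real r * \<tau> \<le> w" "w \<le> 1"
    and n: "n < r"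
  shows "weight \<epsilon> b \<tau> k r (Suc n) \<le> ennreal (2 * Phi b ^ n *
      exp (- \<epsilon> * (hazard b) ^ 3 * (real n * real (r - Suc n)) / sqrt (real k) + row_error k b r w \<delta>))
      * weight \<epsilon> b \<tau> k r n"
proof -
  let ?H = "hazard b"
  define s where "s = ?H\<^sup>2 * real (r - Suc n)"
  let ?t = "s / sqrt (real k)"
  let ?g = "\<lambda>x. (if good \<epsilon> b \<tau> k n x then ennreal (exp (s * pair_sum k n x)) else 0)"
  let ?f = "\<lambda>x y. (if \<forall>j\<in>{1..n}. \<epsilon> * ip k y (x j) \<le> b / sqrt (real k)
            then ennreal (exp (s * (\<Sum>j=1..n. ip k y (x j)))) else 0)"
  interpret S: prob_space "uniform_sphere k" by (rule prob_space_uniform_sphere)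
  interpret PS: product_sigma_finite "\<lambda>_::nat. uniform_sphere k" ..
  have H: "0 < ?H" by (rule hazard_pos)
  have s0: "0 \<le> s" by (simp add: s_def)
  have rk: "0 < sqrt (real k)" using k by simp
  have s_le: "s \<le> ?H\<^sup>2 * real r" unfolding s_def by (intro mult_left_mono) auto
  have w0: "0 \<le> w" using w(1) \<tau>(1) mult_nonneg_nonneg[of "real r" \<tau>] by linarith
  have err: "real n * (8 * ?H\<^sup>2 * w + 5 * ?t\<^sup>2 + 2 * ?H * \<bar>b\<bar> * (\<delta> + w)) + 2 * s * sqrt (real n) * \<delta>
      \<le> row_error k b r w \<delta>"
  proof -
    have "?t\<^sup>2 \<le> (?H\<^sup>2 * real r / sqrt (real k))\<^sup>2"
      using s0 s_le rk by (intro power_mono divide_right_mono) auto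
    moreover have "0 \<le> 8 * ?H\<^sup>2 * w" "0 \<le> 2 * ?H * \<bar>b\<bar> * (\<delta> + w)"
      using H w0 \<delta> by auto
    ultimately have 1: "real n * (8 * ?H\<^sup>2 * w + 5 * ?t\<^sup>2 + 2 * ?H * \<bar>b\<bar> * (\<delta> + w))
      \<le> real r * (8 * ?H\<^sup>2 * w + 5 * (?H\<^sup>2 * real r / sqrt (real k))\<^sup>2 + 2 * ?H * \<bar>b\<bar> * (\<delta> + w))"
      using n by (intro mult_mono) auto
    have "s * sqrt (real n) * \<delta> \<le> (?H\<^sup>2 * real r) * sqrt (real r) * \<delta>"
      using s0 s_le n \<delta> by (intro mult_right_mono mult_mono) auto
    with 1 show ?thesis unfolding row_error_def by linarith
  qed
  have row: "(\<integral>\<^sup>+y. ?f x y \<partial>uniform_sphere k)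
      \<le> ennreal (2 * Phi b ^ n * exp (- \<epsilon> * ?H * ?t * real n + ?H\<^sup>2 * pair_sum k n x + row_error k b r w \<delta>))"
    if good: "good \<epsilon> b \<tau> k n x" for x
  proof -
    let ?L = "\<lambda>j s. gs_coeff k x j s"
    have unit: "ip k (x j) (x j) = 1" and row: "(\<Sum>s=1..<j. (ip k (x j) (gram_schmidt k x s))\<^sup>2) \<le> \<tau>"
      if "j \<in> {1..n}" for j
      using good that unfolding good_def by auto
    have lt: "(\<Sum>s=1..<j. (ip k (x j) (gram_schmidt k x s))\<^sup>2) < 1" if "j \<in> {1..n}" for j
      using row[OF that] \<tau> by linarith
    have orth: "\<And>s t. s \<in> {1..n} \<Longrightarrow> t \<in> {1..n} \<Longrightarrow>
        ip k (gram_schmidt k x s) (gram_schmidt k x t) = (if s = t then 1 else 0)"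
      using gram_schmidt_facts[of n k x] unit lt by blast
    have xe: "x j i = (\<Sum>s=1..j. ?L j s * gram_schmidt k x s i)" if "j \<in> {1..n}" for j i
      using that unit lt by (intro gram_schmidt_step(3) orth) auto
    have sL: "(\<Sum>s=1..<j. (?L j s)\<^sup>2) = (\<Sum>s=1..<j. (ip k (x j) (gram_schmidt k x s))\<^sup>2)" for j
      by (intro sum.cong) (auto simp: gs_coeff_def)
    have diag: "0 < ?L j j \<and> (?L j j)\<^sup>2 = 1 - (\<Sum>s=1..<j. (?L j s)\<^sup>2)" if "j \<in> {1..n}" for j
      unfolding sL using lt[OF that] by (simp add: gs_coeff_def)
    have "real n * \<tau> \<le> real r * \<tau>" using n \<tau> by (intro mult_right_mono) auto
    then have nw: "real n * \<tau> \<le> w" using w by linarith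
    have "(\<integral>\<^sup>+y. ?f x y \<partial>uniform_sphere k)
      \<le> ennreal (2 * Phi b ^ n * exp (- \<epsilon> * ?H * ?t * real n
          + ?H\<^sup>2 * (\<Sum>j=1..n. \<Sum>i=1..<j. ip k (x j) (x i))
          + real n * (8 * ?H\<^sup>2 * w + 5 * ?t\<^sup>2 + 2 * ?H * \<bar>b\<bar> * (\<delta> + w))
          + 2 * s * sqrt (real n) * \<delta>))"
      using row by (intro sphere_row_bound[OF \<epsilon> k \<delta> orth xe diag _ \<tau>(2) nw w(2) s0]) (auto simp: sL[simplified])
    also have "\<dots> \<le> ennreal (2 * Phi b ^ n * exp (- \<epsilon> * ?H * ?t * real n + ?H\<^sup>2 * pair_sum k n x + row_error k b r w \<delta>))"
      using err Phi_pos[of b] unfolding pair_sum_def by (intro ennreal_leI mult_left_mono) (auto simp: less_imp_le)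
    finally show ?thesis .
  qed
  have [measurable]: "Measurable.pred (sphere_prod k n) (good \<epsilon> b \<tau> k n)"
    "pair_sum k n \<in> borel_measurable (sphere_prod k n)"
    "Measurable.pred (sphere_prod k (Suc n)) (good \<epsilon> b \<tau> k (Suc n))"
    "pair_sum k (Suc n) \<in> borel_measurable (sphere_prod k (Suc n))"
    by (rule good_pred measurable_pair_sum)+
  have ins: "{1..Suc n} = insert (Suc n) {1..n}" by auto
  have "weight \<epsilon> b \<tau> k r (Suc n) = (\<integral>\<^sup>+x. (\<integral>\<^sup>+y. (if good \<epsilon> b \<tau> k (Suc n) (x(Suc n := y))
     then ennreal (exp (s * pair_sum k (Suc n) (x(Suc n := y)))) else 0) \<partial>uniform_sphere k) \<partial>sphere_prod k n)"
    unfolding weight_def s_def[symmetric] ins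
  proof (rule PS.product_nn_integral_insert)
    show "(\<lambda>x. if good \<epsilon> b \<tau> k (Suc n) x then ennreal (exp (s * pair_sum k (Suc n) x)) else 0)
      \<in> borel_measurable (Pi\<^sub>M (insert (Suc n) {1..n}) (\<lambda>_. uniform_sphere k))"
      unfolding ins[symmetric] by measurable
  qed auto
  also have "\<dots> \<le> (\<integral>\<^sup>+x. (\<integral>\<^sup>+y. ?g x * ?f x y \<partial>uniform_sphere k) \<partial>sphere_prod k n)"
  proof (intro nn_integral_mono)
    fix x y
    show "(if good \<epsilon> b \<tau> k (Suc n) (x(Suc n := y))
        then ennreal (exp (s * pair_sum k (Suc n) (x(Suc n := y)))) else 0) \<le> ?g x * ?f x y"
      using good_Suc[of \<epsilon> b \<tau> k n x y]
      by (auto simp: pair_sum_Suc distrib_left exp_add ennreal_mult simp del: fun_upd_apply)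
  qed
  also have "\<dots> \<le> (\<integral>\<^sup>+x. ennreal (2 * Phi b ^ n *
      exp (- \<epsilon> * ?H ^ 3 * (real n * real (r - Suc n)) / sqrt (real k) + row_error k b r w \<delta>))
      * (if good \<epsilon> b \<tau> k n x then ennreal (exp (?H\<^sup>2 * real (r - n) * pair_sum k n x)) else 0) \<partial>sphere_prod k n)"
  proof (intro nn_integral_mono)
    fix x assume x: "x \<in> space (sphere_prod k n)"
    show "(\<integral>\<^sup>+y. ?g x * ?f x y \<partial>uniform_sphere k) \<le> ennreal (2 * Phi b ^ n *
      exp (- \<epsilon> * ?H ^ 3 * (real n * real (r - Suc n)) / sqrt (real k) + row_error k b r w \<delta>))
      * (if good \<epsilon> b \<tau> k n x then ennreal (exp (?H\<^sup>2 * real (r - n) * pair_sum k n x)) else 0)"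
    proof (cases "good \<epsilon> b \<tau> k n x")
      case True
      have [measurable]: "\<And>j. (\<lambda>y. ip k y (x j)) \<in> borel_measurable (uniform_sphere k)"
        by measurable
      have "(\<integral>\<^sup>+y. ?g x * ?f x y \<partial>uniform_sphere k) = ?g x * (\<integral>\<^sup>+y. ?f x y \<partial>uniform_sphere k)"
        by (rule nn_integral_cmult) measurable
      also have "\<dots> \<le> ennreal (exp (s * pair_sum k n x)) *
          ennreal (2 * Phi b ^ n * exp (- \<epsilon> * ?H * ?t * real n + ?H\<^sup>2 * pair_sum k n x + row_error k b r w \<delta>))"
        using row[OF True] True by (auto intro: mult_left_mono)
      also have "\<dots> = ennreal (2 * Phi b ^ n *
          exp (- \<epsilon> * ?H ^ 3 * (real n * real (r - Suc n)) / sqrt (real k) + row_error k b r w \<delta>))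
          * ennreal (exp (?H\<^sup>2 * real (r - n) * pair_sum k n x))"
      proof -
        have rn: "real (r - n) = real (r - Suc n) + 1" using n by linarith
        have "s * pair_sum k n x + (- \<epsilon> * ?H * ?t * real n + ?H\<^sup>2 * pair_sum k n x + row_error k b r w \<delta>)
          = (- \<epsilon> * ?H ^ 3 * (real n * real (r - Suc n)) / sqrt (real k) + row_error k b r w \<delta>)
            + ?H\<^sup>2 * real (r - n) * pair_sum k n x"
          unfolding rn s_def by (simp add: algebra_simps power2_eq_square power3_eq_cube)
        then show ?thesis
          using Phi_pos[of b] by (simp add: ennreal_mult[symmetric] less_imp_le exp_add[symmetric] mult_ac)
      qed
      finally show ?thesis using True by simp
    qed simp
  qed
  also have "\<dots> = ennreal (2 * Phi b ^ n *
      exp (- \<epsilon> * ?H ^ 3 * (real n * real (r - Suc n)) / sqrt (real k) + row_error k b r w \<delta>))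
      * weight \<epsilon> b \<tau> k r n"
    unfolding weight_def by (rule nn_integral_cmult) measurable
  finally show ?thesis .
qed

lemma sum_lessThan_choose_two: "(\<Sum>m<n. m) = n choose 2"
  by (induction n) (simp_all add: numeral_2_eq_2)

text \<open>At n = r the sum is r choose 3: it counts triples by their middle element m, with m
  smaller and r - 1 - m larger ones. Partial sums are stated for the sake of the induction.\<close>

lemma sum_row_lengths:
  "n \<le> r \<Longrightarrow> (\<Sum>m<n. real m * real (r - Suc m))
     = real n * (real n - 1) * (real r - 1) / 2 - real n * (real n - 1) * (2 * real n - 1) / 6"
proof (induction n)
  case (Suc n)
  then have "real (r - Suc n) = real r - real n - 1" by linarith
  with Suc show ?case by (simp add: field_simps)
qed simp

lemma weight_bound:
  assumes \<epsilon>: "\<epsilon> = 1 \<or> \<epsilon> = - 1"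
    and k: "1 \<le> k" and \<delta>: "0 < \<delta>" "\<delta> < 1" "10 \<le> \<delta>\<^sup>2 * real k"
    and \<tau>: "0 \<le> \<tau>" "\<tau> \<le> 1/4" and w: "real r * \<tau> \<le> w" "w \<le> 1"
  shows "weight \<epsilon> b \<tau> k r r \<le> ennreal (2 ^ r * Phi b ^ (r choose 2) *
      exp (- \<epsilon> * (hazard b) ^ 3 * (real r * (real r - 1) * (real r - 2) / 6) / sqrt (real k)
        + real r * row_error k b r w \<delta>))"
proof -
  let ?a = "- \<epsilon> * (hazard b) ^ 3 / sqrt (real k)" and ?E = "row_error k b r w \<delta>"
  have "n \<le> r \<Longrightarrow> weight \<epsilon> b \<tau> k r n \<le> ennreal (2 ^ n * Phi b ^ (\<Sum>m<n. m) *
      exp (?a * (\<Sum>m<n. real m * real (r - Suc m)) + real n * ?E))" for n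
  proof (induction n)
    case 0
    interpret P: prob_space "sphere_prod k 0"
      by (intro prob_space_PiM prob_space_uniform_sphere)
    have "good \<epsilon> b \<tau> k 0 x" "pair_sum k 0 x = 0" for x
      by (simp_all add: good_def pair_sum_def)
    then show ?case
      unfolding weight_def using P.emeasure_space_1 by simp
  next
    case (Suc n)
    let ?A = "2 * Phi b ^ n *
      exp (- \<epsilon> * (hazard b) ^ 3 * (real n * real (r - Suc n)) / sqrt (real k) + ?E)"
    let ?B = "2 ^ n * Phi b ^ (\<Sum>m<n. m) *
      exp (?a * (\<Sum>m<n. real m * real (r - Suc m)) + real n * ?E)"
    have "weight \<epsilon> b \<tau> k r (Suc n) \<le> ennreal ?A * weight \<epsilon> b \<tau> k r n"
      using Suc.prems by (intro weight_step assms) auto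
    also have "\<dots> \<le> ennreal ?A * ennreal ?B"
      using Suc by (intro mult_left_mono) auto
    also have "\<dots> = ennreal (?A * ?B)"
      using Phi_pos[of b] by (intro ennreal_mult[symmetric]) (auto simp: less_imp_le)
    also have "?A * ?B = 2 ^ Suc n * Phi b ^ (\<Sum>m<Suc n. m) *
      exp (?a * (\<Sum>m<Suc n. real m * real (r - Suc m)) + real (Suc n) * ?E)"
      by (simp add: power_add exp_add[symmetric] mult_ac) (simp add: algebra_simps add_divide_distrib)
    finally show ?case .
  qed
  from this[of r] have "weight \<epsilon> b \<tau> k r r \<le> ennreal (2 ^ r * Phi b ^ (r choose 2) *
      exp (?a * (\<Sum>m<r. real m * real (r - Suc m)) + real r * ?E))"
    by (simp add: sum_lessThan_choose_two)
  also have "(\<Sum>m<r. real m * real (r - Suc m)) = real r * (real r - 1) * (real r - 2) / 6"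
    by (subst sum_row_lengths) (simp_all add: field_simps)
  finally show ?thesis by (simp add: mult_ac)
qed

section \<open>From perfect cliques to the weight\<close>

definition colour_sign :: "colour \<Rightarrow> real" where
  "colour_sign col = (case col of Red \<Rightarrow> 1 | Blue \<Rightarrow> - 1)"

text \<open>The projection bound needs complete induction on j:
  \<open>orth_proj_gram_schmidt\<close> for the first j - 1 points requires their coefficient sums
  to be below 1, which is the claim at smaller indices together with \<tau> < 1. At j = 1 the sum is
  empty.\<close>

lemma perfect_imp_good:
  assumes clique: "mono_clique col k p r x" and perf: "perfect C l k r x"
    and unit: "\<And>j. j \<in> {1..r} \<Longrightarrow> L2_set (x j) {..k} = 1"
    and \<tau>: "\<tau> = (alpha_C C * sqrt (real l) / sqrt (real k))\<^sup>2" "\<tau> < 1"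
  shows "good (colour_sign col) (- colour_sign col * c_kp k p) \<tau> k r x"
proof -
  have ip1: "ip k (x j) (x j) = 1" if "j \<in> {1..r}" for j
    using unit[OF that] by (simp add: ip_self)
  have proj: "(\<Sum>s=1..<j. (ip k (x j) (gram_schmidt k x s))\<^sup>2) \<le> \<tau>" if "j \<in> {1..r}" for j
    using that
  proof (induction j rule: less_induct)
    case (less j)
    show ?case
    proof (cases "j = 1")
      case False
      then obtain i where i: "j = Suc i" "1 \<le> i" "i < r"
        using less.prems by (cases j) auto
      have eq: "{1..<j} = {1..i}" using i by auto
      have lt: "(\<Sum>s\<in>{1..<j'}. (ip k (x j') (gram_schmidt k x s))\<^sup>2) < 1" if "j' \<in> {1..i}" for j'
        using less.IH[of j'] that i \<tau>(2) by auto
      have "(\<Sum>s=1..i. (ip k (x j) (gram_schmidt k x s))\<^sup>2) = (L2_set (orth_proj k (span_k k x {1..i}) (x j)) {..k})\<^sup>2"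
        using i by (intro orth_proj_gram_schmidt[symmetric] ip1 lt) auto
      also have "\<dots> \<le> \<tau>"
        unfolding \<tau> using perf i by (intro power_mono) (auto simp: perfect_def L2_set_nonneg)
      finally show ?thesis unfolding eq .
    qed (use \<tau> in simp)
  qed
  have col: "colour_sign col * ip k (x j) (x i) \<le> - colour_sign col * c_kp k p / sqrt (real k)"
    if "j \<in> {1..r}" "i \<in> {1..<j}" for i j
  proof -
    have "edge_colour k p x j i = col"
      using clique that unfolding mono_clique_def by auto
    then show ?thesis
      by (cases col) (auto simp: edge_colour_def colour_sign_def split: if_splits)
  qed
  show ?thesis
    unfolding good_def using ip1 proj col by simp
qed

text \<open>Measurability of the event in \<open>P_per\<close> is not established:
  \<open>finite_measure_mono_AE\<close> asks for it only on the side of \<open>good\<close>. The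
  points have norm 1 almost everywhere.\<close>

lemma P_per_le_weight:
  assumes \<tau>: "\<tau> = (alpha_C C * sqrt (real l) / sqrt (real k))\<^sup>2" "\<tau> < 1"
  shows "ennreal (P_per col C l k p r) \<le> weight (colour_sign col) (- colour_sign col * c_kp k p) \<tau> k r r"
proof -
  interpret M: prob_space "sphere_prod k r"
    by (intro prob_space_PiM prob_space_uniform_sphere)
  let ?good = "good (colour_sign col) (- colour_sign col * c_kp k p) \<tau> k r"
  let ?B = "{x \<in> space (sphere_prod k r). ?good x}"
  have [measurable]: "Measurable.pred (sphere_prod k r) ?good"
    by (rule good_pred)
  have B: "?B \<in> sets (sphere_prod k r)" by measurable
  have "AE x in sphere_prod k r. \<forall>j\<in>{1..r}. L2_set (x j) {..k} = 1"
  proof (rule AE_finite_allI)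
    fix j assume "j \<in> {1..r}"
    then show "AE x in sphere_prod k r. L2_set (x j) {..k} = 1"
      by (rule AE_PiM_component[OF prob_space_uniform_sphere]) (rule AE_uniform_sphere)
  qed simp
  then have "AE x in sphere_prod k r.
      x \<in> {x \<in> space (sphere_prod k r). mono_clique col k p r x \<and> perfect C l k r x} \<longrightarrow> x \<in> ?B"
  proof eventually_elim
    case (elim x)
    then show ?case using perfect_imp_good[where x=x and col=col and r=r and p=p, OF _ _ _ \<tau>] by auto
  qed
  then have "P_per col C l k p r \<le> measure (sphere_prod k r) ?B"
    unfolding P_per_def Let_def using B by (rule M.finite_measure_mono_AE)
  then have "ennreal (P_per col C l k p r) \<le> emeasure (sphere_prod k r) ?B"
    unfolding M.emeasure_eq_measure by (rule ennreal_leI)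
  also have "\<dots> = (\<integral>\<^sup>+x. indicator ?B x \<partial>sphere_prod k r)"
    using B by simp
  also have "\<dots> = weight (colour_sign col) (- colour_sign col * c_kp k p) \<tau> k r r"
    unfolding weight_def by (intro nn_integral_cong) (auto simp: indicator_def)
  finally show ?thesis .
qed

section \<open>The threshold c\<close>

text \<open>The function of c that \<open>c_kp\<close> inverts.\<close>

definition cap :: "nat \<Rightarrow> real \<Rightarrow> real" where
  "cap k c = measure (uniform_sphere k) {x \<in> space (uniform_sphere k). ip k x (e0 k) \<le> - c / sqrt (real k)}"

lemma ip_e0: "ip k x (e0 k) = x 0"
  by (simp add: e0_def) (simp add: ip_def if_distrib cong: if_cong)

lemma ip_e0_e0: "ip k (e0 k) (e0 k) = 1"
  unfolding ip_e0 by (simp add: e0_def)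

lemma space_sphere_eq: "space (uniform_sphere k) = space (lborel_k k)" "space (gauss_k k) = space (lborel_k k)"
  by (simp_all add: space_uniform_sphere space_gauss_k space_lborel_k)

lemma measure_sphere_gauss:
  assumes [measurable]: "A \<in> sets (lborel_k k)"
  shows "measure (uniform_sphere k) A = measure (gauss_k k) {x \<in> space (lborel_k k). normalise_k k x \<in> A}"
proof -
  interpret G: prob_space "gauss_k k" by (rule prob_space_gauss_k)
  have "emeasure (gauss_k k) {x \<in> space (lborel_k k). True} = 1"
    using G.emeasure_space_1 by (simp add: space_sphere_eq)
  then show ?thesis
    using emeasure_gauss_k_cone[OF assms, of UNIV] by (simp add: measure_def)
qed

lemma cap_gauss:
  assumes "1 \<le> k"
  shows "cap k c = measure (gauss_k k) {x \<in> space (lborel_k k). x 0 \<le> - c * (L2_set x {..k} / sqrt (real k))}"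
proof -
  have [measurable]: "{x \<in> space (lborel_k k). x 0 \<le> - c / sqrt (real k)} \<in> sets (lborel_k k)"
    by measurable
  have "cap k c = measure (gauss_k k) {x \<in> space (lborel_k k).
      normalise_k k x \<in> {x \<in> space (lborel_k k). x 0 \<le> - c / sqrt (real k)}}"
    unfolding cap_def ip_e0 space_sphere_eq by (rule measure_sphere_gauss) measurable
  also have "\<dots> = measure (gauss_k k) {x \<in> space (lborel_k k). x 0 \<le> - c * (L2_set x {..k} / sqrt (real k))}"
  proof (rule measure_eq_AE)
    show "AE x in gauss_k k. (x \<in> {x \<in> space (lborel_k k).
        normalise_k k x \<in> {x \<in> space (lborel_k k). x 0 \<le> - c / sqrt (real k)}})
      = (x \<in> {x \<in> space (lborel_k k). x 0 \<le> - c * (L2_set x {..k} / sqrt (real k))})"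
      using AE_gauss_k_L2_pos[of k]
      by eventually_elim (auto simp: space_lborel_k field_simps)
  qed (unfold sets_gauss_k, measurable)
  finally show ?thesis .
qed

lemma measure_gauss_halfspace:
  "measure (gauss_k k) {x \<in> space (lborel_k k). x 0 \<le> a} = Phi a"
proof -
  have "emeasure (gauss_k k) {x \<in> space (lborel_k k). x 0 \<le> a} = (\<integral>\<^sup>+g. indicator {..a} (ip k g (e0 k)) \<partial>gauss_k k)"
  proof -
    have "{x \<in> space (lborel_k k). x 0 \<le> a} \<in> sets (gauss_k k)"
      unfolding sets_gauss_k by measurable
    then have "emeasure (gauss_k k) {x \<in> space (lborel_k k). x 0 \<le> a}
        = (\<integral>\<^sup>+g. indicator {x \<in> space (lborel_k k). x 0 \<le> a} g \<partial>gauss_k k)"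
      by simp
    then show ?thesis
      unfolding ip_e0 by (auto intro!: nn_integral_cong simp: indicator_def space_sphere_eq)
  qed
  also have "\<dots> = (\<integral>\<^sup>+h. indicator {..a} h \<partial>std_normal)"
    by (rule gauss_k_marginal) (auto simp: ip_e0_e0)
  finally show ?thesis by (simp add: measure_def Phi_def)
qed

text \<open>On the norm window the cap lies between the half-spaces at heights c (1 + d) and c (1 -
  d); the complement of the window is paid for by \<open>gauss_k_norm_concentration\<close>.\<close>

lemma cap_bounds:
  assumes "1 \<le> k" "0 < d" "d < 1" "0 \<le> c"
  shows "cap k c \<le> Phi (- (c * (1 - d))) + 5 / (d\<^sup>2 * real k)"
    and "Phi (- (c * (1 + d))) \<le> cap k c + 5 / (d\<^sup>2 * real k)"
proof -
  interpret G: prob_space "gauss_k k" by (rule prob_space_gauss_k)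
  let ?S = "space (lborel_k k)"
  let ?A = "{x \<in> ?S. x 0 \<le> - c * (L2_set x {..k} / sqrt (real k))}"
  let ?N = "{x \<in> ?S. L2_set x {..k} \<notin> norm_window k d}"
  let ?H = "\<lambda>a. {x \<in> ?S. x 0 \<le> a}"
  have meas [measurable]: "?A \<in> sets (lborel_k k)" "?N \<in> sets (lborel_k k)" "?H a \<in> sets (lborel_k k)" for a
    by measurable
  have N: "measure (gauss_k k) ?N \<le> 5 / (d\<^sup>2 * real k)"
    by (rule gauss_k_norm_concentration) (use assms in auto)
  have win: "1 - d \<le> L2_set x {..k} / sqrt (real k)" "L2_set x {..k} / sqrt (real k) \<le> 1 + d"
    if "L2_set x {..k} \<in> norm_window k d" for x
    using that assms by (auto simp: norm_window_def field_simps abs_le_iff)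
  have "?A \<subseteq> ?H (- (c * (1 - d))) \<union> ?N"
  proof
    fix x assume x: "x \<in> ?A"
    show "x \<in> ?H (- (c * (1 - d))) \<union> ?N"
    proof (cases "L2_set x {..k} \<in> norm_window k d")
      case True
      have "c * (1 - d) \<le> c * (L2_set x {..k} / sqrt (real k))"
        using win(1)[OF True] assms by (intro mult_left_mono) auto
      with x show ?thesis by auto
    qed (use x in auto)
  qed
  then have "measure (gauss_k k) ?A \<le> measure (gauss_k k) (?H (- (c * (1 - d))) \<union> ?N)"
    by (intro G.finite_measure_mono) auto
  also have "\<dots> \<le> measure (gauss_k k) (?H (- (c * (1 - d)))) + measure (gauss_k k) ?N"
    by (intro measure_Un_le) auto
  finally show "cap k c \<le> Phi (- (c * (1 - d))) + 5 / (d\<^sup>2 * real k)"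
    unfolding cap_gauss[OF assms(1)] measure_gauss_halfspace using N by linarith
  have "?H (- (c * (1 + d))) \<subseteq> ?A \<union> ?N"
  proof
    fix x assume x: "x \<in> ?H (- (c * (1 + d)))"
    show "x \<in> ?A \<union> ?N"
    proof (cases "L2_set x {..k} \<in> norm_window k d")
      case True
      have "c * (L2_set x {..k} / sqrt (real k)) \<le> c * (1 + d)"
        using win(2)[OF True] assms by (intro mult_left_mono) auto
      with x show ?thesis by auto
    qed (use x in auto)
  qed
  then have "measure (gauss_k k) (?H (- (c * (1 + d)))) \<le> measure (gauss_k k) (?A \<union> ?N)"
    by (intro G.finite_measure_mono) auto
  also have "\<dots> \<le> measure (gauss_k k) ?A + measure (gauss_k k) ?N"
    by (intro measure_Un_le) auto
  finally show "Phi (- (c * (1 + d))) \<le> cap k c + 5 / (d\<^sup>2 * real k)"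
    unfolding cap_gauss[OF assms(1)] measure_gauss_halfspace using N by linarith
qed

lemma cap_antimono:
  assumes "c \<le> c'"
  shows "cap k c' \<le> cap k c"
proof -
  interpret S: prob_space "uniform_sphere k" by (rule prob_space_uniform_sphere)
  have "- c' / sqrt (real k) \<le> - c / sqrt (real k)"
    using assms by (intro divide_right_mono) auto
  then show ?thesis
    unfolding cap_def ip_e0 space_sphere_eq
  proof (intro S.finite_measure_mono)
    show "{x \<in> space (lborel_k k). x 0 \<le> - c / sqrt (real k)} \<in> S.events"
      unfolding sets_uniform_sphere by measurable
  qed auto
qed

text \<open>Fubini in coordinate 0. If the other coordinates have square sum \<rho>, an admissible y
  satisfies (k - c^2) y^2 = c^2 \<rho> and y \<le> 0, so there is at most one; c < sqrt k makes the
  coefficient positive.\<close>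

lemma null_set_cone:
  assumes c: "0 \<le> c" "c < sqrt (real k)"
  shows "emeasure (lborel_k k) {x \<in> space (lborel_k k). sqrt (real k) * x 0 = - c * L2_set x {..k}} = 0"
proof -
  interpret product_sigma_finite "\<lambda>_::nat. lborel :: real measure" ..
  let ?Z = "{x \<in> space (lborel_k k). sqrt (real k) * x 0 = - c * L2_set x {..k}}"
  have [measurable]: "?Z \<in> sets (lborel_k k)" by measurable
  have ins: "{..k} = insert 0 {1..k}" by auto
  have ck: "0 < real k - c\<^sup>2"
  proof -
    have "c\<^sup>2 < (sqrt (real k))\<^sup>2" using c by (intro power_strict_mono) auto
    then show ?thesis by simp
  qed
  have "emeasure (lborel_k k) ?Z = (\<integral>\<^sup>+x. indicator ?Z x \<partial>lborel_k k)"
    by simp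
  also have "\<dots> = (\<integral>\<^sup>+x. (\<integral>\<^sup>+y. indicator ?Z (x(0 := y)) \<partial>lborel) \<partial>Pi\<^sub>M {1..k} (\<lambda>_. lborel))"
    unfolding lborel_k_def ins
  proof (rule product_nn_integral_insert)
    show "indicator {x \<in> space (Pi\<^sub>M (insert 0 {1..k}) (\<lambda>_. lborel)). sqrt (real k) * x 0 = - c * L2_set x (insert 0 {1..k})}
      \<in> borel_measurable (Pi\<^sub>M (insert 0 {1..k}) (\<lambda>_. lborel :: real measure))"
      unfolding ins[symmetric] lborel_k_def[symmetric] by measurable
  qed auto
  also have "\<dots> = (\<integral>\<^sup>+(x :: nat \<Rightarrow> real). 0 \<partial>Pi\<^sub>M {1..k} (\<lambda>_. lborel))"
  proof (rule nn_integral_cong)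
    fix x :: "nat \<Rightarrow> real"
    let ?Y = "{y. x(0 := y) \<in> ?Z}"
    have uniq: "y = z" if "y \<in> ?Y" "z \<in> ?Y" for y z
    proof -
      define \<rho> where "\<rho> = (\<Sum>i=1..k. (x i)\<^sup>2)"
      have L: "(L2_set (x(0 := y)) {..k})\<^sup>2 = y\<^sup>2 + \<rho>" for y
      proof -
        have "(\<Sum>i=1..k. ((x(0 := y)) i)\<^sup>2) = \<rho>"
          unfolding \<rho>_def by (intro sum.cong) auto
        then have "(\<Sum>i\<in>{..k}. ((x(0 := y)) i)\<^sup>2) = y\<^sup>2 + \<rho>"
          unfolding ins by (subst sum.insert) auto
        moreover have "0 \<le> (\<Sum>i\<in>{..k}. ((x(0 := y)) i)\<^sup>2)" by (rule sum_nonneg) simp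
        ultimately show ?thesis unfolding L2_set_def by simp
      qed
      have sq: "(real k - c\<^sup>2) * y\<^sup>2 = c\<^sup>2 * \<rho>" and neg: "y \<le> 0" if "y \<in> ?Y" for y
      proof -
        have e: "sqrt (real k) * y = - (c * L2_set (x(0 := y)) {..k})"
          using that by simp
        have "(sqrt (real k) * y)\<^sup>2 = (c * L2_set (x(0 := y)) {..k})\<^sup>2"
          unfolding e by simp
        then have "real k * y\<^sup>2 = c\<^sup>2 * (y\<^sup>2 + \<rho>)"
          unfolding power_mult_distrib L by simp
        then show "(real k - c\<^sup>2) * y\<^sup>2 = c\<^sup>2 * \<rho>" by (simp add: algebra_simps)
        have "0 \<le> c * L2_set (x(0 := y)) {..k}" using c by (simp add: L2_set_nonneg)
        then have "sqrt (real k) * y \<le> 0" using e by linarith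
        moreover have "0 < sqrt (real k)" using c by linarith
        ultimately show "y \<le> 0" by (simp add: mult_le_0_iff)
      qed
      have "(real k - c\<^sup>2) * y\<^sup>2 = (real k - c\<^sup>2) * z\<^sup>2"
        using sq[OF that(1)] sq[OF that(2)] by simp
      then have "y\<^sup>2 = z\<^sup>2" using ck by simp
      then show "y = z" using neg[OF that(1)] neg[OF that(2)] unfolding power2_eq_iff by linarith
    qed
    obtain z where z: "?Y \<subseteq> {z}"
      using uniq by blast
    have "(\<integral>\<^sup>+y. indicator ?Z (x(0 := y)) \<partial>lborel) \<le> (\<integral>\<^sup>+y. indicator {z} y \<partial>(lborel :: real measure))"
      using z by (intro nn_integral_mono) (auto simp: indicator_def)
    also have "\<dots> = 0" by simp
    finally show "(\<integral>\<^sup>+y. indicator ?Z (x(0 := y)) \<partial>lborel) = 0" by simp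
  qed
  finally show ?thesis by simp
qed

text \<open>With the sign of the argument reversed, \<open>cap\<close> is the distribution function
  of sqrt k times coordinate 0. Continuity is then the absence of an atom, which would be a cone of
  measure zero.\<close>

lemma cap_isCont:
  assumes c: "0 \<le> c" "c < sqrt (real k)"
  shows "isCont (\<lambda>y. cap k (- y)) (- c)"
proof -
  interpret S: prob_space "uniform_sphere k" by (rule prob_space_uniform_sphere)
  interpret G: prob_space "gauss_k k" by (rule prob_space_gauss_k)
  have k: "0 < sqrt (real k)" using c by linarith
  define M where "M = distr (uniform_sphere k) borel (\<lambda>x. sqrt (real k) * x 0)"
  have [measurable]: "(\<lambda>x. sqrt (real k) * x 0) \<in> borel_measurable (uniform_sphere k)"
    by measurable
  interpret M: prob_space M unfolding M_def by (rule S.prob_space_distr) measurable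
  interpret M: finite_borel_measure M by standard (simp add: M_def)
  have cdf: "cdf M y = cap k (- y)" for y
  proof -
    have "cdf M y = measure (uniform_sphere k) {x \<in> space (uniform_sphere k). sqrt (real k) * x 0 \<le> y}"
      unfolding cdf_def M_def by (subst measure_distr) (auto intro!: arg_cong[where f="measure _"])
    also have "{x \<in> space (uniform_sphere k). sqrt (real k) * x 0 \<le> y}
      = {x \<in> space (uniform_sphere k). ip k x (e0 k) \<le> - (- y) / sqrt (real k)}"
      using k unfolding ip_e0 by (auto simp: field_simps)
    finally show ?thesis by (simp add: cap_def)
  qed
  have "measure M {- c} = measure (uniform_sphere k) {x \<in> space (lborel_k k). sqrt (real k) * x 0 = - c}"
    unfolding M_def by (subst measure_distr) (auto intro!: arg_cong[where f="measure _"] simp: space_sphere_eq)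
  also have "\<dots> = measure (gauss_k k) {x \<in> space (lborel_k k).
      normalise_k k x \<in> {x \<in> space (lborel_k k). sqrt (real k) * x 0 = - c}}"
    by (rule measure_sphere_gauss) measurable
  also have "\<dots> = measure (gauss_k k) {}"
  proof (rule measure_eq_AE)
    have "AE x in lborel_k k. x \<notin> {x \<in> space (lborel_k k). sqrt (real k) * x 0 = - c * L2_set x {..k}}"
      using null_set_cone[OF c] by (intro AE_not_in) (auto simp: null_sets_def)
    then have "AE x in gauss_k k. x \<notin> {x \<in> space (lborel_k k). sqrt (real k) * x 0 = - c * L2_set x {..k}}"
      unfolding gauss_k_density by (subst AE_density) (auto elim!: eventually_mono)
    with AE_gauss_k_L2_pos[of k]
    show "AE x in gauss_k k. (x \<in> {x \<in> space (lborel_k k).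
      normalise_k k x \<in> {x \<in> space (lborel_k k). sqrt (real k) * x 0 = - c}}) = (x \<in> {})"
      by eventually_elim (auto simp: field_simps)
  qed (unfold sets_gauss_k, measurable)
  finally have "measure M {- c} = 0" by simp
  then have "isCont (cdf M) (- c)" by (simp add: M.isCont_cdf)
  moreover have "cdf M = (\<lambda>y. cap k (- y))" using cdf by auto
  ultimately show ?thesis by simp
qed

lemma gauss_k_box_pos:
  assumes "\<And>i. i \<le> k \<Longrightarrow> lo i < hi i"
  shows "0 < measure (gauss_k k) (Pi\<^sub>E {..k} (\<lambda>i. {lo i<..<hi i}))"
proof -
  interpret product_sigma_finite "\<lambda>_::nat. lborel :: real measure" ..
  interpret G: prob_space "gauss_k k" by (rule prob_space_gauss_k)
  let ?A = "Pi\<^sub>E {..k} (\<lambda>i. {lo i<..<hi i})"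
  have A [measurable]: "?A \<in> sets (lborel_k k)"
    unfolding lborel_k_def by (intro sets_PiM_I_finite) auto
  have "emeasure (lborel_k k) ?A = (\<Prod>i\<le>k. ennreal (hi i - lo i))"
    unfolding lborel_k_def using assms by (subst emeasure_PiM) (auto intro!: prod.cong simp: less_imp_le)
  also have "\<dots> = ennreal (\<Prod>i\<le>k. hi i - lo i)"
    using assms by (intro prod_ennreal) (auto simp: less_imp_le)
  also have "\<dots> > 0"
    using assms by (auto intro!: prod_pos)
  finally have pos: "emeasure (lborel_k k) ?A \<noteq> 0" by simp
  have "emeasure (gauss_k k) ?A \<noteq> 0"
  proof
    assume "emeasure (gauss_k k) ?A = 0"
    then have "(\<integral>\<^sup>+x. ennreal (gauss_weight k x) * indicator ?A x \<partial>lborel_k k) = 0"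
      unfolding gauss_k_density by (subst (asm) emeasure_density) auto
    then have "AE x in lborel_k k. ennreal (gauss_weight k x) * indicator ?A x = 0"
      by (subst (asm) nn_integral_0_iff_AE) auto
    then have "AE x in lborel_k k. x \<notin> ?A"
      by eventually_elim (auto simp: gauss_weight_def indicator_def split: if_splits)
    then have "emeasure (lborel_k k) ?A = 0"
    proof (subst (asm) AE_iff_measurable)
      show "{x \<in> space (lborel_k k). \<not> x \<notin> ?A} = ?A"
        using sets.sets_into_space[OF A] by auto
    qed (use A in auto)
    with pos show False by simp
  qed
  then show ?thesis
    by (simp add: G.emeasure_eq_measure zero_less_measure_iff)
qed

text \<open>The Gaussian density is positive, so it suffices to fit a nonempty open box between the
  two cones.\<close>

lemma cap_strict_antimono:
  assumes k: "1 \<le> k" and c: "0 \<le> c" "c < c'" "c' < sqrt (real k)"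
  shows "cap k c' < cap k c"
proof -
  interpret G: prob_space "gauss_k k" by (rule prob_space_gauss_k)
  let ?S = "space (lborel_k k)"
  have rk: "0 < sqrt (real k)" using k by simp
  have sq: "c\<^sup>2 < real k" "c'\<^sup>2 < real k" "c\<^sup>2 \<le> c'\<^sup>2"
  proof -
    have "c'\<^sup>2 < (sqrt (real k))\<^sup>2" using c by (intro power_strict_mono) auto
    moreover show "c\<^sup>2 \<le> c'\<^sup>2" using c by (intro power_mono) auto
    ultimately show "c\<^sup>2 < real k" "c'\<^sup>2 < real k" by auto
  qed
  \<comment> \<open>The slope of the cone: with y = - \<open>x 0\<close> and \<rho> the square sum
    of the other coordinates, x lies in \<open>?C c\<close> iff y \<ge> \<kappa> sqrt
    \<rho>.\<close>
  define \<kappa> where "\<kappa> = c / sqrt (real k - c\<^sup>2)"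
  define \<kappa>' where "\<kappa>' = c' / sqrt (real k - c'\<^sup>2)"
  have \<kappa>: "0 \<le> \<kappa>" "\<kappa> < \<kappa>'"
  proof -
    show "0 \<le> \<kappa>"
      unfolding \<kappa>_def
    proof (intro divide_nonneg_nonneg real_sqrt_ge_zero)
      show "0 \<le> real k - c\<^sup>2" using sq(1) by linarith
    qed (use c in simp)
    show "\<kappa> < \<kappa>'"
      unfolding \<kappa>_def \<kappa>'_def using c sq by (intro frac_less) auto
  qed
  have \<kappa>2: "\<kappa>\<^sup>2 * (real k - c\<^sup>2) = c\<^sup>2" "\<kappa>'\<^sup>2 * (real k - c'\<^sup>2) = c'\<^sup>2"
    using sq by (auto simp: \<kappa>_def \<kappa>'_def power_divide)
  \<comment> \<open>Chosen so that u > 1 and \<kappa> u < \<open>\<kappa>'\<close>. Other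
    coordinates in (1, u) put sqrt \<rho> between sqrt k and u sqrt k, and then every y between sqrt
    k \<kappa> u and sqrt k \<open>\<kappa>'\<close> lies between the cones.\<close>
  define u where "u = 2 * \<kappa>' / (\<kappa> + \<kappa>')"
  have u: "1 < u" using \<kappa> by (simp add: u_def)
  have \<kappa>u: "\<kappa> * u < \<kappa>'"
  proof -
    have "\<kappa>' * (2 * \<kappa>) < \<kappa>' * (\<kappa> + \<kappa>')" using \<kappa> by (intro mult_strict_left_mono) auto
    then show ?thesis using \<kappa> by (simp add: u_def divide_less_eq mult_ac)
  qed
  define lo where "lo = (\<lambda>i::nat. if i = 0 then - (sqrt (real k) * \<kappa>') else 1)"
  define hi where "hi = (\<lambda>i::nat. if i = 0 then - (sqrt (real k) * (\<kappa> * u)) else u)"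
  let ?A = "Pi\<^sub>E {..k} (\<lambda>i. {lo i<..<hi i})"
  let ?C = "\<lambda>c. {x \<in> ?S. x 0 \<le> - c * (L2_set x {..k} / sqrt (real k))}"
  have "?C d \<in> sets (lborel_k k)" for d
    by measurable
  moreover have "?A \<in> sets (lborel_k k)"
    unfolding lborel_k_def by (intro sets_PiM_I_finite) auto
  ultimately have meas: "?A \<in> sets (lborel_k k)" "?C c \<in> sets (lborel_k k)" "?C c' \<in> sets (lborel_k k)"
    by blast+
  have sub: "?A \<subseteq> ?C c - ?C c'"
  proof
    fix x assume x: "x \<in> ?A"
    define y where "y = - x 0"
    define \<rho> where "\<rho> = (\<Sum>i=1..k. (x i)\<^sup>2)"
    have "lo 0 < x 0 \<and> x 0 < hi 0"
      using x by (auto simp: PiE_iff)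
    then have y: "sqrt (real k) * (\<kappa> * u) < y" "y < sqrt (real k) * \<kappa>'"
      by (auto simp: lo_def hi_def y_def)
    have xi: "1 < x i \<and> x i < u" if "i \<in> {1..k}" for i
    proof -
      have "lo i < x i \<and> x i < hi i"
        using x that by (auto simp: PiE_iff)
      then show ?thesis using that by (auto simp: lo_def hi_def)
    qed
    have "(\<Sum>i=1..k. (1::real)) \<le> \<rho>"
      unfolding \<rho>_def using xi by (intro sum_mono) (auto simp: less_imp_le)
    then have \<rho>1: "real k \<le> \<rho>" by simp
    have "\<rho> \<le> (\<Sum>i=1..k. u\<^sup>2)"
      unfolding \<rho>_def
    proof (intro sum_mono power_mono)
      fix i assume "i \<in> {1..k}"
      with xi[of i] show "x i \<le> u" "0 \<le> x i" by auto
    qed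
    then have \<rho>2: "\<rho> \<le> real k * u\<^sup>2" by simp
    have L: "(L2_set x {..k})\<^sup>2 = y\<^sup>2 + \<rho>"
    proof -
      have "{..k} = insert 0 {1..k}" by auto
      then have "(\<Sum>i\<in>{..k}. (x i)\<^sup>2) = y\<^sup>2 + \<rho>"
        by (simp add: \<rho>_def y_def)
      moreover have "0 \<le> (\<Sum>i\<in>{..k}. (x i)\<^sup>2)" by (rule sum_nonneg) simp
      ultimately show ?thesis unfolding L2_set_def by simp
    qed
    have y0: "0 \<le> y"
    proof -
      have "0 \<le> sqrt (real k) * (\<kappa> * u)" using \<kappa> u by simp
      then show ?thesis using y(1) by linarith
    qed
    have "c * L2_set x {..k} \<le> sqrt (real k) * y"
    proof (rule power2_le_imp_le)
      have "(sqrt (real k) * (\<kappa> * u))\<^sup>2 \<le> y\<^sup>2"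
        using y \<kappa> u by (intro power_mono) auto
      then have "(sqrt (real k) * (\<kappa> * u))\<^sup>2 * (real k - c\<^sup>2) \<le> y\<^sup>2 * (real k - c\<^sup>2)"
        using sq by (intro mult_right_mono) auto
      moreover have "(sqrt (real k) * (\<kappa> * u))\<^sup>2 * (real k - c\<^sup>2) = (real k * u\<^sup>2) * (\<kappa>\<^sup>2 * (real k - c\<^sup>2))"
        by (simp add: power_mult_distrib)
      moreover have "c\<^sup>2 * \<rho> \<le> c\<^sup>2 * (real k * u\<^sup>2)"
        using \<rho>2 by (intro mult_left_mono) auto
      ultimately have "c\<^sup>2 * \<rho> \<le> y\<^sup>2 * (real k - c\<^sup>2)"
        unfolding \<kappa>2 by (simp add: mult.commute)
      then show "(c * L2_set x {..k})\<^sup>2 \<le> (sqrt (real k) * y)\<^sup>2"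
        unfolding power_mult_distrib L by (simp add: algebra_simps)
    qed (use y0 in simp)
    then have "x \<in> ?C c"
      using x rk by (auto simp: y_def field_simps space_lborel_k PiE_iff)
    moreover have "sqrt (real k) * y < c' * L2_set x {..k}"
    proof (rule power2_less_imp_less)
      have "y\<^sup>2 < (sqrt (real k) * \<kappa>')\<^sup>2"
        using y y0 by (intro power_strict_mono) auto
      then have "y\<^sup>2 * (real k - c'\<^sup>2) < (sqrt (real k) * \<kappa>')\<^sup>2 * (real k - c'\<^sup>2)"
        using sq by (intro mult_strict_right_mono) auto
      also have "\<dots> = real k * (\<kappa>'\<^sup>2 * (real k - c'\<^sup>2))"
        by (simp add: power_mult_distrib)
      also have "\<dots> \<le> c'\<^sup>2 * \<rho>"
        unfolding \<kappa>2 using \<rho>1 by (simp add: mult.commute mult_right_mono)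
      finally show "(sqrt (real k) * y)\<^sup>2 < (c' * L2_set x {..k})\<^sup>2"
        unfolding power_mult_distrib L by (simp add: algebra_simps)
    qed (use c in \<open>simp add: L2_set_nonneg\<close>)
    then have "x \<notin> ?C c'"
      using rk by (auto simp: y_def field_simps)
    ultimately show "x \<in> ?C c - ?C c'" by blast
  qed
  have "0 < measure (gauss_k k) ?A"
    using \<kappa>u u rk by (intro gauss_k_box_pos) (auto simp: lo_def hi_def)
  also have "\<dots> \<le> measure (gauss_k k) (?C c - ?C c')"
    using sub meas by (intro G.finite_measure_mono) auto
  also have "\<dots> = measure (gauss_k k) (?C c) - measure (gauss_k k) (?C c')"
  proof (rule G.finite_measure_Diff)
    show "?C c' \<subseteq> ?C c"
    proof
      fix x assume "x \<in> ?C c'"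
      moreover have "c * (L2_set x {..k} / sqrt (real k)) \<le> c' * (L2_set x {..k} / sqrt (real k))"
        using c by (intro mult_right_mono) (auto simp: L2_set_nonneg)
      ultimately show "x \<in> ?C c" by auto
    qed
  qed (use meas in auto)
  finally show ?thesis
    unfolding cap_gauss[OF k] by simp
qed

text \<open>Intermediate values on [0, sqrt (8 / p)], with the window d = 1/2 and its error 20 / k.
  At the right end \<open>Phi_tail\<close> bounds the Gaussian part by 4 (p / 8) = p / 2; at 0 the
  cap has measure at least 1/2 - 20 / k. Uniqueness is proved too, because \<open>c_kp\<close> is a
  definite description.\<close>

lemma c_kp_spec:
  assumes k: "1 \<le> k" "8 / p < real k" "20 / real k \<le> p / 2" "20 / real k \<le> 1 / 2 - p"
    and p: "0 < p" "p < 1 / 2"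
  shows "0 \<le> c_kp k p" "c_kp k p \<le> sqrt (8 / p)" "cap k (c_kp k p) = p"
proof -
  define c1 where "c1 = sqrt (8 / p)"
  have c1: "0 < c1" "c1\<^sup>2 = 8 / p" "c1 < sqrt (real k)"
    using p k by (auto simp: c1_def)
  have "cap k c1 \<le> Phi (- (c1 * (1 - 1/2))) + 5 / ((1/2)\<^sup>2 * real k)"
    using cap_bounds(1)[of k "1/2" c1] k c1 by simp
  also have "5 / ((1/2)\<^sup>2 * real k) = 20 / real k" by (simp add: power2_eq_square)
  also have "Phi (- (c1 * (1 - 1/2))) \<le> p / 2"
  proof -
    have "(c1 / 2)\<^sup>2 * Phi (- (c1 / 2)) \<le> 1" using c1 by (intro Phi_tail) simp
    then show ?thesis using c1 p by (simp add: power_divide field_simps)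
  qed
  finally have hi: "cap k c1 \<le> p" using k(3) by linarith
  have "Phi (- (0 * (1 + 1/2))) \<le> cap k 0 + 5 / ((1/2)\<^sup>2 * real k)"
    using cap_bounds(2)[of k "1/2" 0] k by simp
  then have lo: "p \<le> cap k 0"
    using k(4) by (simp add: Phi_0 power2_eq_square)
  have "\<exists>y\<ge>- c1. y \<le> 0 \<and> cap k (- y) = p"
  proof (rule IVT)
    show "\<forall>x. - c1 \<le> x \<and> x \<le> 0 \<longrightarrow> isCont (\<lambda>y. cap k (- y)) x"
    proof (intro allI impI)
      fix x assume "- c1 \<le> x \<and> x \<le> 0"
      then show "isCont (\<lambda>y. cap k (- y)) x"
        using cap_isCont[of "- x" k] c1 by simp
    qed
  qed (use hi lo c1 in auto)
  then obtain y where y: "- c1 \<le> y" "y \<le> 0" "cap k (- y) = p" by blast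
  define c where "c = - y"
  have c: "0 \<le> c" "c \<le> c1" "cap k c = p" using y by (auto simp: c_def)
  have "c_kp k p = c"
    unfolding c_kp_def
  proof (rule the_equality)
    show "0 \<le> c \<and> measure (uniform_sphere k) {x \<in> space (uniform_sphere k). ip k x (e0 k) \<le> - c / sqrt (real k)} = p"
      using c by (simp add: cap_def)
    fix d assume "0 \<le> d \<and> measure (uniform_sphere k) {x \<in> space (uniform_sphere k). ip k x (e0 k) \<le> - d / sqrt (real k)} = p"
    then have d: "0 \<le> d" "cap k d = p" by (auto simp: cap_def)
    show "d = c"
    proof (cases d c rule: linorder_cases)
      case less
      then have "cap k c < cap k d"
        using d c c1 k by (intro cap_strict_antimono) auto
      then show ?thesis using c d by simp
    next
      case greater
      \<comment> \<open>\<open>cap_strict_antimono\<close> requires arguments below sqrt k, whereas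
        d may be larger: m lies in that range, and weak monotonicity covers the way from m to
        d.\<close>
      define m where "m = min d ((c1 + sqrt (real k)) / 2)"
      have "c1 < (c1 + sqrt (real k)) / 2" "(c1 + sqrt (real k)) / 2 < sqrt (real k)"
        using c1(3) by (simp_all add: field_simps)
      then have m: "c < m" "m < sqrt (real k)" "m \<le> d"
        using greater c(2) unfolding m_def min_def by (auto split: if_splits)
      have "cap k m < cap k c" using m c k by (intro cap_strict_antimono) auto
      moreover have "cap k d \<le> cap k m" using m by (intro cap_antimono)
      ultimately show ?thesis using c d by simp
    qed
  qed
  then show "0 \<le> c_kp k p" "c_kp k p \<le> sqrt (8 / p)" "cap k (c_kp k p) = p"
    using c by (auto simp: c1_def)
qed

text \<open>The Gaussian terms of \<open>cap_bounds\<close>, at heights c (1 - d) and c (1 + d),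
  differ from \<open>Phi\<close> at -c by at most c d, as \<open>Phi\<close> is 1-Lipschitz.\<close>

lemma c_kp_Phi:
  assumes k: "1 \<le> k" "8 / p < real k" "20 / real k \<le> p / 2" "20 / real k \<le> 1 / 2 - p"
    and p: "0 < p" "p < 1 / 2" and d: "0 < d" "d < 1"
  shows "\<bar>Phi (- c_kp k p) - p\<bar> \<le> 5 / (d\<^sup>2 * real k) + sqrt (8 / p) * d"
proof -
  let ?c = "c_kp k p"
  note c = c_kp_spec[OF k p]
  have "\<bar>Phi (- (?c * (1 - d))) - Phi (- ?c)\<bar> \<le> \<bar>- (?c * (1 - d)) - - ?c\<bar>"
    "\<bar>Phi (- (?c * (1 + d))) - Phi (- ?c)\<bar> \<le> \<bar>- (?c * (1 + d)) - - ?c\<bar>"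
    by (rule Phi_lipschitz)+
  moreover have "\<bar>- (?c * (1 - d)) - - ?c\<bar> = ?c * d" "\<bar>- (?c * (1 + d)) - - ?c\<bar> = ?c * d"
    using c d by (simp_all add: algebra_simps)
  moreover have "?c * d \<le> sqrt (8 / p) * d"
    using c d by (intro mult_right_mono) auto
  ultimately show ?thesis
    using cap_bounds[of k d ?c] k(1) d c by linarith
qed

text \<open>Turns p > \<open>p_C C\<close> into p > 0. The definite description is justified by the
  strictly increasing f, whose zeros in (0, 1/2) are the solutions.\<close>

lemma p_C_pos:
  assumes C: "1 < C"
  shows "0 < p_C C"
proof -
  define f where "f p = ln p - C * ln (1 - p)" for p :: real
  have D: "(f has_real_derivative 1 / p + C / (1 - p)) (at p)" if "0 < p" "p < 1" for p
    unfolding f_def using that by (auto intro!: derivative_eq_intros simp: field_simps)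
  have mono: "f p < f q" if "0 < p" "p < q" "q < 1" for p q
  proof (rule DERIV_pos_imp_increasing[where f=f])
    fix x assume "p \<le> x" "x \<le> q"
    then show "\<exists>y. (f has_real_derivative y) (at x) \<and> 0 < y"
      using D[of x] that C by (intro exI[of _ "1 / x + C / (1 - x)"]) (auto intro!: add_pos_pos divide_pos_pos)
  qed (use that in simp)
  have iff: "C = ln p / ln (1 - p) \<longleftrightarrow> f p = 0" if "0 < p" "p < 1 / 2" for p
  proof -
    have "ln (1 - p) < 0" using that by simp
    then show ?thesis by (auto simp: f_def field_simps)
  qed
  \<comment> \<open>This is 2 to the power -C, below 1/2, so that \<open>f p0\<close> = -C (ln 2 +
    ln (1 - p0)) \<le> 0.\<close>
  define p0 where "p0 = exp (- C * ln 2)"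
  have p0: "0 < p0" "p0 < 1 / 2"
  proof -
    show "0 < p0" by (simp add: p0_def)
    have "- C * ln 2 < - ln (2 :: real)" using C by simp
    then have "p0 < exp (- ln (2 :: real))" unfolding p0_def by (subst exp_less_cancel_iff)
    then show "p0 < 1 / 2" by (simp add: exp_minus)
  qed
  have "f p0 \<le> 0"
  proof -
    have "ln (1 / 2) \<le> ln (1 - p0)" using p0 by (subst ln_le_cancel_iff) auto
    then have "- ln 2 \<le> ln (1 - p0)" by (simp add: ln_div)
    then have "C * (- ln 2) \<le> C * ln (1 - p0)" using C by (intro mult_left_mono) auto
    then show ?thesis by (simp add: f_def p0_def)
  qed
  moreover have f_half: "0 < f (1 / 2)"
    using C by (simp add: f_def ln_div)
  ultimately have "\<exists>x\<ge>p0. x \<le> 1 / 2 \<and> f x = 0"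
    using p0 by (intro IVT) (auto intro!: DERIV_isCont D)
  then obtain x where x: "p0 \<le> x" "x \<le> 1 / 2" "f x = 0" by blast
  have x2: "0 < x" "x < 1 / 2"
  proof -
    show "0 < x" using x p0 by linarith
    have "x \<noteq> 1 / 2"
    proof
      assume "x = 1 / 2"
      with x(3) have "f (1 / 2) = 0" by (simp only:)
      with f_half show False by linarith
    qed
    then show "x < 1 / 2" using x(2) by linarith
  qed
  have "\<exists>!p. 0 < p \<and> p < 1 / 2 \<and> C = ln p / ln (1 - p)"
  proof (rule ex1I[of _ x])
    show "0 < x \<and> x < 1 / 2 \<and> C = ln x / ln (1 - x)" using iff[OF x2] x x2 by blast
    fix q assume "0 < q \<and> q < 1 / 2 \<and> C = ln q / ln (1 - q)"
    then have "0 < q" "q < 1 / 2" "f q = 0" using iff[of q] by blast+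
    then show "q = x" using mono[of q x] mono[of x q] x x2 by (cases q x rule: linorder_cases) auto
  qed
  from theI'[OF this] show ?thesis unfolding p_C_def by blast
qed

section \<open>Assembling the bounds\<close>

text \<open>x stands for 1/D^2 and M for a common bound of the constants depending on C and p. The
  four summands are at most 32, 80, 10 and 4 times \<open>M ^ 6 * x\<close>, whence 126.\<close>

lemma row_error_le:
  assumes M: "1 \<le> M" and H: "hazard b \<le> M" and b: "\<bar>b\<bar> \<le> M"
    and x: "0 \<le> x" and w: "w = 4 * M\<^sup>2 * x" and \<delta>: "0 \<le> \<delta>" "\<delta> \<le> x" "sqrt (real r) * \<delta> \<le> 2 * M * x"
    and r: "(real r / sqrt (real k))\<^sup>2 \<le> 16 * M\<^sup>2 * x"
  shows "row_error k b r w \<delta> \<le> real r * (126 * M ^ 6 * x)"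
proof -
  let ?H = "hazard b"
  have H0: "0 < ?H" by (rule hazard_pos)
  have H2: "?H\<^sup>2 \<le> M\<^sup>2" using H H0 by (intro power_mono) auto
  have H4: "(?H\<^sup>2)\<^sup>2 \<le> (M\<^sup>2)\<^sup>2" by (rule power_mono[OF H2]) simp
  have pw: "M ^ m * x \<le> M ^ 6 * x" if "m \<le> 6" for m
    using M x that by (intro mult_right_mono power_increasing) auto
  have "8 * ?H\<^sup>2 * w \<le> 8 * M\<^sup>2 * (4 * M\<^sup>2 * x)"
    unfolding w using H2 x by (intro mult_right_mono mult_left_mono) auto
  also have "\<dots> = 32 * (M ^ 4 * x)" by (simp add: power2_eq_square power4_eq_xxxx)
  finally have 1: "8 * ?H\<^sup>2 * w \<le> 32 * (M ^ 6 * x)" using pw[of 4] by linarith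
  have "5 * (?H\<^sup>2 * real r / sqrt (real k))\<^sup>2 = 5 * ((?H\<^sup>2)\<^sup>2 * (real r / sqrt (real k))\<^sup>2)"
    by (simp add: power_mult_distrib power_divide)
  also have "\<dots> \<le> 5 * ((M\<^sup>2)\<^sup>2 * (16 * M\<^sup>2 * x))"
    using H4 r by (intro mult_left_mono mult_mono) auto
  also have "\<dots> = 80 * (M ^ 6 * x)" by (simp add: power_mult[symmetric] power_add[symmetric] mult.assoc[symmetric])
  finally have 2: "5 * (?H\<^sup>2 * real r / sqrt (real k))\<^sup>2 \<le> 80 * (M ^ 6 * x)" .
  have "2 * ?H * \<bar>b\<bar> * (\<delta> + w) \<le> 2 * M * M * (x + w)"
    using H H0 b \<delta> x unfolding w by (intro mult_mono add_mono) auto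
  also have "\<dots> = 2 * (M ^ 2 * x) + 8 * (M ^ 4 * x)"
    by (simp add: w power2_eq_square power4_eq_xxxx algebra_simps)
  finally have 3: "2 * ?H * \<bar>b\<bar> * (\<delta> + w) \<le> 10 * (M ^ 6 * x)" using pw[of 2] pw[of 4] by linarith
  have "2 * ?H\<^sup>2 * (sqrt (real r) * \<delta>) \<le> 2 * M\<^sup>2 * (2 * M * x)"
    by (rule mult_mono[OF mult_left_mono[OF H2] \<delta>(3)]) (use \<delta> in auto)
  also have "\<dots> = 4 * (M ^ 3 * x)" by (simp add: power2_eq_square power3_eq_cube)
  finally have 4: "2 * ?H\<^sup>2 * (sqrt (real r) * \<delta>) \<le> 4 * (M ^ 6 * x)" using pw[of 3] by linarith
  have "row_error k b r w \<delta> = real r * (8 * ?H\<^sup>2 * w + 5 * (?H\<^sup>2 * real r / sqrt (real k))\<^sup>2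
     + 2 * ?H * \<bar>b\<bar> * (\<delta> + w) + 2 * ?H\<^sup>2 * (sqrt (real r) * \<delta>))"
    by (simp add: row_error_def algebra_simps)
  also have "\<dots> \<le> real r * (126 * (M ^ 6 * x))"
    using 1 2 3 4 by (intro mult_left_mono) linarith+
  finally show ?thesis by (simp add: mult.assoc)
qed

text \<open>Turns the factor F exp z per edge, with F = \<open>Phi b\<close> close to q, into the
  base of the theorem. As z is O(1/D), the bound exp z \<le> 1 + z + z^2 loses only O(1/D^2). The
  linear part is F (f / F)^3 y / 3 = f^3 y / (3 F^2) up to sign; replacing F by q and y by R again
  costs O(1/D^2).\<close>

lemma base_estimate:
  fixes F q f z y R x M \<epsilon> :: real
  assumes M: "1 \<le> M" and \<epsilon>: "\<epsilon> = 1 \<or> \<epsilon> = - 1"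
    and F: "1 / M \<le> F" "F \<le> 1" and q: "1 / M \<le> q" "q \<le> 1" and f: "0 \<le> f" "f \<le> 1"
    and x: "0 \<le> x" and Fq: "\<bar>F - q\<bar> \<le> 2 * M * x" and R: "0 \<le> R" "\<bar>y - R\<bar> \<le> 6 * x"
    and y: "0 \<le> y" "y \<le> 4 * M"
    and z: "z = - \<epsilon> * (f / F) ^ 3 * y / 3 + 505 * M ^ 6 * x" "\<bar>z\<bar> \<le> 1" "z\<^sup>2 \<le> 257049 * M ^ 12 * x"
  shows "F * exp z \<le> q - \<epsilon> * f ^ 3 / q\<^sup>2 * (R / 3) + 260000 * M ^ 12 * x"
proof -
  have M0: "0 < M" using M by simp
  have F0: "0 < F" and q0: "0 < q" using F q M0 by (auto intro: less_le_trans[of 0 "1 / M"])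
  have f3: "0 \<le> f ^ 3" "f ^ 3 \<le> 1" using f by (auto intro: power_le_one)
  have pw: "M ^ m * x \<le> M ^ 12 * x" if "m \<le> 12" for m
    using M x that by (intro mult_right_mono power_increasing) auto
  \<comment> \<open>\<open>exp_bound\<close> covers 0 \<le> z \<le> 1; for z = - t < 0 the bound
    follows from exp t \<ge> 1 + t.\<close>
  have "exp z \<le> 1 + z + z\<^sup>2"
  proof (cases "0 \<le> z")
    case True
    then show ?thesis using z(2) by (intro exp_bound) auto
  next
    case False
    define t where "t = - z"
    have t: "0 < t" "0 < 1 + t" using False by (auto simp: t_def)
    have "exp z = 1 / exp t" by (simp add: t_def exp_minus divide_inverse)
    also have "\<dots> \<le> 1 / (1 + t)"
      using exp_ge_add_one_self[of t] t by (intro divide_left_mono) auto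
    also have "\<dots> \<le> 1 - t + t\<^sup>2"
    proof -
      have "(1 - t + t\<^sup>2) * (1 + t) = 1 + t ^ 3"
        by (simp add: algebra_simps power2_eq_square power3_eq_cube)
      moreover have "0 \<le> t ^ 3" using t by simp
      ultimately show ?thesis using t by (simp add: divide_le_eq)
    qed
    finally show ?thesis by (simp add: t_def)
  qed
  then have "F * exp z \<le> F * (1 + z + z\<^sup>2)"
    using F0 by (intro mult_left_mono) auto
  also have "\<dots> = F + F * z + F * z\<^sup>2" by (simp add: algebra_simps)
  finally have 1: "F * exp z \<le> F + F * z + F * z\<^sup>2" .
  have 2: "F * z\<^sup>2 \<le> 257049 * (M ^ 12 * x)"
    using mult_right_mono[OF F(2), of "z\<^sup>2"] z(3) by simp
  have Fz: "F * z = - \<epsilon> * (f ^ 3 / F\<^sup>2) * y / 3 + F * (505 * M ^ 6 * x)"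
    using F0 by (simp add: z(1) power_divide power2_eq_square power3_eq_cube field_simps)
  have 3: "F * (505 * M ^ 6 * x) \<le> 505 * (M ^ 12 * x)"
  proof -
    have "F * (505 * M ^ 6 * x) \<le> 1 * (505 * M ^ 6 * x)"
      using F(2) x M0 by (intro mult_right_mono) auto
    then show ?thesis using pw[of 6] by (simp add: mult.assoc)
  qed
  have inv: "1 / F \<le> M" "1 / q \<le> M" using F q F0 q0 M0 by (auto simp: field_simps)
  have 4: "\<bar>f ^ 3 / F\<^sup>2 * y - f ^ 3 / q\<^sup>2 * R\<bar> \<le> 22 * (M ^ 12 * x)"
  proof -
    have "1 / F\<^sup>2 - 1 / q\<^sup>2 = (q - F) * (q + F) * ((1 / F)\<^sup>2 * (1 / q)\<^sup>2)"
      using F0 q0 by (simp add: field_simps power2_eq_square)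
    then have "\<bar>1 / F\<^sup>2 - 1 / q\<^sup>2\<bar> = \<bar>q - F\<bar> * \<bar>q + F\<bar> * ((1 / F)\<^sup>2 * (1 / q)\<^sup>2)"
      by (simp add: abs_mult)
    also have "\<dots> \<le> (2 * M * x) * 2 * (M\<^sup>2 * M\<^sup>2)"
      using Fq F q F0 q0 inv x M0
      by (intro mult_mono power_mono) (auto simp: abs_minus_commute)
    also have "\<dots> = 4 * (M ^ 5 * x)" by (simp add: power2_eq_square eval_nat_numeral)
    finally have d: "\<bar>1 / F\<^sup>2 - 1 / q\<^sup>2\<bar> \<le> 4 * (M ^ 5 * x)" .
    have "f ^ 3 / F\<^sup>2 * y - f ^ 3 / q\<^sup>2 * R = f ^ 3 * ((1 / F\<^sup>2 - 1 / q\<^sup>2) * y + (1 / q)\<^sup>2 * (y - R))"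
      by (simp add: algebra_simps power_divide diff_divide_distrib)
    then have "\<bar>f ^ 3 / F\<^sup>2 * y - f ^ 3 / q\<^sup>2 * R\<bar> = f ^ 3 * \<bar>(1 / F\<^sup>2 - 1 / q\<^sup>2) * y + (1 / q)\<^sup>2 * (y - R)\<bar>"
      using f3 by (simp add: abs_mult)
    also have "\<dots> \<le> 1 * (\<bar>1 / F\<^sup>2 - 1 / q\<^sup>2\<bar> * \<bar>y\<bar> + (1 / q)\<^sup>2 * \<bar>y - R\<bar>)"
      using f3 by (intro mult_mono) (auto intro: order_trans[OF abs_triangle_ineq] simp: abs_mult)
    also have "\<dots> \<le> 1 * ((4 * (M ^ 5 * x)) * (4 * M) + M\<^sup>2 * (6 * x))"
      using d R y inv q0 x M0 by (intro mult_left_mono add_mono mult_mono power_mono) auto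
    also have "\<dots> = 16 * (M ^ 6 * x) + 6 * (M ^ 2 * x)"
      by (simp add: power2_eq_square eval_nat_numeral)
    also have "\<dots> \<le> 22 * (M ^ 12 * x)" using pw[of 6] pw[of 2] by linarith
    finally show ?thesis .
  qed
  have 5: "F \<le> q + 2 * (M ^ 12 * x)" using Fq pw[of 1] by (simp add: mult.assoc)
  have 6: "- \<epsilon> * (f ^ 3 / F\<^sup>2) * y / 3 \<le> - \<epsilon> * (f ^ 3 / q\<^sup>2) * R / 3 + 22 * (M ^ 12 * x)"
    using 4 \<epsilon> pw[of 0] x mult_nonneg_nonneg[of "M ^ 12" x] M0 by (auto simp: abs_le_iff)
  have 7: "0 \<le> M ^ 12 * x" using M0 x by simp
  \<comment> \<open>The coefficients of \<open>M ^ 12 * x\<close> add up to 257049 + 505 + 22 + 2 <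
    260000.\<close>
  have "F * exp z \<le> q + - \<epsilon> * (f ^ 3 / q\<^sup>2) * R / 3 + 260000 * (M ^ 12 * x)"
    using 1 2 3 5 6 7 Fz by linarith
  then show ?thesis by (simp add: mult.assoc)
qed

lemma P_per_le_1: "P_per col C l k p r \<le> 1"
proof -
  interpret M: prob_space "sphere_prod k r"
    by (intro prob_space_PiM prob_space_uniform_sphere)
  show ?thesis unfolding P_per_def Let_def by (rule M.prob_le_1)
qed

text \<open>The case of D large against M. The ratio a of r to l is 1 for red and C for blue, so
  that one statement serves both colours.\<close>

lemma P_per_bound_large:
  fixes C p D M a :: real and l k r :: nat
  assumes p: "0 < p" "p < 1 / 2"
    and M: "1 \<le> M" "2 / p \<le> M" "a \<le> M" "(alpha_C C)\<^sup>2 \<le> M" "sqrt (8 / p) \<le> M" "1 / (1 / 2 - p) \<le> M"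
    and D: "600 * M ^ 6 \<le> D"
    and l: "10 * D ^ 4 \<le> real l" and k: "\<bar>real k - D\<^sup>2 * (real l)\<^sup>2\<bar> < 1"
    and r: "1 \<le> a" "\<bar>real r - a * real l\<bar> < 1"
    and q: "q = (case col of Red \<Rightarrow> p | Blue \<Rightarrow> 1 - p)"
  shows "P_per col C l k p r \<le> (q - colour_sign col * phi (c_kp k p) ^ 3 / q\<^sup>2
      * ((a * real l / sqrt (real k)) / 3) + 260000 * M ^ 12 * (1 / D\<^sup>2)) ^ (r choose 2)"
proof -
  define x where "x = 1 / D\<^sup>2"
  \<comment> \<open>Small enough that sqrt r \<delta> is O(1/D^2), large enough that \<delta>^2 k
    \<ge> l / (2 D^2) \<ge> 5 D^2, which makes the Chebyshev error 5 / (\<delta>^2 k) at most 1/D^2.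
    The last inequality is l \<ge> 10 D^4.\<close>
  define \<delta> where "\<delta> = 1 / (D\<^sup>2 * sqrt (real l))"
  define c where "c = c_kp k p"
  define \<epsilon> where "\<epsilon> = colour_sign col"
  define b where "b = - \<epsilon> * c"
  define H where "H = hazard b"
  define F where "F = Phi b"
  define \<tau> where "\<tau> = (alpha_C C * sqrt (real l) / sqrt (real k))\<^sup>2"
  \<comment> \<open>The product of the bounds r \<le> 2 M l and \<tau> \<le> 2 M x / l.\<close>
  define w where "w = 4 * M\<^sup>2 * x"
  have M0: "0 < M" using M by simp
  have Mpow: "M ^ m \<le> M ^ 6" if "m \<le> 6" for m
    using M that by (intro power_increasing) auto
  have M6: "1 \<le> M ^ 6" using M by simp
  have D1: "600 \<le> D" "M \<le> D" "600 * M\<^sup>2 \<le> D" "600 * M ^ 4 \<le> D"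
    using D M6 Mpow[of 1] Mpow[of 2] Mpow[of 4] M0 by auto
  have D0: "0 < D" using D1 by simp
  have DD: "D \<le> D\<^sup>2" "D\<^sup>2 \<le> D ^ 4" "D \<le> D ^ 4"
    using D1 power_increasing[of 1 2 D] power_increasing[of 2 4 D] power_increasing[of 1 4 D] by auto
  have l1: "10 * D\<^sup>2 \<le> real l" "10 * D \<le> real l" "6000 \<le> real l"
    using l DD D1 by linarith+
  have l0: "0 < real l" "0 < sqrt (real l)" using l1 by auto
  have x: "0 < x" "x \<le> 1 / D" "x \<le> 1" "D\<^sup>2 * x = 1"
  proof -
    show "0 < x" using D0 by (simp add: x_def)
    show "x \<le> 1 / D" unfolding x_def using DD(1) D0 by (intro divide_left_mono) auto
    then show "x \<le> 1" using D1 by (auto intro: order_trans)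
    show "D\<^sup>2 * x = 1" using D0 by (simp add: x_def)
  qed
  have kD: "D\<^sup>2 * (real l)\<^sup>2 / 2 \<le> real k"
  proof -
    have "1 * 2 \<le> D\<^sup>2 * (real l)\<^sup>2"
    proof (rule mult_mono)
      show "1 \<le> D\<^sup>2" using DD D1 by linarith
      show "2 \<le> (real l)\<^sup>2"
        using mult_mono[of 6000 "real l" 1 "real l"] l1 by (simp add: power2_eq_square)
    qed auto
    then show ?thesis using k by linarith
  qed
  have Dl: "0 < D * real l" using D0 l0 by simp
  have sk: "D * real l / 2 \<le> sqrt (real k)" "0 < sqrt (real k)"
  proof -
    have "(D * real l / 2)\<^sup>2 \<le> D\<^sup>2 * (real l)\<^sup>2 / 2"
      by (simp add: power_mult_distrib power_divide)
    then show "D * real l / 2 \<le> sqrt (real k)"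
      using kD by (intro real_le_rsqrt) linarith
    then show "0 < sqrt (real k)" using Dl by linarith
  qed
  have kM: "100 * M \<le> real k"
  proof -
    have "M * (200 * 1) \<le> D\<^sup>2 * ((real l) * (real l))"
      using D1 DD l1 M0 by (intro mult_mono) auto
    then show ?thesis using kD by (simp add: power2_eq_square)
  qed
  have k1: "1 \<le> k" using kM M by simp
  have invk: "1 / sqrt (real k) \<le> 2 * x"
  proof -
    have "1 / sqrt (real k) \<le> 1 / (D * real l / 2)"
      using sk Dl by (intro divide_left_mono) auto
    also have "\<dots> \<le> 1 / (D\<^sup>2 / 2)"
      using l1 D0 Dl by (intro divide_left_mono) (auto simp: power2_eq_square)
    finally show ?thesis by (simp add: x_def)
  qed
  have kp: "8 / p < real k" "20 / real k \<le> p / 2" "20 / real k \<le> 1 / 2 - p"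
  proof -
    have k0: "0 < real k" using k1 by simp
    have Mp: "2 \<le> M * p" using M(2) p by (simp add: field_simps)
    have kp: "100 * M * p \<le> real k * p" using kM p by (intro mult_right_mono) auto
    have "8 < real k * p" using Mp kp by linarith
    then show "8 / p < real k" using p by (simp add: divide_less_eq)
    from Mp kp show "20 / real k \<le> p / 2" using k0 by (simp add: field_simps)
    define u where "u = 1 / 2 - p"
    have u: "0 < u" using p by (simp add: u_def)
    have "1 \<le> M * u" using M(6) u unfolding u_def[symmetric] by (simp add: divide_le_eq)
    moreover have "100 * M * u \<le> real k * u"
      using kM u by (intro mult_right_mono) auto
    ultimately have "20 \<le> real k * u" by linarith
    then have "20 \<le> (1 / 2 - p) * real k" unfolding u_def by (simp only: mult.commute)
    then show "20 / real k \<le> 1 / 2 - p" using k0 by (simp add: divide_le_eq)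
  qed
  have c: "0 \<le> c" "c \<le> M"
    using c_kp_spec[OF k1 kp p] M(5) by (auto simp: c_def)
  have r2: "real l - 1 < real r" "real r \<le> 2 * M * real l" "2 \<le> real r"
  proof -
    have "1 * real l \<le> a * real l" "a * real l \<le> M * real l" "1 * real l \<le> M * real l"
      using r M l0 by (auto intro: mult_right_mono)
    then show "real l - 1 < real r" "real r \<le> 2 * M * real l" using r l1 by linarith+
    then show "2 \<le> real r" using l1 by linarith
  qed
  have \<delta>: "0 < \<delta>" "\<delta> \<le> x" "\<delta> < 1" "sqrt (real r) * \<delta> \<le> 2 * M * x"
    "\<delta>\<^sup>2 * real k \<ge> real l / (2 * D\<^sup>2)"
  proof -
    have sl: "1 \<le> sqrt (real l)" using l1 by simp
    have e: "\<delta> = x / sqrt (real l)" by (simp add: \<delta>_def x_def)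
    show "0 < \<delta>" using e x l0 by simp
    show "\<delta> \<le> x" unfolding e using x sl by (simp add: divide_le_eq mult_le_cancel_left1)
    have "x \<le> 1 / 600" using x(2) D1 divide_left_mono[of 600 D 1] by linarith
    then show "\<delta> < 1" using \<open>\<delta> \<le> x\<close> by linarith
    have "2 * M * 1 \<le> 2 * M * (2 * M)" using M by (intro mult_left_mono) auto
    then have "2 * M * real l \<le> (2 * M)\<^sup>2 * real l"
      by (intro mult_right_mono) (auto simp: power2_eq_square)
    then have "sqrt (real r) \<le> sqrt ((2 * M)\<^sup>2 * real l)"
      using r2 by (intro real_sqrt_le_mono) linarith
    also have "\<dots> = 2 * M * sqrt (real l)" using M0 by (simp add: real_sqrt_mult)
    finally have "sqrt (real r) * \<delta> \<le> (2 * M * sqrt (real l)) * \<delta>"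
      using \<open>0 < \<delta>\<close> by (intro mult_right_mono) auto
    then show "sqrt (real r) * \<delta> \<le> 2 * M * x" using l0 by (simp add: e)
    have "\<delta>\<^sup>2 * (D\<^sup>2 * (real l)\<^sup>2 / 2) \<le> \<delta>\<^sup>2 * real k"
      using kD by (intro mult_left_mono) auto
    moreover have "\<delta>\<^sup>2 * (D\<^sup>2 * (real l)\<^sup>2 / 2) = real l / (2 * D\<^sup>2)"
    proof -
      have "\<delta>\<^sup>2 = 1 / (D\<^sup>2 * D\<^sup>2 * real l)"
        by (simp add: \<delta>_def power_divide power_mult_distrib power2_eq_square[of "D\<^sup>2"])
      then show ?thesis using D0 l0 by (simp add: field_simps power2_eq_square)
    qed
    ultimately show "\<delta>\<^sup>2 * real k \<ge> real l / (2 * D\<^sup>2)" by simp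
  qed
  have \<delta>k: "10 \<le> \<delta>\<^sup>2 * real k" "5 / (\<delta>\<^sup>2 * real k) \<le> x"
  proof -
    have "5 * D\<^sup>2 \<le> real l / (2 * D\<^sup>2)"
      using l D0 by (simp add: field_simps power2_eq_square power4_eq_xxxx)
    then have *: "5 * D\<^sup>2 \<le> \<delta>\<^sup>2 * real k" using \<delta>(5) by linarith
    then show "10 \<le> \<delta>\<^sup>2 * real k" using DD D1 by linarith
    have "5 / (\<delta>\<^sup>2 * real k) \<le> 5 / (5 * D\<^sup>2)"
      using * D0 \<delta>(1) k1 by (intro divide_left_mono mult_pos_pos) auto
    then show "5 / (\<delta>\<^sup>2 * real k) \<le> x" by (simp add: x_def)
  qed
  have Fq: "\<bar>F - q\<bar> \<le> 2 * M * x"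
  proof -
    have "\<bar>Phi (- c) - p\<bar> \<le> 5 / (\<delta>\<^sup>2 * real k) + sqrt (8 / p) * \<delta>"
      unfolding c_def by (rule c_kp_Phi[OF k1 kp p]) (use \<delta> in auto)
    also have "\<dots> \<le> 1 * x + M * x"
      using \<delta>k \<delta> M M0 x p by (intro add_mono mult_mono) auto
    also have "\<dots> \<le> M * x + M * x" using M x by (intro add_mono mult_right_mono) auto
    finally have "\<bar>Phi (- c) - p\<bar> \<le> 2 * M * x" by simp
    then show ?thesis
      using Phi_minus[of c] by (cases col) (auto simp: F_def b_def \<epsilon>_def colour_sign_def q)
  qed
  have ip: "1 / M \<le> p / 2"
    using M(2) M0 p by (simp add: field_simps)
  have qp: "p \<le> q" "q \<le> 1"
    using p by (cases col; simp add: q)+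
  have F1: "1 / M \<le> F" "F \<le> 1"
  proof -
    have "2 * M * x \<le> 2 * M * (1 / D)" using x M0 by (intro mult_left_mono) auto
    also have "\<dots> \<le> 1 / M"
    proof -
      have "2 * (M * M) \<le> D" using D1(3) mult_pos_pos[OF M0 M0] unfolding power2_eq_square by linarith
      then show ?thesis using D0 M0 by (simp add: field_simps)
    qed
    finally show "1 / M \<le> F" using Fq ip qp by linarith
    show "F \<le> 1" by (simp add: F_def Phi_le_1)
  qed
  have F0: "0 < F" by (simp add: F_def Phi_pos)
  have even_density: "phi b = phi c"
    by (cases col) (auto simp: b_def \<epsilon>_def colour_sign_def std_normal_density_even)
  have f01: "0 \<le> phi c" "phi c \<le> 1"
    by (simp_all add: std_normal_density_le_1)
  have HM: "0 < H" "H \<le> M"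
  proof -
    show "0 < H" unfolding H_def by (rule hazard_pos)
    have "phi b \<le> M * F"
      using F1 M0 std_normal_density_le_1[of b] by (simp add: field_simps)
    then show "H \<le> M" using F0 by (simp add: H_def hazard_def F_def[symmetric] divide_le_eq)
  qed
  have bM: "\<bar>b\<bar> \<le> M"
    using c by (cases col) (auto simp: b_def \<epsilon>_def colour_sign_def)
  have rk: "real r / sqrt (real k) \<le> 4 * M / D"
  proof -
    have "real r / sqrt (real k) \<le> (2 * M * real l) / (D * real l / 2)"
      using r2 sk Dl by (intro frac_le) auto
    also have "\<dots> = 4 * M / D" using l0 by simp
    finally show ?thesis .
  qed
  have rk2: "(real r / sqrt (real k))\<^sup>2 \<le> 16 * M\<^sup>2 * x"
  proof -
    have "(real r / sqrt (real k))\<^sup>2 \<le> (4 * M / D)\<^sup>2"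
      using rk by (intro power_mono) auto
    then show ?thesis by (simp add: x_def power_divide power_mult_distrib)
  qed
  have \<tau>eq: "\<tau> = (alpha_C C)\<^sup>2 * real l / real k"
    by (simp add: \<tau>_def power_divide power_mult_distrib)
  have \<tau>le: "\<tau> \<le> 2 * M * x / real l"
  proof -
    have "\<tau> \<le> M * real l / (D\<^sup>2 * (real l)\<^sup>2 / 2)"
      unfolding \<tau>eq using M kD D0 l0 by (intro frac_le mult_right_mono) auto
    also have "\<dots> = 2 * M * x / real l"
      using D0 l0 by (simp add: x_def power2_eq_square field_simps)
    finally show ?thesis .
  qed
  have Mx: "4 * M\<^sup>2 * x \<le> 1"
  proof -
    have "4 * M\<^sup>2 \<le> D\<^sup>2" using D1(3) DD(1) M0 zero_le_power2[of M] by linarith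
    then show ?thesis using D0 by (simp add: x_def divide_le_eq)
  qed
  have \<tau>: "0 \<le> \<tau>" "\<tau> \<le> 1 / 4" "real r * \<tau> \<le> w" "w \<le> 1"
  proof -
    show "0 \<le> \<tau>" by (simp add: \<tau>_def)
    show "w \<le> 1" using Mx by (simp add: w_def)
    have "real r * \<tau> \<le> (2 * M * real l) * (2 * M * x / real l)"
      using r2 \<tau>le \<open>0 \<le> \<tau>\<close> by (intro mult_mono) auto
    also have "\<dots> = w" using l0 by (simp add: w_def power2_eq_square)
    finally show rw: "real r * \<tau> \<le> w" .
    have "4 * \<tau> \<le> real r * \<tau>"
      using r2 l1 \<open>0 \<le> \<tau>\<close> by (intro mult_right_mono) auto
    then show "\<tau> \<le> 1 / 4" using rw \<open>w \<le> 1\<close> by linarith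
  qed
  have \<epsilon>: "\<epsilon> = 1 \<or> \<epsilon> = - 1" by (cases col) (auto simp: \<epsilon>_def colour_sign_def)
  define E where "E = row_error k b r w \<delta>"
  define n where "n = r choose 2"
  have E: "E \<le> real r * (126 * M ^ 6 * x)"
    unfolding E_def using HM bM x \<delta> rk2 M by (intro row_error_le) (auto simp: H_def w_def)
  have n: "real n = real r * (real r - 1) / 2"
    using choose_two[of r] r2 unfolding n_def
    by (cases r) (auto simp: real_of_nat_div algebra_simps even_two_times_div_two)
  \<comment> \<open>(r choose 3) = (r choose 2) (r - 2) / 3, so H^3 y / 3 is the first order
    exponent per edge. In z, 505 = 504 + 1: the row errors give 504 = 4 * 126, because r^2 \<le> 4
    (r choose 2), and the factor \<open>2 ^ r\<close> gives 1.\<close>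
  define y where "y = (real r - 2) / sqrt (real k)"
  define z where "z = - \<epsilon> * H ^ 3 * y / 3 + 505 * M ^ 6 * x"
  have "ennreal (P_per col C l k p r) \<le> ennreal (2 ^ r * F ^ n *
      exp (- \<epsilon> * H ^ 3 * (real r * (real r - 1) * (real r - 2) / 6) / sqrt (real k) + real r * E))"
  proof (rule order_trans)
    show "ennreal (P_per col C l k p r) \<le> weight \<epsilon> b \<tau> k r r"
      unfolding b_def c_def \<epsilon>_def by (rule P_per_le_weight[OF \<tau>_def]) (use \<tau>(2) in linarith)
    show "weight \<epsilon> b \<tau> k r r \<le> ennreal (2 ^ r * F ^ n *
      exp (- \<epsilon> * H ^ 3 * (real r * (real r - 1) * (real r - 2) / 6) / sqrt (real k) + real r * E))"
      unfolding F_def H_def E_def n_def by (rule weight_bound[OF \<epsilon> k1 \<delta>(1,3) \<delta>k(1) \<tau>])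
  qed
  then have "P_per col C l k p r \<le> 2 ^ r * F ^ n *
      exp (- \<epsilon> * H ^ 3 * (real r * (real r - 1) * (real r - 2) / 6) / sqrt (real k) + real r * E)"
    using F0 by (subst (asm) ennreal_le_iff) auto
  also have "\<dots> \<le> F ^ n * exp (real n * z)"
  proof -
    have "(2::real) ^ r \<le> exp (real r)"
    proof -
      have "(2::real) ^ r \<le> exp 1 ^ r"
        using exp_ge_add_one_self[of 1] by (intro power_mono) auto
      then show ?thesis by (simp add: exp_of_nat_mult[symmetric])
    qed
    moreover have "real r + (- \<epsilon> * H ^ 3 * (real r * (real r - 1) * (real r - 2) / 6) / sqrt (real k) + real r * E)
        \<le> real n * z"
    proof -
      have 1: "- \<epsilon> * H ^ 3 * (real r * (real r - 1) * (real r - 2) / 6) / sqrt (real k) = real n * (- \<epsilon> * H ^ 3 * y / 3)"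
        by (simp add: n y_def)
      \<comment> \<open>This makes r at most (r choose 2) M^6 x, which absorbs the factor 2 lost at
        every point.\<close>
      have "4 * D\<^sup>2 \<le> real r - 1" using r2 l l1 DD by linarith
      then have "4 * D\<^sup>2 * x \<le> (real r - 1) * x" using x by (intro mult_right_mono) auto
      then have "4 \<le> (real r - 1) * x" using x(4) by simp
      also have "\<dots> \<le> (real r - 1) * x * M ^ 6"
        using M6 x r2 mult_left_mono[of 1 "M ^ 6" "(real r - 1) * x"] by simp
      finally have "real r * 4 \<le> real r * ((real r - 1) * x * M ^ 6)"
        by (intro mult_left_mono) auto
      then have 2: "real r \<le> real n * (M ^ 6 * x)" by (simp add: n mult_ac)
      have "real r * E \<le> real r * (real r * (126 * M ^ 6 * x))"
        using E by (intro mult_left_mono) auto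
      also have "\<dots> \<le> real r * ((2 * (real r - 1)) * (126 * M ^ 6 * x))"
        using r2 x M0 by (intro mult_left_mono mult_right_mono) auto
      also have "\<dots> = real n * (504 * M ^ 6 * x)" by (simp add: n)
      finally have 3: "real r * E \<le> real n * (504 * M ^ 6 * x)" .
      have "real n * z = real n * (- \<epsilon> * H ^ 3 * y / 3) + real n * (M ^ 6 * x) + real n * (504 * M ^ 6 * x)"
        by (simp add: z_def algebra_simps)
      with 1 2 3 show ?thesis by linarith
    qed
    ultimately have "2 ^ r * exp (- \<epsilon> * H ^ 3 * (real r * (real r - 1) * (real r - 2) / 6) / sqrt (real k) + real r * E)
        \<le> exp (real n * z)"
      by (smt (verit) exp_add exp_ge_zero exp_le_cancel_iff mult_right_mono)
    then show ?thesis
      using F0 mult_left_mono[of _ "exp (real n * z)" "F ^ n"] by (simp add: mult_ac)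
  qed
  also have "\<dots> = (F * exp z) ^ n"
    by (simp add: power_mult_distrib exp_of_nat_mult[symmetric])
  also have "\<dots> \<le> (q - \<epsilon> * phi c ^ 3 / q\<^sup>2 * ((a * real l / sqrt (real k)) / 3) + 260000 * M ^ 12 * x) ^ n"
  proof (rule power_mono)
    have y: "0 \<le> y" "y \<le> 4 * M / D"
    proof -
      show "0 \<le> y" using r2 by (simp add: y_def)
      have "y \<le> real r / sqrt (real k)" unfolding y_def by (intro divide_right_mono) auto
      then show "y \<le> 4 * M / D" using rk by linarith
    qed
    \<comment> \<open>505 from the error and 4/3 from the main term, rounded up to 507; D \<ge> 600
      M^6 then gives |z| \<le> 1.\<close>
    have zabs: "\<bar>z\<bar> \<le> 507 * M ^ 6 / D"
    proof -
      define A where "A = M ^ 6 / D"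
      have "0 \<le> H ^ 3 * y" "0 \<le> 505 * M ^ 6 * x" using HM y x M0 by auto
      then have "\<bar>z\<bar> \<le> H ^ 3 * y / 3 + 505 * M ^ 6 * x"
        using \<epsilon> unfolding z_def by (elim disjE) (simp_all add: abs_le_iff)
      moreover have "H ^ 3 * y \<le> 4 * A"
      proof -
        have "H ^ 3 * y \<le> M ^ 3 * (4 * M / D)"
          using HM y by (intro mult_mono power_mono) auto
        also have "\<dots> = 4 * (M ^ 4 / D)" by (simp add: eval_nat_numeral)
        also have "\<dots> \<le> 4 * A"
          unfolding A_def using Mpow[of 4] D0 by (intro mult_left_mono divide_right_mono) auto
        finally show ?thesis .
      qed
      moreover have "505 * M ^ 6 * x \<le> 505 * A"
        unfolding A_def using mult_left_mono[OF x(2), of "505 * M ^ 6"] M0 by simp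
      moreover have "0 \<le> A" using M0 D0 by (simp add: A_def)
      ultimately have "\<bar>z\<bar> \<le> 507 * A" by linarith
      then show ?thesis by (simp add: A_def)
    qed
    have "507 * M ^ 6 / D \<le> 1" using D D0 M6 by (simp add: divide_le_eq)
    with zabs have z1: "\<bar>z\<bar> \<le> 1" by linarith
    have z2: "z\<^sup>2 \<le> 257049 * M ^ 12 * x"
    proof -
      have "\<bar>z\<bar>\<^sup>2 \<le> (507 * M ^ 6 / D)\<^sup>2" using zabs by (intro power_mono) auto
      then show ?thesis by (simp add: x_def power_divide power_mult_distrib power_mult[symmetric])
    qed
    \<comment> \<open>Rounding a l to r costs 1 and the shift in r - 2 costs 2, both divided by sqrt
      k.\<close>
    have yR: "\<bar>y - a * real l / sqrt (real k)\<bar> \<le> 6 * x"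
    proof -
      have "y - a * real l / sqrt (real k) = (real r - 2 - a * real l) / sqrt (real k)"
        by (simp add: y_def diff_divide_distrib)
      also have "\<bar>\<dots>\<bar> \<le> 3 / sqrt (real k)"
        unfolding abs_divide using r(2) sk by (intro frac_le) auto
      also have "\<dots> \<le> 6 * x" using invk by simp
      finally show ?thesis .
    qed
    have "4 * M / D \<le> 4 * M" using D1 M0 D0 by (simp add: divide_le_eq)
    then show "F * exp z \<le> q - \<epsilon> * phi c ^ 3 / q\<^sup>2 * ((a * real l / sqrt (real k)) / 3) + 260000 * M ^ 12 * x"
      using M(1) \<epsilon> F1 f01 x(1) Fq yR y z1 z2 qp ip p r(1)
      by (intro base_estimate[where y=y])
        (auto simp: z_def H_def hazard_def F_def even_density)
    show "0 \<le> F * exp z" using F0 by simp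
  qed
  finally show ?thesis unfolding n_def x_def \<epsilon>_def c_def .
qed

lemma P_per_bound:
  fixes C p a :: real
  assumes p: "0 < p" "p < 1 / 2" and a: "1 \<le> a"
    and q: "q = (case col of Red \<Rightarrow> p | Blue \<Rightarrow> 1 - p)"
  shows "\<exists>K0. \<forall>K\<ge>K0. \<forall>D\<ge>1. \<forall>(l :: nat) (k :: nat) (r :: nat).
    10 * D ^ 4 \<le> real l \<longrightarrow> \<bar>real k - D\<^sup>2 * (real l)\<^sup>2\<bar> < 1 \<longrightarrow> \<bar>real r - a * real l\<bar> < 1 \<longrightarrow>
    P_per col C l k p r \<le> (q - colour_sign col * phi (c_kp k p) ^ 3 / q\<^sup>2
      * ((a * real l / sqrt (real k)) / 3) + K * (1 / D\<^sup>2)) ^ (r choose 2)"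
proof -
  define M where "M = Max {1, 2 / p, a, (alpha_C C)\<^sup>2, sqrt (8 / p), 1 / (1 / 2 - p)}"
  have M: "1 \<le> M" "2 / p \<le> M" "a \<le> M" "(alpha_C C)\<^sup>2 \<le> M" "sqrt (8 / p) \<le> M" "1 / (1 / 2 - p) \<le> M"
    unfolding M_def by (rule Max_ge; simp)+
  define K0 where "K0 = 260000 * M ^ 12 + (1 + M ^ 3) * (600 * M ^ 6)\<^sup>2"
  have M0: "0 < M" using M by simp
  have "1 / M \<le> p" using M(2) M0 p by (simp add: field_simps)
  moreover have qp: "p \<le> q" "q \<le> 1" using p by (cases col; simp add: q)+
  ultimately have q1: "1 / M \<le> q" "0 < q" using p by linarith+
  have \<epsilon>: "\<bar>colour_sign col\<bar> = 1" by (cases col) (auto simp: colour_sign_def)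
  have corr: "\<bar>colour_sign col * phi (c_kp k p) ^ 3 / q\<^sup>2 * ((a * real l / sqrt (real k)) / 3)\<bar> \<le> M ^ 3 / D"
    if D: "1 \<le> D" and l: "10 * D ^ 4 \<le> real l" and k: "\<bar>real k - D\<^sup>2 * (real l)\<^sup>2\<bar> < 1"
    for D and l k :: nat
  proof -
    have "1 \<le> D ^ 4" using D by simp
    then have l10: "10 \<le> real l" using l by linarith
    have "1 * (10 * 1) \<le> D\<^sup>2 * (real l * real l)"
      using D l10 by (intro mult_mono) auto
    then have "10 \<le> D\<^sup>2 * (real l)\<^sup>2" by (simp add: power2_eq_square)
    moreover have "(D * real l / 2)\<^sup>2 = D\<^sup>2 * (real l)\<^sup>2 / 4"
      by (simp add: power_mult_distrib power_divide)
    ultimately have "(D * real l / 2)\<^sup>2 \<le> real k"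
      using k by linarith
    then have sk: "D * real l / 2 \<le> sqrt (real k)" by (rule real_le_rsqrt)
    have Dl: "0 < D * real l" using D l10 by simp
    have "a * real l / sqrt (real k) \<le> (M * real l) / (D * real l / 2)"
      using sk Dl M a M0 by (intro frac_le mult_right_mono) auto
    also have "\<dots> = 2 * M / D" using l10 by simp
    finally have R: "a * real l / sqrt (real k) \<le> 2 * M / D" .
    have f3: "0 \<le> phi (c_kp k p) ^ 3" "phi (c_kp k p) ^ 3 \<le> 1"
      using std_normal_density_le_1[of "c_kp k p"] by (auto intro: power_le_one)
    have iq: "(1 / q)\<^sup>2 \<le> M\<^sup>2"
      using q1 M0 by (intro power_mono) (auto simp: field_simps)
    have "\<bar>colour_sign col * phi (c_kp k p) ^ 3 / q\<^sup>2 * ((a * real l / sqrt (real k)) / 3)\<bar>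
      = phi (c_kp k p) ^ 3 * (1 / q)\<^sup>2 * ((a * real l / sqrt (real k)) / 3)"
      using \<epsilon> f3(1) a by (simp add: abs_mult power_divide)
    also have "\<dots> \<le> 1 * M\<^sup>2 * ((2 * M / D) / 3)"
      using f3 iq R a M0 by (intro mult_mono divide_right_mono) auto
    also have "\<dots> = 2 / 3 * (M ^ 3 / D)" by (simp add: power2_eq_square power3_eq_cube)
    also have "\<dots> \<le> M ^ 3 / D"
    proof -
      have "0 \<le> M ^ 3 / D" using M0 D by simp
      then show ?thesis by linarith
    qed
    finally show ?thesis .
  qed
  have "P_per col C l k p r \<le> (q - colour_sign col * phi (c_kp k p) ^ 3 / q\<^sup>2
      * ((a * real l / sqrt (real k)) / 3) + K * (1 / D\<^sup>2)) ^ (r choose 2)"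
    if K: "K0 \<le> K" and D: "1 \<le> D" and l: "10 * D ^ 4 \<le> real l" and k: "\<bar>real k - D\<^sup>2 * (real l)\<^sup>2\<bar> < 1"
      and r: "\<bar>real r - a * real l\<bar> < 1" for K D and l k r :: nat
  proof (cases "600 * M ^ 6 \<le> D")
    case True
    define B where "B = q - colour_sign col * phi (c_kp k p) ^ 3 / q\<^sup>2
      * ((a * real l / sqrt (real k)) / 3)"
    have "260000 * M ^ 12 \<le> K" using K M0 by (auto simp: K0_def intro: order_trans[rotated])
    then have "260000 * M ^ 12 * (1 / D\<^sup>2) \<le> K * (1 / D\<^sup>2)" by (intro mult_right_mono) auto
    then have le: "B + 260000 * M ^ 12 * (1 / D\<^sup>2) \<le> B + K * (1 / D\<^sup>2)" by simp
    have "P_per col C l k p r \<le> (B + 260000 * M ^ 12 * (1 / D\<^sup>2)) ^ (r choose 2)"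
      unfolding B_def by (rule P_per_bound_large[OF p M True l k a r q])
    moreover have "0 \<le> B + 260000 * M ^ 12 * (1 / D\<^sup>2)"
    proof -
      have "M ^ 4 \<le> M ^ 6" using M(1) by (intro power_increasing) auto
      moreover have "M ^ 3 * M = M ^ 4" by (simp add: eval_nat_numeral)
      moreover have "0 \<le> M ^ 6" using M0 by simp
      ultimately have "M ^ 3 * M \<le> D" using True by linarith
      then have "M ^ 3 / D \<le> 1 / M" using M0 D by (simp add: field_simps)
      moreover have "0 \<le> 260000 * M ^ 12 * (1 / D\<^sup>2)" using M0 by simp
      ultimately show ?thesis
        using corr[OF D l k] q1 unfolding B_def by linarith
    qed
    ultimately have "P_per col C l k p r \<le> (B + K * (1 / D\<^sup>2)) ^ (r choose 2)"
      using power_mono[OF le, of "r choose 2"] by linarith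
    then show ?thesis by (simp add: B_def)
  next
    case False
    have "M ^ 3 / D \<le> M ^ 3" using D M0 by (simp add: divide_le_eq mult_le_cancel_left1)
    have D2: "D\<^sup>2 \<le> (600 * M ^ 6)\<^sup>2" using False D by (intro power_mono) auto
    have one_le: "1 + m \<le> Y \<Longrightarrow> \<bar>X\<bar> \<le> d \<Longrightarrow> d \<le> m \<Longrightarrow> 1 \<le> q - X + Y" for X Y d m :: real
      using q1(2) by linarith
    have "1 + M ^ 3 \<le> K * (1 / D\<^sup>2)"
    proof -
      have "(1 + M ^ 3) * D\<^sup>2 \<le> (1 + M ^ 3) * (600 * M ^ 6)\<^sup>2"
        using D2 M0 by (intro mult_left_mono) auto
      also have "\<dots> \<le> K" using K M0 by (auto simp: K0_def intro: order_trans[rotated])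
      finally show ?thesis using D by (simp add: pos_le_divide_eq)
    qed
    then have "1 \<le> q - colour_sign col * phi (c_kp k p) ^ 3 / q\<^sup>2
      * ((a * real l / sqrt (real k)) / 3) + K * (1 / D\<^sup>2)"
      using one_le[OF _ corr[OF D l k] \<open>M ^ 3 / D \<le> M ^ 3\<close>] by blast
    then show ?thesis
      using P_per_le_1[of col C l k p r] one_le_power order_trans by blast
  qed
  then show ?thesis by blast
qed

lemma std_normal_density_cubed:
  "(exp (- c\<^sup>2) / (2 * pi)) powr (3 / 2) = phi c ^ 3"
proof -
  have d: "0 < phi c" by (simp add: normal_density_pos)
  have "(phi c)\<^sup>2 = exp (- c\<^sup>2) / (2 * pi)"
  proof -
    have "(exp (- c\<^sup>2 / 2))\<^sup>2 = exp (- c\<^sup>2)"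
      by (simp add: power2_eq_square exp_add[symmetric])
    then show ?thesis
      by (simp add: std_normal_density_def power_mult_distrib power_divide)
  qed
  then have sq: "exp (- c\<^sup>2) / (2 * pi) = phi c powr 2"
    using less_imp_le[OF d] by (simp only: powr_numeral)
  have "(exp (- c\<^sup>2) / (2 * pi)) powr (3 / 2) = phi c powr (2 * (3 / 2))"
    unfolding sq by (rule powr_powr)
  also have "2 * (3 / 2) = (3 :: real)" by simp
  also have "phi c powr 3 = phi c ^ 3"
    using less_imp_le[OF d] by (rule powr_numeral)
  finally show ?thesis .
qed

theorem theorem9p2:
  fixes C :: real
  assumes "C > 1"
  shows "\<exists>(D0 :: real) (l0 :: real \<Rightarrow> nat). \<forall>p. p_C C < p \<and> p < 1/2 \<longrightarrow>
    (\<exists>K :: real. \<forall>D \<ge> D0. \<forall>(l :: nat) (k :: nat) (r :: nat).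
       l \<ge> l0 D \<longrightarrow> \<bar>real k - D\<^sup>2 * (real l)\<^sup>2\<bar> < 1 \<longrightarrow> \<bar>real r - C * real l\<bar> < 1 \<longrightarrow>
       (\<exists>err. \<bar>err\<bar> \<le> K * (1 / D\<^sup>2) \<and>
          P_per Red C l k p l \<le>
            (p - (exp (- (c_kp k p)\<^sup>2) / (2 * pi)) powr (3/2) * (1 / p\<^sup>2) * (real l / (3 * sqrt (real k))) + err)
              ^ (l choose 2)) \<and>
       (\<exists>err. \<bar>err\<bar> \<le> K * (1 / D\<^sup>2) \<and>
          P_per Blue C l k p r \<le>
            (1 - p + (exp (- (c_kp k p)\<^sup>2) / (2 * pi)) powr (3/2) * (C / (1 - p)\<^sup>2) * (real l / (3 * sqrt (real k))) + err)
              ^ (r choose 2)))"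
proof (rule exI[of _ "1 :: real"], rule exI[of _ "\<lambda>D. nat \<lceil>10 * D ^ 4\<rceil>"], intro allI impI)
  \<comment> \<open>The choice D0 = 1 is possible because K is chosen after p and absorbs small D;
    the bound 10 D^4 for l involves D alone.\<close>
  fix p assume "p_C C < p \<and> p < 1 / 2"
  then have p: "0 < p" "p < 1 / 2" using p_C_pos[OF assms] by auto
  have q: "p = (case Red of Red \<Rightarrow> p | Blue \<Rightarrow> 1 - p)" "1 - p = (case Blue of Red \<Rightarrow> p | Blue \<Rightarrow> 1 - p)"
    by simp_all
  obtain K1 where K1: "\<forall>K\<ge>K1. \<forall>D\<ge>1. \<forall>(l :: nat) (k :: nat) (r :: nat).
      10 * D ^ 4 \<le> real l \<longrightarrow> \<bar>real k - D\<^sup>2 * (real l)\<^sup>2\<bar> < 1 \<longrightarrow> \<bar>real r - 1 * real l\<bar> < 1 \<longrightarrow>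
      P_per Red C l k p r \<le> (p - colour_sign Red * phi (c_kp k p) ^ 3 / p\<^sup>2
      * ((1 * real l / sqrt (real k)) / 3) + K * (1 / D\<^sup>2)) ^ (r choose 2)"
    using P_per_bound[OF p order_refl q(1), of C] by blast
  obtain K2 where K2: "\<forall>K\<ge>K2. \<forall>D\<ge>1. \<forall>(l :: nat) (k :: nat) (r :: nat).
      10 * D ^ 4 \<le> real l \<longrightarrow> \<bar>real k - D\<^sup>2 * (real l)\<^sup>2\<bar> < 1 \<longrightarrow> \<bar>real r - C * real l\<bar> < 1 \<longrightarrow>
      P_per Blue C l k p r \<le> (1 - p - colour_sign Blue * phi (c_kp k p) ^ 3 / (1 - p)\<^sup>2
      * ((C * real l / sqrt (real k)) / 3) + K * (1 / D\<^sup>2)) ^ (r choose 2)"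
    using P_per_bound[OF p less_imp_le[OF assms] q(2), of C] by blast
  \<comment> \<open>Both error terms are taken to be K / D^2 itself, so K has to be
    nonnegative.\<close>
  define K where "K = max 0 (max K1 K2)"
  show "\<exists>K :: real. \<forall>D \<ge> 1. \<forall>(l :: nat) (k :: nat) (r :: nat).
       l \<ge> nat \<lceil>10 * D ^ 4\<rceil> \<longrightarrow> \<bar>real k - D\<^sup>2 * (real l)\<^sup>2\<bar> < 1 \<longrightarrow> \<bar>real r - C * real l\<bar> < 1 \<longrightarrow>
       (\<exists>err. \<bar>err\<bar> \<le> K * (1 / D\<^sup>2) \<and>
          P_per Red C l k p l \<le>
            (p - (exp (- (c_kp k p)\<^sup>2) / (2 * pi)) powr (3/2) * (1 / p\<^sup>2) * (real l / (3 * sqrt (real k))) + err)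
              ^ (l choose 2)) \<and>
       (\<exists>err. \<bar>err\<bar> \<le> K * (1 / D\<^sup>2) \<and>
          P_per Blue C l k p r \<le>
            (1 - p + (exp (- (c_kp k p)\<^sup>2) / (2 * pi)) powr (3/2) * (C / (1 - p)\<^sup>2) * (real l / (3 * sqrt (real k))) + err)
              ^ (r choose 2))"
  proof (rule exI[of _ K], intro allI impI conjI)
    fix D :: real and l k r :: nat
    assume D: "1 \<le> D" and "nat \<lceil>10 * D ^ 4\<rceil> \<le> l" and k: "\<bar>real k - D\<^sup>2 * (real l)\<^sup>2\<bar> < 1"
      and r: "\<bar>real r - C * real l\<bar> < 1"
    then have l: "10 * D ^ 4 \<le> real l" by linarith
    have err: "\<bar>K * (1 / D\<^sup>2)\<bar> \<le> K * (1 / D\<^sup>2)" by (simp add: K_def)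
    have "P_per Red C l k p l \<le> (p - phi (c_kp k p) ^ 3 * (1 / p\<^sup>2)
        * (real l / (3 * sqrt (real k))) + K * (1 / D\<^sup>2)) ^ (l choose 2)"
      using K1[rule_format, OF _ D l k, of K l] by (simp add: K_def colour_sign_def mult_ac)
    with err show "\<exists>err. \<bar>err\<bar> \<le> K * (1 / D\<^sup>2) \<and> P_per Red C l k p l \<le>
        (p - (exp (- (c_kp k p)\<^sup>2) / (2 * pi)) powr (3/2) * (1 / p\<^sup>2) * (real l / (3 * sqrt (real k))) + err) ^ (l choose 2)"
      unfolding std_normal_density_cubed by blast
    have "P_per Blue C l k p r \<le> (1 - p + phi (c_kp k p) ^ 3 * (C / (1 - p)\<^sup>2)
        * (real l / (3 * sqrt (real k))) + K * (1 / D\<^sup>2)) ^ (r choose 2)"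
      using K2[rule_format, OF _ D l k r, of K] by (simp add: K_def colour_sign_def mult_ac)
    with err show "\<exists>err. \<bar>err\<bar> \<le> K * (1 / D\<^sup>2) \<and> P_per Blue C l k p r \<le>
        (1 - p + (exp (- (c_kp k p)\<^sup>2) / (2 * pi)) powr (3/2) * (C / (1 - p)\<^sup>2) * (real l / (3 * sqrt (real k))) + err) ^ (r choose 2)"
      unfolding std_normal_density_cubed by blast
  qed
qed

end
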